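(* Let $\beta\in(0,1)$, $r>0$, $s\ge 0$ be constants, and suppose that, for each $n$, $\epsilon=n^{-\beta}$ and $\theta\in\mathbb{R}^p$, $\eta\in\mathbb{R}^q$ (with $\theta,\eta,p,q$ allowed to depend on $n$) satisfy $$\frac{2\|\theta\|\|\eta\|}{\sqrt{\|\theta\|^2+\|\eta\|^2}}=\sqrt{2r\log n},\qquad \frac{\big|\|\theta\|^2-\|\eta\|^2\big|}{\sqrt{\|\theta\|^2+\|\eta\|^2}}=\sqrt{2s\log n}.$$ Let $\beta^*(r,s)$, the test $\dot\psi$, and the risks $R_n(\psi,\theta,\eta,\epsilon)$, $R_n(\theta,\eta,\epsilon)$ be as defined in the context. If $\beta<\beta^*(r,s)$, then $\lim_{n\to\infty}R_n(\dot\psi,\theta,\eta,\epsilon)=0$. Moreover, if $\beta>\beta^*(r,s)$, then $\liminf_{n\to\infty}R_n(\theta,\eta,\epsilon)>0$.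
   Context: Model: for $z,\sigma\in\{-1,1\}^n$, $P^{(n)}_{(\theta,\eta,z,\sigma)}$ is the joint law of independent $X_i\sim N(z_i\theta,I_p)$, $Y_i\sim N(\sigma_i\eta,I_q)$, $i\in[n]$. Write $a\wedge b=\min(a,b)$ and $$\ell(z,\sigma)=\Big(\frac1n\sum_{i=1}^n\mathbf 1\{z_i\ne\sigma_i\}\Big)\wedge\Big(\frac1n\sum_{i=1}^n\mathbf 1\{z_i\ne-\sigma_i\}\Big).$$ For a test $\psi$ (measurable function of the data with values in $[0,1]$; $P\psi$ denotes expectation of $\psi$ under $P$), the worst-case testing error for $H_0:\ell(z,\sigma)=0$ vs. $H_1:\ell(z,\sigma)>\epsilon$ is $$R_n(\psi,\theta,\eta,\epsilon)=\sup_{z,\sigma\in\{-1,1\}^n:\,\ell(z,\sigma)=0}P^{(n)}_{(\theta,\eta,z,\sigma)}\psi+\sup_{z,\sigma\in\{-1,1\}^n:\,\ell(z,\sigma)>\epsilon}P^{(n)}_{(\theta,\eta,z,\sigma)}(1-\psi),$$ and $R_n(\theta,\eta,\epsilon)=\inf_\psi R_n(\psi,\theta,\eta,\epsilon)$ (the test may depend on $\theta,\eta$). Threshold function: with $A=r+s-\sqrt s\sqrt{r+s}$, $$\beta^*(r,s)=\begin{cases}\frac12+2A, & 3s>r \text{ and } A\le\frac18,\\ \frac12(1+3r-s), & 3s\le r\text{ and }5r+s\le1,\\ 2\sqrt r\sqrt{1-r-s}, & 5r+s>1,\ \frac18<A\le\frac12,\ 2(1-r-s)A>r,\\ 2\sqrt{2A}-2A,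 & 5r+s>1,\ \frac18<A\le\frac12,\ 2(1-r-s)A\le r,\\ 1, & A>\frac12.\end{cases}$$ Test: let $S_{(r,s)}(t)=\mathbb P\big(|\sqrt rU+\sqrt sV|-\sqrt{r+s}|V|>t\big)$, where $(U,V)\sim\frac12N(0,1)\otimes N(-\sqrt{2(r+s)\log n},1)+\frac12N(0,1)\otimes N(\sqrt{2(r+s)\log n},1)$. Let $C^-(X_i,Y_i,\theta,\eta)=|\theta^TX_i-\eta^TY_i|-|\theta^TX_i+\eta^TY_i|$ and $C^+(X_i,Y_i,\theta,\eta)=|\theta^TX_i+\eta^TY_i|-|\theta^TX_i-\eta^TY_i|$, and $$\dot T_n^{\pm}=\sup_{t\in\mathbb R}\frac{\left|\sum_{i=1}^n\mathbf 1\{C^{\pm}(X_i,Y_i,\theta,\eta)>t\sqrt{2\log n}\}-nS_{(r,s)}(t)\right|}{\sqrt{nS_{(r,s)}(t)(1-S_{(r,s)}(t))}}.$$ Then $\dot\psi=\mathbf 1\{\dot T_n^-\wedge\dot T_n^+>\sqrt{2(1+\delta)\log\log n}\}$, where $\delta>0$ is an arbitrary fixed constant. *)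

theory Defs
  imports "HOL-Probability.Probability"
begin

text \<open>
  The dimensions \<open>p\<close> and \<open>q\<close> may vary with the sample size \<open>n\<close>, so a vector in \<open>p\<close>-dimensional
  Euclidean space is a function on \<open>{..<p}\<close>, with Euclidean norm given by \<^const>\<open>L2_set\<close>; samples
  are indexed by \<open>{..<n}\<close>, and a data point is a function \<open>x\<close> on \<open>{..<n}\<close> with \<open>x i\<close> the pair of
  the \<open>i\<close>-th \<open>X\<close>- and \<open>Y\<close>-observations.
\<close>

definition normal_law :: "real \<Rightarrow> real measure" where
  "normal_law m = density lborel (\<lambda>x. ennreal (normal_density m 1 x))"

text \<open>The normal law with mean vector \<open>m\<close> and identity covariance matrix.\<close>

definition std_normal_vec :: "nat \<Rightarrow> (nat \<Rightarrow> real) \<Rightarrow> (nat \<Rightarrow> real) measure" where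
  "std_normal_vec d m = PiM {..<d} (\<lambda>j. normal_law (m j))"

type_synonym data = "nat \<Rightarrow> (nat \<Rightarrow> real) \<times> (nat \<Rightarrow> real)"

definition labels :: "nat \<Rightarrow> (nat \<Rightarrow> real) set" where
  "labels n = {..<n} \<rightarrow>\<^sub>E {-1, 1}"

definition joint_law ::
  "nat \<Rightarrow> nat \<Rightarrow> nat \<Rightarrow> (nat \<Rightarrow> real) \<Rightarrow> (nat \<Rightarrow> real) \<Rightarrow> (nat \<Rightarrow> real) \<Rightarrow> (nat \<Rightarrow> real) \<Rightarrow> data measure"
where
  "joint_law n p q \<theta> \<eta> z \<sigma> =
     PiM {..<n} (\<lambda>i. std_normal_vec p (\<lambda>j. z i * \<theta> j) \<Otimes>\<^sub>M std_normal_vec q (\<lambda>j. \<sigma> i * \<eta> j))"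

definition label_dist :: "nat \<Rightarrow> (nat \<Rightarrow> real) \<Rightarrow> (nat \<Rightarrow> real) \<Rightarrow> real" where
  "label_dist n z \<sigma> =
     min ((1 / real n) * (\<Sum>i<n. of_bool (z i \<noteq> \<sigma> i))) ((1 / real n) * (\<Sum>i<n. of_bool (z i \<noteq> - \<sigma> i)))"

definition data_space :: "nat \<Rightarrow> nat \<Rightarrow> nat \<Rightarrow> data measure" where
  "data_space n p q =
     PiM {..<n} (\<lambda>_. PiM {..<p} (\<lambda>_. borel) \<Otimes>\<^sub>M PiM {..<q} (\<lambda>_. borel))"

definition tests :: "nat \<Rightarrow> nat \<Rightarrow> nat \<Rightarrow> (data \<Rightarrow> real) set" where
  "tests n p q =
     {\<psi> \<in> borel_measurable (data_space n p q). \<forall>x\<in>space (data_space n p q). 0 \<le> \<psi> x \<and> \<psi> x \<le> 1}"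

text \<open>
  The risk takes values in \<^typ>\<open>ennreal\<close>, so that the supremum over an empty alternative, which
  occurs only for small \<open>n\<close>, is \<open>0\<close>.
\<close>

definition test_risk ::
  "nat \<Rightarrow> nat \<Rightarrow> nat \<Rightarrow> (data \<Rightarrow> real) \<Rightarrow> (nat \<Rightarrow> real) \<Rightarrow> (nat \<Rightarrow> real) \<Rightarrow> real \<Rightarrow> ennreal"
where
  "test_risk n p q \<psi> \<theta> \<eta> \<epsilon> =
     (SUP (z, \<sigma>) \<in> {(z, \<sigma>). z \<in> labels n \<and> \<sigma> \<in> labels n \<and> label_dist n z \<sigma> = 0}.
        \<integral>\<^sup>+ x. ennreal (\<psi> x) \<partial>joint_law n p q \<theta> \<eta> z \<sigma>) +
     (SUP (z, \<sigma>) \<in> {(z, \<sigma>). z \<in> labels n \<and> \<sigma> \<in> labels n \<and> label_dist n z \<sigma> > \<epsilon>}.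
        \<integral>\<^sup>+ x. ennreal (1 - \<psi> x) \<partial>joint_law n p q \<theta> \<eta> z \<sigma>)"

definition minimax_risk ::
  "nat \<Rightarrow> nat \<Rightarrow> nat \<Rightarrow> (nat \<Rightarrow> real) \<Rightarrow> (nat \<Rightarrow> real) \<Rightarrow> real \<Rightarrow> ennreal"
where
  "minimax_risk n p q \<theta> \<eta> \<epsilon> = (INF \<psi> \<in> tests n p q. test_risk n p q \<psi> \<theta> \<eta> \<epsilon>)"

definition beta_A :: "real \<Rightarrow> real \<Rightarrow> real" where
  "beta_A r s = r + s - sqrt s * sqrt (r + s)"

definition beta_star :: "real \<Rightarrow> real \<Rightarrow> real" where
  "beta_star r s =
     (let A = beta_A r s in
      if 3 * s > r \<and> A \<le> 1/8 then 1/2 + 2 * A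
      else if 3 * s \<le> r \<and> 5 * r + s \<le> 1 then (1 + 3 * r - s) / 2
      else if 5 * r + s > 1 \<and> 1/8 < A \<and> A \<le> 1/2 \<and> 2 * (1 - r - s) * A > r
        then 2 * sqrt r * sqrt (1 - r - s)
      else if 5 * r + s > 1 \<and> 1/8 < A \<and> A \<le> 1/2 \<and> 2 * (1 - r - s) * A \<le> r
        then 2 * sqrt (2 * A) - 2 * A
      else 1)"

text \<open>
  The conditions of the first four branches are mutually exclusive, and the last branch is
  exactly the case \<open>A > 1/2\<close>:
\<close>

lemma beta_star_last_case:
  fixes r s :: real
  assumes "r > 0" "s \<ge> 0"
  defines "A \<equiv> beta_A r s"
  shows "A > 1/2 \<longleftrightarrow>
     \<not> (3 * s > r \<and> A \<le> 1/8) \<and> \<not> (3 * s \<le> r \<and> 5 * r + s \<le> 1) \<and>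
     \<not> (5 * r + s > 1 \<and> 1/8 < A \<and> A \<le> 1/2)"
proof -
  define a b where "a = sqrt (r + s)" and "b = sqrt s"
  have sq: "s = b\<^sup>2" "r = a\<^sup>2 - b\<^sup>2" and b: "0 \<le> b" and ab: "b < a"
    using assms by (simp_all add: a_def b_def)
  have A: "A = a\<^sup>2 - a * b"
    unfolding A_def beta_A_def using sq by (simp add: a_def b_def)
  have key: "8 * A - (5 * r + s) = (3 * a - 2 * b) * (a - 2 * b)"
    unfolding A sq by (simp add: algebra_simps power2_eq_square)
  have pos: "3 * a - 2 * b > 0" using b ab by linarith
  have iff: "3 * s > r \<longleftrightarrow> a < 2 * b"
    using abs_le_square_iff[of "2 * b" a] b ab by (auto simp: sq power_mult_distrib)
  have le: "8 * A \<ge> 5 * r + s" if "3 * s \<le> r"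
  proof -
    have "0 \<le> (3 * a - 2 * b) * (a - 2 * b)" using that iff pos by simp
    then show ?thesis using key by linarith
  qed
  have gt: "8 * A < 5 * r + s" if "3 * s > r"
  proof -
    have "(3 * a - 2 * b) * (a - 2 * b) < 0" using that iff pos by (simp add: mult_pos_neg)
    then show ?thesis using key by linarith
  qed
  have "5 * r + s \<ge> 2 * A" if "3 * s \<le> r"
  proof -
    have "0 \<le> a * b" using b ab by simp
    moreover have "4 * b\<^sup>2 \<le> a\<^sup>2" using that unfolding sq by linarith
    moreover have "0 \<le> a\<^sup>2" by simp
    ultimately show ?thesis unfolding A sq right_diff_distrib by linarith
  qed
  then show ?thesis using le gt by linarith
qed

text \<open>
  \<open>S_tail n r s t\<close> integrates over the equal-weight mixture of the two product laws of \<open>(U, V)\<close>.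
\<close>

definition S_tail :: "nat \<Rightarrow> real \<Rightarrow> real \<Rightarrow> real \<Rightarrow> real" where
  "S_tail n r s t =
     (let m = sqrt (2 * (r + s) * ln (real n));
          E = {(u, v). \<bar>sqrt r * u + sqrt s * v\<bar> - sqrt (r + s) * \<bar>v\<bar> > t}
      in 1/2 * measure (normal_law 0 \<Otimes>\<^sub>M normal_law (- m)) E +
         1/2 * measure (normal_law 0 \<Otimes>\<^sub>M normal_law m) E)"

definition dot :: "nat \<Rightarrow> (nat \<Rightarrow> real) \<Rightarrow> (nat \<Rightarrow> real) \<Rightarrow> real" where
  "dot d a b = (\<Sum>j<d. a j * b j)"

definition C_minus ::
  "nat \<Rightarrow> nat \<Rightarrow> (nat \<Rightarrow> real) \<Rightarrow> (nat \<Rightarrow> real) \<Rightarrow> (nat \<Rightarrow> real) \<times> (nat \<Rightarrow> real) \<Rightarrow> real"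
where
  "C_minus p q \<theta> \<eta> = (\<lambda>(X, Y). \<bar>dot p \<theta> X - dot q \<eta> Y\<bar> - \<bar>dot p \<theta> X + dot q \<eta> Y\<bar>)"

definition C_plus ::
  "nat \<Rightarrow> nat \<Rightarrow> (nat \<Rightarrow> real) \<Rightarrow> (nat \<Rightarrow> real) \<Rightarrow> (nat \<Rightarrow> real) \<times> (nat \<Rightarrow> real) \<Rightarrow> real"
where
  "C_plus p q \<theta> \<eta> = (\<lambda>(X, Y). \<bar>dot p \<theta> X + dot q \<eta> Y\<bar> - \<bar>dot p \<theta> X - dot q \<eta> Y\<bar>)"

definition hc_stat ::
  "nat \<Rightarrow> real \<Rightarrow> real \<Rightarrow> ((nat \<Rightarrow> real) \<times> (nat \<Rightarrow> real) \<Rightarrow> real) \<Rightarrow> data \<Rightarrow> ereal"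
where
  "hc_stat n r s C x =
     (SUP t \<in> (UNIV :: real set). ereal
        (\<bar>(\<Sum>i<n. of_bool (C (x i) > t * sqrt (2 * ln (real n)))) - real n * S_tail n r s t\<bar> /
         sqrt (real n * S_tail n r s t * (1 - S_tail n r s t))))"

definition psi_dot ::
  "nat \<Rightarrow> nat \<Rightarrow> nat \<Rightarrow> real \<Rightarrow> real \<Rightarrow> real \<Rightarrow> (nat \<Rightarrow> real) \<Rightarrow> (nat \<Rightarrow> real) \<Rightarrow> data \<Rightarrow> real"
where
  "psi_dot n p q r s \<delta> \<theta> \<eta> x =
     of_bool (min (hc_stat n r s (C_minus p q \<theta> \<eta>) x) (hc_stat n r s (C_plus p q \<theta> \<eta>) x)
              > ereal (sqrt (2 * (1 + \<delta>) * ln (ln (real n)))))"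

end

theory Submission
  imports Defs "HOL-Real_Asymp.Real_Asymp"
begin

text \<open>
  For an observation with matching labels, \<open>C_minus / sqrt (2 ln n)\<close> has tail \<open>S_tail\<close>, and mismatching
  labels reflect its law at \<open>0\<close>. Under the null hypothesis one of the two statistics is therefore the supremum of
  a standardized empirical process. Doob's inequality for the martingale
  \<open>(N - n S) / (1 - S)\<close>, applied on blocks on which the odds of \<open>S\<close> grow by a factor close to
  \<open>1\<close>, bounds this supremum by \<open>sqrt (2 (1 + \<delta>) ln ln n)\<close>. Under the alternative a single threshold of order
  \<open>sqrt (2 ln n)\<close> suffices: up to factors \<open>n\<close> to the power \<open>o(1)\<close>, its optimal position gives \<open>beta_star\<close>.

  For the lower bound, labels drawn independently with mismatch probability of order
  \<open>\<epsilon>\<close> make the observations independent and identically distributed under both hypotheses. Their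
  Hellinger distance is at most \<open>\<epsilon>\<close> to the power \<open>\<rho>\<close> times the \<open>\<rho>\<close>-th moment of the likelihood ratio,
  \<open>1 \<le> \<rho> \<le> 2\<close>, and the likelihood ratio is at most \<open>2 exp C_minus\<close>. Convex duality between the
  threshold and the moment makes the two exponents agree.
\<close>


section \<open>Projections and rotations of Gaussian vectors\<close>

text \<open>At a threshold where \<open>C_minus\<close> is 2 \<tau> ln n, the likelihood ratio of a
  mismatched to a matched observation is about n to the power 2 \<tau>, so the two tail exponents
  differ by 2 \<tau>. The matched one is the Legendre transform in \<rho> of
  \<open>mgf_exponent\<close>, with 2 \<tau> as its derivative. As long as matched observations
  above the best threshold still occur in the sample, the second moment of the likelihood ratio
  decides and \<rho> = 2. Beyond that point the second moment is dominated by values that no matched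
  observation in the sample attains; lowering \<rho> until the matched exponent is 1 takes the place
  of a truncation, and \<rho> = 1 is reached when \<open>beta_star\<close> becomes 1. The iterated
  logarithm in the level of the test counts blocks: n times the odds grows up to n, so about ln n
  blocks of constant ratio must all stay below the level x, and each fails with probability about
  exp (- x^2 / 2).\<close>

lemma sets_normal_law [simp, measurable_cong]: "sets (normal_law m) = sets borel"
  and space_normal_law [simp]: "space (normal_law m) = UNIV"
  by (simp_all add: normal_law_def)

lemma prob_space_normal_law: "prob_space (normal_law m)"
  unfolding normal_law_def by (rule prob_space_normal_density) simp

lemma distr_normal_law_uminus: "distr (normal_law m) borel uminus = normal_law (- m)"
proof (rule measure_eqI)
  fix B assume "B \<in> sets (distr (normal_law m) borel uminus)"
  then have [measurable]: "B \<in> sets borel" by simp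
  have "emeasure (distr (normal_law m) borel uminus) B =
      (\<integral>\<^sup>+x. indicator B (- x) * ennreal (normal_density m 1 x) \<partial>lborel)"
    by (subst nn_integral_indicator[symmetric], simp, subst nn_integral_distr)
       (simp_all add: normal_law_def nn_integral_density mult.commute)
  also have "\<dots> = (\<integral>\<^sup>+x. indicator B x * ennreal (normal_density m 1 (- x)) \<partial>lborel)"
    using nn_integral_real_affine[of "\<lambda>x. indicator B (- x) * ennreal (normal_density m 1 x)" "-1" 0] by simp
  also have "\<dots> = emeasure (normal_law (- m)) B"
    by (subst nn_integral_indicator[symmetric], simp)
       (simp add: normal_law_def emeasure_density nn_integral_density mult.commute normal_density_def power2_eq_square algebra_simps)
  finally show "emeasure (distr (normal_law m) borel uminus) B = emeasure (normal_law (- m)) B" .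
qed simp

lemma normal_law_mgf:
  "(\<integral>\<^sup>+x. ennreal (exp (h * x)) \<partial>normal_law m) = ennreal (exp (h * m + h\<^sup>2 / 2))"
proof -
  have "(\<integral>\<^sup>+x. ennreal (exp (h * x)) \<partial>normal_law m)
      = (\<integral>\<^sup>+x. ennreal (normal_density m 1 x) * ennreal (exp (h * x)) \<partial>lborel)"
    by (simp add: normal_law_def nn_integral_density)
  also have "\<dots> = (\<integral>\<^sup>+x. ennreal (exp (h * m + h\<^sup>2 / 2)) * ennreal (normal_density (m + h) 1 x) \<partial>lborel)"
  proof (intro nn_integral_cong)
    fix x
    have "- (x - m)\<^sup>2 / 2 + h * x = h * m + h\<^sup>2 / 2 + - (x - (m + h))\<^sup>2 / 2"
      by (simp add: power2_eq_square field_simps)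
    then have "exp (- (x - m)\<^sup>2 / 2) * exp (h * x) = exp (h * m + h\<^sup>2 / 2) * exp (- (x - (m + h))\<^sup>2 / 2)"
      by (simp flip: exp_add)
    then show "ennreal (normal_density m 1 x) * ennreal (exp (h * x)) =
        ennreal (exp (h * m + h\<^sup>2 / 2)) * ennreal (normal_density (m + h) 1 x)"
      by (simp add: normal_density_def flip: ennreal_mult)
  qed
  also have "\<dots> = ennreal (exp (h * m + h\<^sup>2 / 2)) * emeasure (normal_law (m + h)) UNIV"
    by (subst nn_integral_cmult) (simp_all add: normal_law_def emeasure_density)
  also have "emeasure (normal_law (m + h)) UNIV = 1"
    using prob_space.emeasure_space_1[OF prob_space_normal_law, of "m + h"] by simp
  finally show ?thesis by simp
qed

lemma pair_normal_law_density:
  "normal_law a \<Otimes>\<^sub>M normal_law b = density (lborel \<Otimes>\<^sub>M lborel)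
     (\<lambda>(x, y). ennreal (normal_density a 1 x * normal_density b 1 y))"
  unfolding normal_law_def
  by (subst pair_measure_density)
     (auto simp: ennreal_mult intro!: sigma_finite_lborel prob_space_imp_sigma_finite prob_space_normal_density)

text \<open>The rotation is a composition of two one-dimensional substitutions: in x for fixed y,
  with factor 1 / \<bar>c\<bar>, and after Fubini in y for fixed x, with factor \<bar>c\<bar>. The
  factors cancel; the division by \<open>c\<close> excludes quarter turns.\<close>

lemma nn_integral_pair_rotation:
  fixes c s :: real and f :: "real \<times> real \<Rightarrow> ennreal"
  assumes cs: "c\<^sup>2 + s\<^sup>2 = 1" "c \<noteq> 0"
    and [measurable]: "f \<in> borel_measurable (borel \<Otimes>\<^sub>M borel)"
  shows "(\<integral>\<^sup>+p. f (c * fst p - s * snd p, s * fst p + c * snd p) \<partial>(lborel \<Otimes>\<^sub>M lborel))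
       = (\<integral>\<^sup>+p. f p \<partial>(lborel \<Otimes>\<^sub>M lborel))"
proof -
  have 1: "s * (s * y + x) / c + c * y = (s * x + y) / c" for x y
  proof -
    have "s * (s * y + x) + c * c * y = (c\<^sup>2 + s\<^sup>2) * y + s * x" by (simp add: power2_eq_square algebra_simps)
    then show ?thesis using cs by (simp add: field_simps)
  qed
  have "(\<integral>\<^sup>+p. f (c * fst p - s * snd p, s * fst p + c * snd p) \<partial>(lborel \<Otimes>\<^sub>M lborel))
      = (\<integral>\<^sup>+y. \<integral>\<^sup>+x. f (c * x - s * y, s * x + c * y) \<partial>lborel \<partial>lborel)"
    by (subst lborel_pair.nn_integral_snd[symmetric]) (auto simp: case_prod_beta)
  also have "\<dots> = (\<integral>\<^sup>+y. \<bar>1/c\<bar> * (\<integral>\<^sup>+x. f (x, s / c * x + 1 / c * y) \<partial>lborel) \<partial>lborel)"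
  proof (intro nn_integral_cong, goal_cases)
    case (1 y)
    have "(\<integral>\<^sup>+x. f (c * x - s * y, s * x + c * y) \<partial>lborel)
        = \<bar>1/c\<bar> * (\<integral>\<^sup>+x. f (c * (s * y / c + 1/c * x) - s * y, s * (s * y / c + 1/c * x) + c * y) \<partial>lborel)"
      using cs by (intro nn_integral_real_affine[where f="\<lambda>x. f (c * x - s * y, s * x + c * y)"]) auto
    also have "(\<lambda>x. f (c * (s * y / c + 1/c * x) - s * y, s * (s * y / c + 1/c * x) + c * y))
        = (\<lambda>x. f (x, s / c * x + 1 / c * y))"
    proof
      fix x
      have "c * (s * y / c + 1/c * x) - s * y = x" using cs by (simp add: field_simps)
      moreover have "s * (s * y / c + 1/c * x) + c * y = s / c * x + 1 / c * y"
        using \<open>s * (s * y + x) / c + c * y = (s * x + y) / c\<close> cs by (simp add: field_simps)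
      ultimately show "f (c * (s * y / c + 1/c * x) - s * y, s * (s * y / c + 1/c * x) + c * y)
          = f (x, s / c * x + 1 / c * y)" by simp
    qed
    finally show ?case .
  qed
  also have "\<dots> = \<bar>1/c\<bar> * (\<integral>\<^sup>+y. \<integral>\<^sup>+x. f (x, s / c * x + 1 / c * y) \<partial>lborel \<partial>lborel)"
    by (subst nn_integral_cmult) auto
  also have "(\<integral>\<^sup>+y. \<integral>\<^sup>+x. f (x, s / c * x + 1 / c * y) \<partial>lborel \<partial>lborel)
      = (\<integral>\<^sup>+x. \<integral>\<^sup>+y. f (x, s / c * x + 1 / c * y) \<partial>lborel \<partial>lborel)"
    by (subst lborel_pair.Fubini'[where f="\<lambda>x y. f (x, s / c * x + 1 / c * y)"]) auto
  also have "\<dots> = (\<integral>\<^sup>+x. \<bar>c\<bar> * (\<integral>\<^sup>+y. f (x, y) \<partial>lborel) \<partial>lborel)"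
  proof (intro nn_integral_cong, goal_cases)
    case (1 x)
    have "(\<integral>\<^sup>+y. f (x, s / c * x + 1 / c * y) \<partial>lborel) =
        \<bar>c\<bar> * (\<integral>\<^sup>+y. f (x, s / c * x + 1 / c * (- s * x + c * y)) \<partial>lborel)"
      using cs by (intro nn_integral_real_affine[where f="\<lambda>y. f (x, s / c * x + 1 / c * y)"]) auto
    then show ?case using cs by (simp add: field_simps)
  qed
  also have "\<dots> = \<bar>c\<bar> * (\<integral>\<^sup>+x. \<integral>\<^sup>+y. f (x, y) \<partial>lborel \<partial>lborel)"
    by (subst nn_integral_cmult) auto
  also have "\<bar>1/c\<bar> * (\<bar>c\<bar> * (\<integral>\<^sup>+x. \<integral>\<^sup>+y. f (x, y) \<partial>lborel \<partial>lborel)) = (\<integral>\<^sup>+x. \<integral>\<^sup>+y. f (x, y) \<partial>lborel \<partial>lborel)"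
    using cs by (simp flip: mult.assoc ennreal_mult)
  also have "\<dots> = (\<integral>\<^sup>+p. f p \<partial>(lborel \<Otimes>\<^sub>M lborel))"
    by (subst lborel.nn_integral_fst) auto
  finally show ?thesis .
qed

text \<open>A Gaussian density with identity covariance depends only on the distance to the mean,
  which a rotation preserves.\<close>

lemma normal_law_rotation:
  fixes c s a b :: real
  assumes cs: "c\<^sup>2 + s\<^sup>2 = 1" "c \<noteq> 0"
  shows "distr (normal_law a \<Otimes>\<^sub>M normal_law b) (borel \<Otimes>\<^sub>M borel) (\<lambda>(x, y). (c * x - s * y, s * x + c * y))
       = normal_law (c * a - s * b) \<Otimes>\<^sub>M normal_law (s * a + c * b)" (is "?L = ?R")
proof (rule measure_eqI)
  fix B assume "B \<in> sets ?L"
  then have [measurable]: "B \<in> sets (borel \<Otimes>\<^sub>M borel)" by simp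
  have dens: "normal_density a 1 x * normal_density b 1 y =
     normal_density (c * a - s * b) 1 (c * x - s * y) * normal_density (s * a + c * b) 1 (s * x + c * y)" for x y
  proof -
    have "(x - a)\<^sup>2 + (y - b)\<^sup>2 = (c\<^sup>2 + s\<^sup>2) * ((x - a)\<^sup>2 + (y - b)\<^sup>2)" using cs by simp
    also have "\<dots> = (c * x - s * y - (c * a - s * b))\<^sup>2 + (s * x + c * y - (s * a + c * b))\<^sup>2"
      by algebra
    finally have "exp (- (x - a)\<^sup>2 / 2) * exp (- (y - b)\<^sup>2 / 2) =
        exp (- (c * x - s * y - (c * a - s * b))\<^sup>2 / 2) * exp (- (s * x + c * y - (s * a + c * b))\<^sup>2 / 2)"
      by (simp flip: exp_add add: field_simps)
    then show ?thesis by (simp add: normal_density_def)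
  qed
  have "emeasure ?L B = (\<integral>\<^sup>+p. indicator B (c * fst p - s * snd p, s * fst p + c * snd p)
       * ennreal (normal_density a 1 (fst p) * normal_density b 1 (snd p)) \<partial>(lborel \<Otimes>\<^sub>M lborel))"
    by (subst nn_integral_indicator[symmetric], simp, subst nn_integral_distr)
       (simp_all add: pair_normal_law_density nn_integral_density mult.commute case_prod_beta)
  also have "\<dots> = (\<integral>\<^sup>+p. (\<lambda>q. indicator B q * ennreal (normal_density (c * a - s * b) 1 (fst q) * normal_density (s * a + c * b) 1 (snd q)))
      (c * fst p - s * snd p, s * fst p + c * snd p) \<partial>(lborel \<Otimes>\<^sub>M lborel))"
    by (simp add: dens)
  also have "\<dots> = (\<integral>\<^sup>+q. indicator B q * ennreal (normal_density (c * a - s * b) 1 (fst q) * normal_density (s * a + c * b) 1 (snd q)) \<partial>(lborel \<Otimes>\<^sub>M lborel))"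
    by (rule nn_integral_pair_rotation[OF cs]) simp
  also have "\<dots> = emeasure ?R B"
    by (subst nn_integral_indicator[symmetric], simp)
       (simp add: pair_normal_law_density emeasure_density nn_integral_density mult.commute case_prod_beta)
  finally show "emeasure ?L B = emeasure ?R B" .
qed (simp cong: sets_pair_measure_cong)

section \<open>Linear functionals of a Gaussian vector\<close>

lemma sets_std_normal_vec [measurable_cong]: "sets (std_normal_vec d m) = sets (PiM {..<d} (\<lambda>_. borel))"
  unfolding std_normal_vec_def by (intro sets_PiM_cong) auto

lemma prob_space_std_normal_vec: "prob_space (std_normal_vec d m)"
  unfolding std_normal_vec_def by (intro prob_space_PiM prob_space_normal_law)

lemma measurable_dot [measurable]: "dot d a \<in> borel_measurable (PiM {..<d} (\<lambda>_. borel))"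
  unfolding dot_def[abs_def] by measurable

lemma L2_set_dot: "(L2_set a {..<d})\<^sup>2 = dot d a a"
  by (simp add: L2_set_def dot_def power2_eq_square sum_nonneg)

lemma distributed_normal_law: "prob_space M \<Longrightarrow> X \<in> borel_measurable M \<Longrightarrow>
   distributed M lborel X (normal_density m 1) \<longleftrightarrow> distr M borel X = normal_law m"
  unfolding distributed_def normal_law_def by (auto cong: distr_cong)

lemma distr_std_normal_vec_component:
  assumes "j < d" shows "distr (std_normal_vec d m) borel (\<lambda>X. X j) = normal_law (m j)"
proof -
  have "distr (std_normal_vec d m) (normal_law (m j)) (\<lambda>X. X j) = normal_law (m j)"
    unfolding std_normal_vec_def
    by (rule distr_PiM_component) (use assms in \<open>auto intro: prob_space_normal_law\<close>)
  then show ?thesis by (simp cong: distr_cong)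
qed


lemma indep_vars_std_normal_vec:
  assumes "d > 0"
  shows "prob_space.indep_vars (std_normal_vec d m) (\<lambda>_. borel) (\<lambda>j X. X j) {..<d}"
proof -
  interpret prob_space "std_normal_vec d m" by (rule prob_space_std_normal_vec)
  have "distr (std_normal_vec d m) (\<Pi>\<^sub>M i\<in>{..<d}. borel) (\<lambda>x. \<lambda>i\<in>{..<d}. x i)
      = distr (std_normal_vec d m) (std_normal_vec d m) (\<lambda>x. x)"
    by (intro distr_cong) (auto simp: sets_std_normal_vec[unfolded std_normal_vec_def] std_normal_vec_def space_PiM PiE_restrict)
  also have "\<dots> = (\<Pi>\<^sub>M i\<in>{..<d}. normal_law (m i))"
    by (simp add: distr_id std_normal_vec_def)
  also have "\<dots> = (\<Pi>\<^sub>M i\<in>{..<d}. distr (std_normal_vec d m) borel (\<lambda>X. X i))"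
    by (intro PiM_cong) (auto simp: distr_std_normal_vec_component)
  finally show ?thesis
    using assms by (subst indep_vars_iff_distr_eq_PiM') (auto cong: measurable_cong_sets)
qed

lemma distr_dot_std_normal_vec:
  assumes a: "L2_set a {..<d} > 0"
  shows "distr (std_normal_vec d m) borel (\<lambda>X. dot d a X / L2_set a {..<d})
       = normal_law (dot d a m / L2_set a {..<d})"
proof -
  interpret prob_space "std_normal_vec d m" by (rule prob_space_std_normal_vec)
  define L where "L = L2_set a {..<d}"
  \<comment> \<open>Coordinates with coefficient zero are left out, because the rule for sums of
    independent normal variables asks for positive standard deviations.\<close>
  define I where "I = {j. j < d \<and> a j \<noteq> 0}"
  have L: "L > 0" "L\<^sup>2 = (\<Sum>j\<in>I. (a j)\<^sup>2)"
  proof -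
    have "L\<^sup>2 = (\<Sum>j<d. (a j)\<^sup>2)" by (simp add: L_def L2_set_def sum_nonneg)
    also have "\<dots> = (\<Sum>j\<in>I. (a j)\<^sup>2)" by (intro sum.mono_neutral_right) (auto simp: I_def)
    finally show "L\<^sup>2 = (\<Sum>j\<in>I. (a j)\<^sup>2)" .
  qed (use a L_def in simp)
  have I: "finite I" "I \<subseteq> {..<d}" by (auto simp: I_def)
  have ne: "I \<noteq> {}" using L by auto
  with I have "d > 0" by auto
  have ind: "indep_vars (\<lambda>_. borel) (\<lambda>j X. a j / L * X j) I"
    by (rule indep_vars_compose2[OF indep_vars_subset[OF indep_vars_std_normal_vec[OF \<open>d > 0\<close>] I(2)]]) simp
  have rv: "(\<lambda>X. X j) \<in> borel_measurable (std_normal_vec d m)" if "j < d" for j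
    using that by (simp cong: measurable_cong_sets add: sets_std_normal_vec)
  have dst: "distributed (std_normal_vec d m) lborel (\<lambda>X. a j / L * X j)
      (normal_density (a j / L * m j) \<bar>a j / L\<bar>)" if "j \<in> I" for j
  proof -
    have "distributed (std_normal_vec d m) lborel (\<lambda>X. X j) (normal_density (m j) 1)"
      using that rv by (subst distributed_normal_law) (auto simp: I_def distr_std_normal_vec_component prob_space_std_normal_vec)
    from normal_density_affine[OF this, of "a j / L" 0] show ?thesis using that L by (simp add: I_def)
  qed
  have "distributed (std_normal_vec d m) lborel (\<lambda>X. \<Sum>j\<in>I. a j / L * X j)
      (normal_density (\<Sum>j\<in>I. a j / L * m j) (sqrt (\<Sum>j\<in>I. \<bar>a j / L\<bar>\<^sup>2)))"
    using I ne L by (intro sum_indep_normal ind dst) (auto simp: I_def)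
  moreover have "(\<Sum>j\<in>I. \<bar>a j / L\<bar>\<^sup>2) = 1"
    using L by (simp add: power_divide flip: sum_divide_distrib L(2))
  moreover have "(\<Sum>j\<in>I. a j / L * X j) = dot d a X / L" for X
    unfolding dot_def sum_divide_distrib by (intro sum.mono_neutral_cong_left) (auto simp: I_def)
  ultimately have "distributed (std_normal_vec d m) lborel (\<lambda>X. dot d a X / L) (normal_density (dot d a m / L) 1)"
    by simp
  moreover have "(\<lambda>X. dot d a X / L) \<in> borel_measurable (std_normal_vec d m)"
    by (simp cong: measurable_cong_sets add: sets_std_normal_vec)
  ultimately show ?thesis
    unfolding L_def by (simp add: distributed_normal_law prob_space_std_normal_vec)
qed

text \<open>
  The law of \<open>C_minus / sqrt (2 ln n)\<close> for an observation with \<open>z\<^sub>i = \<sigma>\<^sub>i\<close>; both components of the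
  mixture in \<^const>\<open>S_tail\<close> give the same law. If \<open>z\<^sub>i \<noteq> \<sigma>\<^sub>i\<close>, the law is its reflection at \<open>0\<close>.
\<close>

definition C_law :: "nat \<Rightarrow> real \<Rightarrow> real \<Rightarrow> real measure" where
  "C_law n r s = distr (normal_law 0 \<Otimes>\<^sub>M normal_law (sqrt (2 * (r + s) * ln (real n)))) borel
     (\<lambda>(u, v). \<bar>sqrt r * u + sqrt s * v\<bar> - sqrt (r + s) * \<bar>v\<bar>)"

lemma sets_C_law [simp, measurable_cong]: "sets (C_law n r s) = sets borel"
  and space_C_law [simp]: "space (C_law n r s) = UNIV"
  by (simp_all add: C_law_def)

lemma prob_space_pair_normal_law: "prob_space (normal_law a \<Otimes>\<^sub>M normal_law b)"
proof -
  interpret A: prob_space "normal_law a" by (rule prob_space_normal_law)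
  interpret B: prob_space "normal_law b" by (rule prob_space_normal_law)
  interpret pair_prob_space "normal_law a" "normal_law b" ..
  show ?thesis by (rule P.prob_space_axioms)
qed

lemma prob_space_C_law: "prob_space (C_law n r s)"
  unfolding C_law_def by (rule prob_space.prob_space_distr[OF prob_space_pair_normal_law]) simp

lemma normal_law_sign: "e \<in> {-1, 1} \<Longrightarrow> distr (normal_law m) borel ((*) e) = normal_law (e * m)"
  using distr_normal_law_uminus[of m]
  by (auto simp: distr_id2 fun_eq_iff cong: distr_cong)

lemma pair_normal_law_sign:
  assumes "e \<in> {-1, 1}" "e' \<in> {-1, 1}"
  shows "distr (normal_law a \<Otimes>\<^sub>M normal_law b) (borel \<Otimes>\<^sub>M borel) (\<lambda>(u, v). (e * u, e' * v))
       = normal_law (e * a) \<Otimes>\<^sub>M normal_law (e' * b)"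
  unfolding normal_law_sign[OF assms(1), symmetric] normal_law_sign[OF assms(2), symmetric]
  by (subst pair_measure_distr)
     (auto simp: normal_law_sign[OF assms(2)] intro!: prob_space_imp_sigma_finite prob_space_normal_law)

text \<open>\<open>z\<close> will be the common label and \<open>e\<close> the sign of the
  difference of the squared norms. The statistic is unchanged when (u, v) is replaced by (- u, - v),
  and the first coordinate is centred, so reflections of the coordinates absorb both signs.\<close>

lemma distr_pair_normal_law_C_law:
  assumes e: "e \<in> {-1, 1}" and z: "z \<in> {-1, 1}"
  shows "distr (normal_law 0 \<Otimes>\<^sub>M normal_law (z * sqrt (2 * (r + s) * ln (real n)))) borel
     (\<lambda>(u, v). \<bar>e * sqrt r * u + sqrt s * v\<bar> - sqrt (r + s) * \<bar>v\<bar>) = C_law n r s"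
proof -
  define m where "m = sqrt (2 * (r + s) * ln (real n))"
  have ez: "e * z \<in> {-1, 1}" using e z by auto
  have "C_law n r s = distr (distr (normal_law 0 \<Otimes>\<^sub>M normal_law (z * m)) (borel \<Otimes>\<^sub>M borel)
      (\<lambda>(u, v). (e * z * u, z * v))) borel (\<lambda>(u, v). \<bar>sqrt r * u + sqrt s * v\<bar> - sqrt (r + s) * \<bar>v\<bar>)"
    unfolding pair_normal_law_sign[OF ez z] using z by (auto simp: C_law_def m_def)
  also have "\<dots> = distr (normal_law 0 \<Otimes>\<^sub>M normal_law (z * m)) borel
      (\<lambda>(u, v). \<bar>sqrt r * (e * z * u) + sqrt s * (z * v)\<bar> - sqrt (r + s) * \<bar>z * v\<bar>)"
    by (subst distr_distr) (auto simp: comp_def case_prod_beta')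
  also have "(\<lambda>(u, v). \<bar>sqrt r * (e * z * u) + sqrt s * (z * v)\<bar> - sqrt (r + s) * \<bar>z * v\<bar>)
      = (\<lambda>(u, v). \<bar>e * sqrt r * u + sqrt s * v\<bar> - sqrt (r + s) * \<bar>v\<bar>)"
    using z by (auto simp: fun_eq_iff abs_if algebra_simps)
  finally show ?thesis by (simp add: m_def)
qed

lemma S_tail_C_law: "S_tail n r s t = measure (C_law n r s) {t<..}"
proof -
  define m where "m = sqrt (2 * (r + s) * ln (real n))"
  let ?g = "\<lambda>(u, v). \<bar>sqrt r * u + sqrt s * v\<bar> - sqrt (r + s) * \<bar>v\<bar>"
  have "measure (normal_law 0 \<Otimes>\<^sub>M normal_law (z * m)) {(u, v). \<bar>sqrt r * u + sqrt s * v\<bar> - sqrt (r + s) * \<bar>v\<bar> > t}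
      = measure (C_law n r s) {t<..}" if "z \<in> {-1, 1}" for z
  proof -
    have "measure (C_law n r s) {t<..} = measure (normal_law 0 \<Otimes>\<^sub>M normal_law (z * m))
        (?g -` {t<..} \<inter> space (normal_law 0 \<Otimes>\<^sub>M normal_law (z * m)))"
      using distr_pair_normal_law_C_law[OF _ that, of 1 r s n, symmetric]
      by (simp add: m_def measure_distr)
    also have "?g -` {t<..} \<inter> space (normal_law 0 \<Otimes>\<^sub>M normal_law (z * m))
        = {(u, v). \<bar>sqrt r * u + sqrt s * v\<bar> - sqrt (r + s) * \<bar>v\<bar> > t}"
      by (auto simp: space_pair_measure)
    finally show ?thesis ..
  qed
  from this[of 1] this[of "-1"] show ?thesis by (simp add: S_tail_def Let_def m_def)
qed

lemma measurable_C_minus [measurable]: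
  "C_minus p q \<theta> \<eta> \<in> borel_measurable (PiM {..<p} (\<lambda>_. borel) \<Otimes>\<^sub>M PiM {..<q} (\<lambda>_. borel))"
  unfolding C_minus_def by measurable

lemma dot_smult: "dot d a (\<lambda>j. z * b j) = z * dot d a b"
  by (simp add: dot_def sum_distrib_left mult_ac)

text \<open>The projections divided by the norms are independent normal variables with mean z (T,
  H). The rotation that takes the direction (T, H) to the second axis puts the whole mean into V =
  (X + Y) / N, where X and Y are the two inner products, and leaves U centred. Up to the factor l
  and a sign, X - Y is the combination of U and V with coefficients sqrt r and sqrt s.\<close>

lemma distr_C_minus:
  fixes \<theta> \<eta> :: "nat \<Rightarrow> real" and r s :: real and p q n :: nat
  defines "T \<equiv> L2_set \<theta> {..<p}" and "H \<equiv> L2_set \<eta> {..<q}"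
  assumes n: "n \<ge> 2" and r: "r > 0" and s: "s \<ge> 0" and z: "z \<in> {-1, 1}"
    and TH: "2 * T * H / sqrt (T\<^sup>2 + H\<^sup>2) = sqrt (2 * r * ln (real n))"
      "\<bar>T\<^sup>2 - H\<^sup>2\<bar> / sqrt (T\<^sup>2 + H\<^sup>2) = sqrt (2 * s * ln (real n))"
  shows "distr (std_normal_vec p (\<lambda>j. z * \<theta> j) \<Otimes>\<^sub>M std_normal_vec q (\<lambda>j. z * \<eta> j)) borel
      (\<lambda>x. C_minus p q \<theta> \<eta> x / sqrt (2 * ln (real n))) = C_law n r s"
proof -
  let ?M = "std_normal_vec p (\<lambda>j. z * \<theta> j) \<Otimes>\<^sub>M std_normal_vec q (\<lambda>j. z * \<eta> j)"
  define l where "l = sqrt (2 * ln (real n))"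
  define w where "w = sqrt (r + s)"
  define N where "N = sqrt (T\<^sup>2 + H\<^sup>2)"
  have l: "l > 0" using n by (simp add: l_def)
  have w: "w > 0" "w\<^sup>2 = r + s" using r s by (simp_all add: w_def)
  have T0: "T \<ge> 0" "H \<ge> 0" by (simp_all add: T_def H_def)
  have rs: "2 * T * H / N = sqrt r * l" "\<bar>T\<^sup>2 - H\<^sup>2\<bar> / N = sqrt s * l"
    using TH by (simp_all add: N_def l_def real_sqrt_mult[symmetric] mult_ac)
  have "sqrt r * l > 0" using r l by simp
  then have "2 * T * H / N > 0" using rs by simp
  then have "T \<noteq> 0" "H \<noteq> 0" by auto
  with T0 have TH0: "T > 0" "H > 0" by simp_all
  then have TH0: "T > 0" "H > 0" "N > 0" by (simp_all add: N_def add_pos_pos)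
  have N2: "N\<^sup>2 = T\<^sup>2 + H\<^sup>2" by (simp add: N_def)
  \<comment> \<open>The two norm conditions are combined as the legs of a Pythagorean triple; the
    hypotenuse yields \<open>N = w * l\<close>, the length of the mean vector.\<close>
  have "(N\<^sup>2)\<^sup>2 = (2 * T * H)\<^sup>2 + (\<bar>T\<^sup>2 - H\<^sup>2\<bar>)\<^sup>2"
    unfolding N2 power2_abs by (simp add: power2_eq_square algebra_simps)
  also have "2 * T * H = sqrt r * l * N" using rs(1) TH0 by (simp add: field_simps)
  also have "\<bar>T\<^sup>2 - H\<^sup>2\<bar> = sqrt s * l * N" using rs(2) TH0 by (simp add: field_simps)
  also have "(sqrt r * l * N)\<^sup>2 + (sqrt s * l * N)\<^sup>2 = (w * l)\<^sup>2 * N\<^sup>2"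
    using r s by (simp add: power_mult_distrib w algebra_simps)
  finally have "N\<^sup>2 = (w * l)\<^sup>2" using TH0 by (simp add: power2_eq_square)
  then have N: "N = w * l" using TH0 w l by (simp add: power2_eq_iff_nonneg)
  \<comment> \<open>The hypothesis gives only the absolute value of the difference; \<open>e\<close>
    records which norm is larger.\<close>
  obtain e :: real where e: "e \<in> {-1, 1}" "T\<^sup>2 - H\<^sup>2 = e * \<bar>T\<^sup>2 - H\<^sup>2\<bar>"
    by (cases "T\<^sup>2 \<ge> H\<^sup>2") (force intro: that[of 1] that[of "-1"])+
  have 1: "distr ?M (borel \<Otimes>\<^sub>M borel) (\<lambda>(X, Y). (dot p \<theta> X / T, dot q \<eta> Y / H))
      = normal_law (z * T) \<Otimes>\<^sub>M normal_law (z * H)"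
  proof -
    have "distr (std_normal_vec p (\<lambda>j. z * \<theta> j)) borel (\<lambda>X. dot p \<theta> X / T) = normal_law (z * T)"
      using distr_dot_std_normal_vec[of \<theta> p "\<lambda>j. z * \<theta> j"] TH0
      by (simp add: T_def dot_smult L2_set_dot[symmetric] power2_eq_square)
    moreover have "distr (std_normal_vec q (\<lambda>j. z * \<eta> j)) borel (\<lambda>X. dot q \<eta> X / H) = normal_law (z * H)"
      using distr_dot_std_normal_vec[of \<eta> q "\<lambda>j. z * \<eta> j"] TH0
      by (simp add: H_def dot_smult L2_set_dot[symmetric] power2_eq_square)
    ultimately show ?thesis
      by (subst pair_measure_distr[symmetric])
         (auto intro!: prob_space_imp_sigma_finite prob_space_normal_law cong: measurable_cong_sets simp: sets_std_normal_vec)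
  qed
  have "(H / N)\<^sup>2 + (T / N)\<^sup>2 = (T\<^sup>2 + H\<^sup>2) / N\<^sup>2"
    by (simp add: power_divide add_divide_distrib)
  also have "\<dots> = 1" using N2[symmetric] TH0 by simp
  finally have cs: "(H / N)\<^sup>2 + (T / N)\<^sup>2 = 1" "H / N \<noteq> 0" using TH0 by simp_all
  have "H / N * (z * T) - T / N * (z * H) = 0" by simp
  moreover have "T / N * (z * T) + H / N * (z * H) = z * N"
  proof -
    have "T / N * (z * T) + H / N * (z * H) = z * (T\<^sup>2 + H\<^sup>2) / N"
      by (simp add: power2_eq_square algebra_simps add_divide_distrib)
    then show ?thesis using TH0 unfolding N2[symmetric] by (simp add: power2_eq_square)
  qed
  ultimately have 2: "distr (normal_law (z * T) \<Otimes>\<^sub>M normal_law (z * H)) (borel \<Otimes>\<^sub>M borel)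
      (\<lambda>(x, y). (H / N * x - T / N * y, T / N * x + H / N * y)) = normal_law 0 \<Otimes>\<^sub>M normal_law (z * N)"
    using normal_law_rotation[OF cs, of "z * T" "z * H"] by simp
  have m: "sqrt (2 * (r + s) * ln (real n)) = N"
    unfolding N w_def l_def real_sqrt_mult[symmetric] by (simp add: mult_ac)
  have "C_law n r s = distr (normal_law 0 \<Otimes>\<^sub>M normal_law (z * N)) borel
     (\<lambda>(u, v). \<bar>e * sqrt r * u + sqrt s * v\<bar> - w * \<bar>v\<bar>)"
    using distr_pair_normal_law_C_law[OF e(1) z, of r s n] unfolding m w_def by simp
  also have "\<dots> = distr ?M borel (\<lambda>x. C_minus p q \<theta> \<eta> x / l)"
    unfolding 2[symmetric] 1[symmetric]
  proof -
    let ?f = "\<lambda>(X, Y). (dot p \<theta> X / T, dot q \<eta> Y / H)"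
    let ?g = "\<lambda>(x, y). (H / N * x - T / N * y, T / N * x + H / N * y)"
    let ?h = "\<lambda>(u, v). \<bar>e * sqrt r * u + sqrt s * v\<bar> - w * \<bar>v\<bar>"
    have f: "?f \<in> ?M \<rightarrow>\<^sub>M borel \<Otimes>\<^sub>M borel"
      by (simp cong: measurable_cong_sets add: sets_std_normal_vec)
    have *: "\<bar>e * sqrt r * (H / N * (X / T) - T / N * (Y / H)) + sqrt s * (T / N * (X / T) + H / N * (Y / H))\<bar>
        - w * \<bar>T / N * (X / T) + H / N * (Y / H)\<bar> = (\<bar>X - Y\<bar> - \<bar>X + Y\<bar>) / l" for X Y
    proof -
      have V: "T / N * (X / T) + H / N * (Y / H) = (X + Y) / N"
        using TH0 by (simp add: add_divide_distrib)
      have sr: "sqrt r = 2 * T * H * w / N\<^sup>2" "sqrt s = e * (T\<^sup>2 - H\<^sup>2) * w / N\<^sup>2"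
      proof -
        have "2 * T * H * w / N\<^sup>2 = (2 * T * H / N) * w / N" by (simp add: power2_eq_square)
        also have "\<dots> = sqrt r" unfolding rs(1) using N w l by simp
        finally show "sqrt r = 2 * T * H * w / N\<^sup>2" ..
        have "e * (T\<^sup>2 - H\<^sup>2) = \<bar>T\<^sup>2 - H\<^sup>2\<bar>" using e by auto
        then have "e * (T\<^sup>2 - H\<^sup>2) * w / N\<^sup>2 = (\<bar>T\<^sup>2 - H\<^sup>2\<bar> / N) * w / N" by (simp add: power2_eq_square)
        also have "\<dots> = sqrt s" unfolding rs(2) using N w l by simp
        finally show "sqrt s = e * (T\<^sup>2 - H\<^sup>2) * w / N\<^sup>2" ..
      qed
      have "e * sqrt r * (H / N * (X / T) - T / N * (Y / H)) + sqrt s * (T / N * (X / T) + H / N * (Y / H))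
        = e * w / N ^ 3 * (2 * (H\<^sup>2 * X - T\<^sup>2 * Y) + (T\<^sup>2 - H\<^sup>2) * (X + Y))"
        unfolding V sr using TH0 by (simp add: field_simps power2_eq_square power3_eq_cube)
      also have "2 * (H\<^sup>2 * X - T\<^sup>2 * Y) + (T\<^sup>2 - H\<^sup>2) * (X + Y) = N\<^sup>2 * (X - Y)"
        unfolding N2 by (simp add: algebra_simps)
      also have "e * w / N ^ 3 * (N\<^sup>2 * (X - Y)) = e * (X - Y) / l"
        using N w(1) l by (simp add: field_simps power2_eq_square power3_eq_cube)
      finally have U: "\<bar>e * sqrt r * (H / N * (X / T) - T / N * (Y / H)) + sqrt s * (T / N * (X / T) + H / N * (Y / H))\<bar>
          = \<bar>X - Y\<bar> / l"
        using e l by (auto simp: abs_mult)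
      show ?thesis unfolding U unfolding V using N w l by (simp add: diff_divide_distrib)
    qed
    have "distr (distr (distr ?M (borel \<Otimes>\<^sub>M borel) ?f) (borel \<Otimes>\<^sub>M borel) ?g) borel ?h
        = distr (distr ?M (borel \<Otimes>\<^sub>M borel) ?f) borel (?h \<circ> ?g)"
      by (rule distr_distr) simp_all
    also have "\<dots> = distr ?M borel (?h \<circ> ?g \<circ> ?f)"
      by (rule distr_distr[OF _ f]) simp
    also have "\<dots> = distr ?M borel (\<lambda>x. C_minus p q \<theta> \<eta> x / l)"
    proof (intro distr_cong refl)
      fix x :: "(nat \<Rightarrow> real) \<times> (nat \<Rightarrow> real)"
      obtain X Y where "x = (X, Y)" by (cases x)
      then show "(?h \<circ> ?g \<circ> ?f) x = C_minus p q \<theta> \<eta> x / l"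
        using *[of "dot p \<theta> X" "dot q \<eta> Y"] by (simp only: comp_def prod.case C_minus_def)
    qed
    finally show "distr (distr (distr ?M (borel \<Otimes>\<^sub>M borel) ?f) (borel \<Otimes>\<^sub>M borel) ?g) borel ?h
        = distr ?M borel (\<lambda>x. C_minus p q \<theta> \<eta> x / l)" .
  qed
  finally show ?thesis by (simp add: l_def)
qed


section \<open>Exponents of the two error probabilities\<close>

text \<open>
  The exponent of \<open>n\<close> in a bound for the moment generating function of \<open>C_law\<close> at
  \<open>\<rho> sqrt (2 ln n)\<close>, after \<open>- \<bar>v\<bar>\<close> has been replaced by \<open>- \<kappa> v\<close>. The optimal \<open>\<kappa>\<close> is \<open>1\<close> if the
  dominating point has \<open>v > 0\<close>; the two branches of \<open>beta_star\<close> that contain \<open>sqrt s\<close> only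
  through \<open>s\<close> come from a dominating point with \<open>v = 0\<close>, where the optimum is \<open>\<kappa> < 1\<close>.
\<close>

definition mgf_exponent :: "real \<Rightarrow> real \<Rightarrow> real \<Rightarrow> real \<Rightarrow> real" where
  "mgf_exponent r s \<rho> \<kappa> =
     \<rho>\<^sup>2 * (r + \<kappa>\<^sup>2 * (sqrt (r + s) - sqrt s)\<^sup>2) - 2 * \<rho> * \<kappa> * (sqrt (r + s) * (sqrt (r + s) - sqrt s))"

text \<open>
  In units of \<open>sqrt (2 ln n)\<close>, \<open>\<tau>\<close> is the optimal threshold, \<open>(u, v)\<close> is the cheapest value of
  \<open>(U, V)\<close> with which a mismatched observation exceeds it, at probability \<open>n\<close> to the power
  \<open>- (u\<^sup>2 + (v - w)\<^sup>2)\<close>, and a matched observation exceeds it with probability at most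
  \<open>n\<close> to the power \<open>- (2 \<rho> \<tau> - mgf_exponent r s \<rho> \<kappa>)\<close>. The same \<open>\<rho>\<close> is the moment of the likelihood
  ratio that proves the matching lower bound.
\<close>

lemma beta_star_witness:
  fixes r s :: real
  assumes r: "r > 0" and s: "s \<ge> 0"
  defines "w \<equiv> sqrt (r + s)"
  obtains \<rho> \<kappa> \<tau> u v where "1 \<le> \<rho>" "\<rho> \<le> 2" "0 \<le> \<kappa>" "\<kappa> \<le> 1" "\<tau> > 0" "v \<ge> 0"
    "w * v - \<bar>sqrt r * u + sqrt s * v\<bar> \<ge> \<tau>"
    "beta_star r s \<le> 1 - (u\<^sup>2 + (v - w)\<^sup>2)"
    "beta_star r s \<le> (1 + (2 * \<rho> * \<tau> - mgf_exponent r s \<rho> \<kappa>)) / 2 - (u\<^sup>2 + (v - w)\<^sup>2)"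
    "2 * \<rho> * \<tau> - mgf_exponent r s \<rho> \<kappa> > u\<^sup>2 + (v - w)\<^sup>2"
    "beta_star r s < 1 \<Longrightarrow> 1 + mgf_exponent r s \<rho> \<kappa> \<le> \<rho> * beta_star r s"
    "mgf_exponent r s \<rho> \<kappa> \<ge> 0"
proof -
  define d where "d = w - sqrt s"
  have mgf: "mgf_exponent r s \<rho> \<kappa> = \<rho>\<^sup>2 * (r + \<kappa>\<^sup>2 * d\<^sup>2) - 2 * \<rho> * \<kappa> * (w * d)" for \<rho> \<kappa>
    by (simp add: mgf_exponent_def d_def w_def)
  define b where "b = sqrt s"
  define c where "c = sqrt r"
  define A where "A = beta_A r s"
  have b: "b \<ge> 0" "b\<^sup>2 = s" and c: "c > 0" "c\<^sup>2 = r" using r s by (simp_all add: b_def c_def)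
  have w: "w > b" "w\<^sup>2 = r + s" using r s by (simp_all add: b_def w_def)
  have d: "d = w - b" "d > 0" using w by (simp_all add: d_def w_def b_def)
  have A: "A = w * d"
    unfolding A_def beta_A_def w_def[symmetric] b_def[symmetric] unfolding w(2)[symmetric] d
    by (simp add: power2_eq_square algebra_simps)
  have r': "r = w\<^sup>2 - b\<^sup>2" using w b by simp
  have d2: "r + d\<^sup>2 = 2 * A" unfolding r' A d by (simp add: power2_eq_square algebra_simps)
  have A0: "A > 0" using w b d by (simp add: A)
  have w0: "w > 0" using w b by simp
  have rd: "r = d * (w + b)" unfolding r' d by (simp add: power2_eq_square algebra_simps)
  have rA: "r * w\<^sup>2 = A * (2 * w\<^sup>2 - A)" unfolding r' A d by (simp add: power2_eq_square algebra_simps)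
  have w1': "1 - r - s = 1 - w\<^sup>2" using w by simp
  have "d\<^sup>2 \<le> r" unfolding rd power2_eq_square using b d by simp
  have iff: "3 * s > r \<longleftrightarrow> w < 2 * b"
    using abs_le_square_iff[of "2 * b" w] b w w0 by (auto simp: power_mult_distrib)
  have key: "8 * A - (5 * r + s) = (3 * w - 2 * b) * (w - 2 * b)"
    unfolding A r' d b(2)[symmetric] by (simp add: algebra_simps power2_eq_square)
  define B where "B = beta_star r s"
  \<comment> \<open>For v \<ge> 0 the points at which a mismatched observation reaches \<tau> form a
    wedge. This is its tip, where the first absolute value vanishes.\<close>
  have apex: "w * v - \<bar>sqrt r * u + sqrt s * v\<bar> = \<tau>" if "v = \<tau> / w" "u = - b * \<tau> / (w * c)" for u v \<tau>
    using that w0 c by (simp add: b_def c_def)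
  have apex_a: "u\<^sup>2 + (v - w)\<^sup>2 = \<tau>\<^sup>2 / r - 2 * \<tau> + w\<^sup>2" if "v = \<tau> / w" "u = - b * \<tau> / (w * c)" for u v \<tau>
  proof -
    have "u\<^sup>2 + (v - w)\<^sup>2 = \<tau>\<^sup>2 * (s / (w\<^sup>2 * r) + 1 / w\<^sup>2) - 2 * \<tau> + w\<^sup>2"
      unfolding that using w0 c by (simp add: power_mult_distrib power_divide b power2_diff field_simps)
        (simp add: power2_eq_square)
    also have "s / (w\<^sup>2 * r) + 1 / w\<^sup>2 = (s + r) / (w\<^sup>2 * r)"
      using w0 r by (simp add: field_simps)
    also have "\<dots> = 1 / r" using w0 r by (simp add: w(2)[symmetric] add.commute)
    finally show ?thesis by simp
  qed
  \<comment> \<open>This \<kappa> is the unconstrained minimizer of \<open>mgf_exponent\<close> for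
    given \<rho>. It is used in cases 2 and 3, where it is at most 1.\<close>
  have kap: "mgf_exponent r s \<rho> \<kappa> = \<rho>\<^sup>2 * r - w\<^sup>2" if "\<kappa> = w / (\<rho> * d)" "\<rho> > 0" for \<rho> \<kappa>
    unfolding mgf that using d that(2) by (simp add: field_simps power2_eq_square)
  consider (1) "3 * s > r" "A \<le> 1/8" | (2) "3 * s \<le> r" "5 * r + s \<le> 1"
    | (3) "5 * r + s > 1" "1/8 < A" "A \<le> 1/2" "2 * (1 - r - s) * A > r"
    | (4) "5 * r + s > 1" "1/8 < A" "A \<le> 1/2" "2 * (1 - r - s) * A \<le> r" | (5) "A > 1/2"
    using beta_star_last_case[OF r s] unfolding A_def[symmetric] by linarith
  then show thesis
  proof cases
    \<comment> \<open>Away from the tip the cheapest point lies on the ray from the mean (0, w)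
      along (- c, d), the gradient of w v - (c u + b v), whose squared length is 2 A. A step k along
      it raises the value from A to A + 2 k A at cost 2 k^2 A. Here \<rho> = 2 and k = 1, and w < 2
      b keeps c u + b v positive.\<close>
    case 1
    then have B: "beta_star r s = 1/2 + 2 * A" by (simp add: beta_star_def Let_def A_def[symmetric])
    have wb: "w < 2 * b" using 1 iff by simp
    have L: "mgf_exponent r s 2 1 = 4 * A" using d2 by (simp add: mgf A)
    have a: "(- c)\<^sup>2 + ((w + d) - w)\<^sup>2 = 2 * A" using d2 c by simp
    have "w * (w + d) - \<bar>sqrt r * (- c) + sqrt s * (w + d)\<bar> = w * (w + d) - \<bar>w * (2 * b - w)\<bar>"
    proof -
      have "c * c = w * w - b * b" using c(2) r' by (simp add: power2_eq_square)
      then have "c * (- c) + b * (w + d) = w * (2 * b - w)" by (simp add: d(1) algebra_simps)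
      then show ?thesis unfolding c_def[symmetric] b_def[symmetric] by simp
    qed
    also have "\<dots> = 3 * A" using wb w0 unfolding A d by (simp add: abs_mult algebra_simps)
    finally have t: "w * (w + d) - \<bar>sqrt r * (- c) + sqrt s * (w + d)\<bar> \<ge> 3 * A" by simp
    show thesis
      by (rule that[of 2 1 "3 * A" "w + d" "- c"]) (use t a L B A0 1 w0 d in \<open>simp_all\<close>)
  next
    \<comment> \<open>For w \<ge> 2 b the step k = 1 would reach or pass the tip of the wedge, so
      the tip is the cheapest point. The threshold is \<tau> = \<rho> r, since 2 \<tau> is the
      derivative of \<rho>^2 r - w^2 in \<rho>.\<close>
    case 2
    then have B: "beta_star r s = (1 + 3 * r - s) / 2" by (simp add: beta_star_def Let_def A_def[symmetric])
    have wb: "w \<ge> 2 * b" using 2 iff by simp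
    define \<kappa> where "\<kappa> = w / (2 * d)"
    have k: "0 \<le> \<kappa>" "\<kappa> \<le> 1" using w0 d wb by (auto simp: \<kappa>_def field_simps)
    define v where "v = (2 * r) / w"
    define u where "u = - b * (2 * r) / (w * c)"
    note L = kap[OF \<kappa>_def] note t = apex[OF v_def u_def] note a = apex_a[OF v_def u_def]
    have a': "u\<^sup>2 + (v - w)\<^sup>2 = r + s" unfolding a w(2) using r by (simp add: power2_eq_square)
    have v0: "v \<ge> 0" using r w0 by (simp add: v_def)
    show thesis
      by (rule that[of 2 \<kappa> "2 * r" v u]) (use k v0 t a' B r s w L 2 in \<open>simp_all add: field_simps\<close>)
  next
    case 3
    have n1: "\<not> (3 * s > r \<and> A \<le> 1/8)" "\<not> (3 * s \<le> r \<and> 5 * r + s \<le> 1)" using 3 by auto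
    have B: "beta_star r s = 2 * sqrt r * sqrt (1 - r - s)"
      unfolding beta_star_def Let_def A_def[symmetric] using n1 3 by simp
    have w1: "1 - w\<^sup>2 > 0" using 3(4) A0 r w by (smt (verit, best) mult_nonneg_nonneg mult_nonpos_nonneg)
    \<comment> \<open>By \<open>rA\<close> the case condition becomes A > 2 w^4, which is what
      \<kappa> \<le> 1 needs for the \<rho> defined below.\<close>
    have "A * (2 * w\<^sup>2 - A) < 2 * (1 - w\<^sup>2) * A * w\<^sup>2"
    proof -
      have "r * w\<^sup>2 < 2 * (1 - r - s) * A * w\<^sup>2"
        by (rule mult_strict_right_mono[OF 3(4)]) (use w0 in simp)
      then show ?thesis unfolding rA w1' .
    qed
    then have "A * (2 * w\<^sup>2 - A) < A * (2 * (1 - w\<^sup>2) * w\<^sup>2)" by (simp add: mult_ac)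
    then have "2 * w\<^sup>2 - A < 2 * (1 - w\<^sup>2) * w\<^sup>2" using A0 by (simp add: mult_less_cancel_left)
    then have A4: "A > 2 * w ^ 4" by (simp add: algebra_simps power_numeral_reduce)
    have "w\<^sup>2 * (w\<^sup>2 * r) \<le> w\<^sup>2 * ((1 - w\<^sup>2) * d\<^sup>2)"
    proof -
      have "w\<^sup>2 * (w\<^sup>2 * r) = A * (w\<^sup>2 * (2 * w\<^sup>2 - A))" using rA by (simp add: mult_ac)
      also have "\<dots> \<le> A * ((1 - w\<^sup>2) * A)"
      proof (intro mult_left_mono)
        have "w\<^sup>2 * (2 * w\<^sup>2 - A) = 2 * w ^ 4 - w\<^sup>2 * A" by (simp add: algebra_simps power_numeral_reduce)
        then show "w\<^sup>2 * (2 * w\<^sup>2 - A) \<le> (1 - w\<^sup>2) * A" using A4 by (simp add: algebra_simps)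
      qed (use A0 in simp)
      also have "\<dots> = w\<^sup>2 * ((1 - w\<^sup>2) * d\<^sup>2)" by (simp add: A power2_eq_square)
      finally show ?thesis .
    qed
    then have wd: "w\<^sup>2 * r \<le> (1 - w\<^sup>2) * d\<^sup>2" by (rule mult_left_le_imp_le) (use w0 in simp)
    \<comment> \<open>Chosen so that the matched exponent \<rho>^2 r + w^2 equals 1; \<rho> \<le> 2
      is then the condition 5 r + s \<ge> 1.\<close>
    define \<rho> where "\<rho> = sqrt ((1 - w\<^sup>2) / r)"
    have \<rho>: "\<rho> > 0" "\<rho>\<^sup>2 = (1 - w\<^sup>2) / r" using w1 r by (simp_all add: \<rho>_def)
    have "(w / d)\<^sup>2 \<le> \<rho>\<^sup>2" 
    using wd zero_less_power[OF d(2), of 2] unfolding \<rho>(2) power_divide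
    by (simp only: pos_le_divide_eq[OF r] times_divide_eq_left pos_divide_le_eq)
    then have "w / d \<le> \<rho>" by (rule power2_le_imp_le) (use \<rho>(1) in simp)
    moreover have "w / d \<ge> 1" using d b by simp
    ultimately have \<rho>1: "\<rho> \<ge> 1" "w / d \<le> \<rho>" by simp_all
    have "\<rho>\<^sup>2 \<le> 2\<^sup>2" using 3(1) r unfolding \<rho> w(2) by (simp add: field_simps)
    then have \<rho>2: "\<rho> \<le> 2" by (rule power2_le_imp_le) simp
    define \<kappa> where "\<kappa> = w / (\<rho> * d)"
    have k: "0 \<le> \<kappa>" "\<kappa> \<le> 1" using w0 d \<rho> \<rho>1 by (auto simp: \<kappa>_def field_simps)
    define \<tau> where "\<tau> = \<rho> * r"
    define v where "v = \<tau> / w"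
    define u where "u = - b * \<tau> / (w * c)"
    note L = kap[OF \<kappa>_def \<rho>(1)] note t = apex[OF v_def u_def] note a = apex_a[OF v_def u_def]
    have r2: "\<rho>\<^sup>2 * r = 1 - w\<^sup>2" using \<rho> r by simp
    have "\<tau>\<^sup>2 / r = \<rho>\<^sup>2 * r" using r by (simp add: \<tau>_def power2_eq_square)
    then have a': "u\<^sup>2 + (v - w)\<^sup>2 = 1 - 2 * \<tau>" unfolding a using r2 by simp
    have v0: "v \<ge> 0" using r w0 \<rho> by (simp add: v_def \<tau>_def)
    have \<rho>\<tau>: "\<rho> * \<tau> = 1 - w\<^sup>2" unfolding \<tau>_def r2[symmetric] by (simp add: power2_eq_square)
    have "sqrt r * sqrt (1 - r - s) = \<tau>"
    proof -
      have "\<tau>\<^sup>2 = r * (\<rho>\<^sup>2 * r)" by (simp add: \<tau>_def power2_eq_square)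
      also have "\<dots> = r * (1 - r - s)" using r2 w by simp
      finally show ?thesis using \<rho> r by (simp add: \<tau>_def real_sqrt_mult[symmetric] real_sqrt_unique)
    qed
    then have B': "beta_star r s = 2 * \<tau>" using B by simp
    have \<tau>0: "\<tau> > 0" using \<rho> r by (simp add: \<tau>_def)
    have L0: "\<rho>\<^sup>2 * r - w\<^sup>2 \<ge> 0"
    proof -
      have "w\<^sup>2 * d\<^sup>2 \<le> w\<^sup>2 * r" using \<open>d\<^sup>2 \<le> r\<close> by (simp add: mult_left_mono)
      also have "\<dots> \<le> (\<rho>\<^sup>2 * r) * d\<^sup>2" using wd r2 by simp
      finally show ?thesis using d by (simp add: mult_le_cancel_right)
    qed
    show thesis
      by (rule that[of \<rho> \<kappa> \<tau> v u]) (use L0 \<tau>0 \<rho>1 \<rho>2 k v0 t a' B' r s w L r2 \<rho>\<tau> in \<open>simp_all add: mult.assoc\<close>)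
  next
    case 4
    have n1: "\<not> (3 * s > r \<and> A \<le> 1/8)" "\<not> (3 * s \<le> r \<and> 5 * r + s \<le> 1)" using 4 by auto
    have B: "beta_star r s = 2 * sqrt (2 * A) - 2 * A"
      unfolding beta_star_def Let_def A_def[symmetric] using n1 4 by simp
    \<comment> \<open>The matched exponent is again 1: for \<kappa> = 1 it is 2 A \<rho>^2, whence
      \<rho> = 1 / x. The point lies on the ray of case 1, with k determined by \<tau> = A + 2 k A,
      and \<open>xw\<close> below ensures that the ray has not passed the tip.\<close>
    define x where "x = sqrt (2 * A)"
    have x: "x > 0" "x\<^sup>2 = 2 * A" using A0 by (simp_all add: x_def)
    have x1: "x \<le> 1" "x \<ge> 1/2" using 4 real_sqrt_le_mono[of "2 * A" 1] real_sqrt_le_mono[of "1/4" "2 * A"]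
      by (simp_all add: x_def real_sqrt_divide)
    have "2 * (1 - w\<^sup>2) * A * w\<^sup>2 \<le> A * (2 * w\<^sup>2 - A)"
    proof -
      have "2 * (1 - r - s) * A * w\<^sup>2 \<le> r * w\<^sup>2"
        by (rule mult_right_mono[OF 4(4)]) simp
      then show ?thesis unfolding rA w1' .
    qed
    then have "A * (2 * (1 - w\<^sup>2) * w\<^sup>2) \<le> A * (2 * w\<^sup>2 - A)" by (simp add: mult_ac)
    then have "2 * (1 - w\<^sup>2) * w\<^sup>2 \<le> 2 * w\<^sup>2 - A" using A0 by simp
    then have A4: "A \<le> 2 * w ^ 4" by (simp add: algebra_simps power_numeral_reduce)
    have "x\<^sup>2 \<le> (2 * w\<^sup>2)\<^sup>2" using A4 unfolding x by (simp add: power_mult_distrib)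
    then have xw: "x \<le> 2 * w\<^sup>2" by (rule power2_le_imp_le) simp
    define \<tau> where "\<tau> = x - A"
    have A2: "A = x\<^sup>2 / 2" using x by simp
    have "\<tau> = x * (1 - x / 2)" by (simp add: \<tau>_def A2 power2_eq_square algebra_simps)
    then have \<tau>0: "\<tau> > 0" using x x1 by simp
    define k where "k = (\<tau> - A) / (2 * A)"
    have k: "k = (1 - x) / x" using x by (simp add: k_def \<tau>_def A2 power2_eq_square field_simps)
    have k0: "k \<ge> 0" using k x x1 by simp
    define v where "v = w + k * d"
    define u where "u = - k * c"
    have a: "u\<^sup>2 + (v - w)\<^sup>2 = (1 - x)\<^sup>2"
    proof -
      have "u\<^sup>2 + (v - w)\<^sup>2 = k\<^sup>2 * (r + d\<^sup>2)" by (simp add: u_def v_def power_mult_distrib c algebra_simps)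
      also have "\<dots> = (1 - x)\<^sup>2" unfolding d2 x(2)[symmetric] k using x(1) by (simp add: power_divide)
      finally show ?thesis .
    qed
    have t: "w * v - \<bar>sqrt r * u + sqrt s * v\<bar> = \<tau>"
    proof -
      have "c * c = r" using c(2) by (simp add: power2_eq_square)
      then have "c * u + b * v = b * w + k * (b * d - r)"
        unfolding u_def v_def by (simp add: algebra_simps)
      then have e1: "sqrt r * u + sqrt s * v = b * w + k * (b * d - r)" by (simp add: c_def b_def)
      note e1
      also have "b * d - r = - A" unfolding rd A by (simp add: algebra_simps)
      also have "k * - A = - (\<tau> - A) / 2" using A0 by (simp add: k_def field_simps)
      also have "b * w + - (\<tau> - A) / 2 = (2 * w\<^sup>2 - x) / 2"
        unfolding \<tau>_def A d by (simp add: power2_eq_square field_simps)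
      finally have e2: "\<bar>sqrt r * u + sqrt s * v\<bar> = b * w - (\<tau> - A) / 2"
        using xw unfolding \<tau>_def A d by (simp add: power2_eq_square field_simps)
      have "w * v = w\<^sup>2 + (\<tau> - A) / 2" using A0 unfolding v_def k_def by (simp add: power2_eq_square A[symmetric] field_simps)
        (simp add: A)
      then show ?thesis unfolding e2 by (simp add: A d power2_eq_square algebra_simps)
    qed
    have v0: "v \<ge> 0" using w0 k0 d by (simp add: v_def)
    have L: "mgf_exponent r s (1 / x) 1 = 1 - x"
    proof -
      have "mgf_exponent r s (1 / x) 1 = (2 * A) / x\<^sup>2 - 2 * A / x"
        using d2 by (simp add: mgf A power_divide)
      also have "\<dots> = 1 - x" using x(1) by (simp add: A2 power2_eq_square)
      finally show ?thesis .
    qed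
    have B': "beta_star r s = 2 * x - x\<^sup>2" using B x by (simp add: x_def)
    have \<rho>\<tau>: "2 * (1 / x) * \<tau> = 2 - x" using x by (simp add: \<tau>_def A2 power2_eq_square field_simps)
    have "x * x < 2 * x" using x(1) x1 by (intro mult_strict_right_mono) auto
    then have a1: "(1 - x)\<^sup>2 < 1" by (simp add: power2_eq_square algebra_simps)
    show thesis
    proof (rule that[of "1 / x" 1 \<tau> v u])
      show "1 + mgf_exponent r s (1 / x) 1 \<le> 1 / x * beta_star r s"
        unfolding L B' using x(1) by (simp add: power2_eq_square field_simps)
    qed (unfold L a B' \<rho>\<tau>, use x1 x(1) t v0 \<tau>0 a1 in \<open>simp_all add: power2_eq_square field_simps\<close>)
  next
    \<comment> \<open>A mismatched observation at its mean (0, w) attains the threshold A at no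
      cost, while the matched exponent 2 A exceeds 1.\<close>
    case 5
    have n1: "\<not> (3 * s > r \<and> A \<le> 1/8)" "\<not> (3 * s \<le> r \<and> 5 * r + s \<le> 1)" "\<not> (5 * r + s > 1 \<and> 1/8 < A \<and> A \<le> 1/2)"
      using 5 beta_star_last_case[OF r s] unfolding A_def[symmetric] by auto
    have B: "beta_star r s = 1"
      unfolding beta_star_def Let_def A_def[symmetric] using n1 5 by auto
    have L: "mgf_exponent r s 1 1 = 0" using d2 by (simp add: mgf A)
    have t: "w * w - \<bar>sqrt r * 0 + sqrt s * w\<bar> \<ge> A"
      unfolding b_def[symmetric] using b w0 by (simp add: A d abs_mult algebra_simps)
    show thesis
      by (rule that[of 1 1 A w 0]) (use t L B A0 w0 5 in simp_all)
  qed
qed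


section \<open>Tails of matched and mismatched observations\<close>

lemma C_law_mgf:
  fixes r s \<rho> \<kappa> :: real
  assumes n: "n \<ge> 1" and r: "r > 0" and s: "s \<ge> 0" and \<rho>: "\<rho> \<ge> 0" and \<kappa>: "0 \<le> \<kappa>" "\<kappa> \<le> 1"
  shows "(\<integral>\<^sup>+x. ennreal (exp (\<rho> * sqrt (2 * ln (real n)) * x)) \<partial>C_law n r s)
     \<le> ennreal (2 * real n powr mgf_exponent r s \<rho> \<kappa>)"
proof -
  define w where "w = sqrt (r + s)"
  define d where "d = sqrt (r + s) - sqrt s"
  define l where "l = sqrt (2 * ln (real n))"
  define m where "m = sqrt (2 * (r + s) * ln (real n))"
  have l: "l \<ge> 0" "l\<^sup>2 = 2 * ln (real n)" using n by (simp_all add: l_def)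
  have m: "m = w * l" unfolding m_def l_def w_def real_sqrt_mult[symmetric] by (simp add: mult_ac)
  have d: "d \<ge> 0" using r s by (simp add: d_def)
  define a where "a = \<rho> * l * sqrt r"
  define b where "b = - (\<rho> * l * \<kappa> * d)"
  interpret M1: prob_space "normal_law 0" by (rule prob_space_normal_law)
  interpret M2: prob_space "normal_law m" by (rule prob_space_normal_law)
  have I: "(\<integral>\<^sup>+x. ennreal (exp (h * fst x) * exp (b * snd x)) \<partial>(normal_law 0 \<Otimes>\<^sub>M normal_law m))
     = ennreal (exp (h\<^sup>2 / 2 + (b * m + b\<^sup>2 / 2)))" for h
  proof -
    have "(\<integral>\<^sup>+x. ennreal (exp (h * fst x) * exp (b * snd x)) \<partial>(normal_law 0 \<Otimes>\<^sub>M normal_law m))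
        = (\<integral>\<^sup>+u. \<integral>\<^sup>+v. ennreal (exp (h * u)) * ennreal (exp (b * v)) \<partial>normal_law m \<partial>normal_law 0)"
      by (subst M2.nn_integral_fst[symmetric]) (auto simp: ennreal_mult)
    also have "\<dots> = ennreal (exp (h\<^sup>2 / 2)) * ennreal (exp (b * m + b\<^sup>2 / 2))"
      by (simp add: nn_integral_cmult nn_integral_multc normal_law_mgf)
    finally show ?thesis by (simp add: exp_add ennreal_mult)
  qed
  have mgf: "mgf_exponent r s \<rho> \<kappa> = \<rho>\<^sup>2 * (r + \<kappa>\<^sup>2 * d\<^sup>2) - 2 * \<rho> * \<kappa> * (w * d)"
    by (simp add: mgf_exponent_def w_def d_def)
  have ba: "a\<^sup>2 / 2 + (b * m + b\<^sup>2 / 2) = mgf_exponent r s \<rho> \<kappa> * ln (real n)"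
  proof -
    have "a\<^sup>2 / 2 + (b * m + b\<^sup>2 / 2) = l\<^sup>2 / 2 * mgf_exponent r s \<rho> \<kappa>"
      using r by (simp add: mgf a_def b_def m power_mult_distrib field_simps) (simp add: power2_eq_square)
    then show ?thesis unfolding l(2) by simp
  qed
  have "(\<integral>\<^sup>+x. ennreal (exp (\<rho> * l * x)) \<partial>C_law n r s)
      = (\<integral>\<^sup>+x. ennreal (exp (\<rho> * l * (\<bar>sqrt r * fst x + sqrt s * snd x\<bar> - w * \<bar>snd x\<bar>)))
          \<partial>(normal_law 0 \<Otimes>\<^sub>M normal_law m))"
    unfolding C_law_def m_def[symmetric] w_def[symmetric]
    by (subst nn_integral_distr) (auto simp: case_prod_beta')
  \<comment> \<open>The triangle inequality separates \<open>u\<close> from \<open>v\<close>, and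
    exp (a \<bar>u\<bar>) is at most the sum over both signs of its exponent; this is the factor 2
    of the bound.\<close>
  also have "\<dots> \<le> (\<integral>\<^sup>+x. ennreal (exp (a * fst x) * exp (b * snd x)) + ennreal (exp ((- a) * fst x) * exp (b * snd x))
          \<partial>(normal_law 0 \<Otimes>\<^sub>M normal_law m))"
  proof (intro nn_integral_mono)
    fix x :: "real \<times> real"
    obtain u v where x: "x = (u, v)" by (cases x)
    have "\<bar>sqrt r * u + sqrt s * v\<bar> \<le> sqrt r * \<bar>u\<bar> + sqrt s * \<bar>v\<bar>"
      using abs_triangle_ineq[of "sqrt r * u" "sqrt s * v"] r s by (simp add: abs_mult)
    then have "\<bar>sqrt r * u + sqrt s * v\<bar> - w * \<bar>v\<bar> \<le> sqrt r * \<bar>u\<bar> - d * \<bar>v\<bar>"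
      by (simp add: d_def w_def algebra_simps)
    moreover have "\<kappa> * (d * v) \<le> d * \<bar>v\<bar>"
    proof -
      have "\<kappa> * (d * v) \<le> \<kappa> * (d * \<bar>v\<bar>)" using \<kappa> d by (intro mult_left_mono) auto
      also have "\<dots> \<le> 1 * (d * \<bar>v\<bar>)" using \<kappa> d by (intro mult_right_mono) auto
      finally show ?thesis by simp
    qed
    ultimately have "\<bar>sqrt r * u + sqrt s * v\<bar> - w * \<bar>v\<bar> \<le> sqrt r * \<bar>u\<bar> - \<kappa> * (d * v)" by simp
    then have "\<rho> * l * (\<bar>sqrt r * u + sqrt s * v\<bar> - w * \<bar>v\<bar>) \<le> \<rho> * l * (sqrt r * \<bar>u\<bar> - \<kappa> * (d * v))"
      using \<rho> l by (intro mult_left_mono) auto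
    also have "\<dots> = a * \<bar>u\<bar> + b * v" by (simp add: a_def b_def algebra_simps)
    finally have "exp (\<rho> * l * (\<bar>sqrt r * u + sqrt s * v\<bar> - w * \<bar>v\<bar>)) \<le> exp (a * \<bar>u\<bar> + b * v)" by simp
    also have "\<dots> \<le> exp (a * u + b * v) + exp ((- a) * u + b * v)"
      by (cases "u \<ge> 0") auto
    finally show "ennreal (exp (\<rho> * l * (\<bar>sqrt r * fst x + sqrt s * snd x\<bar> - w * \<bar>snd x\<bar>)))
      \<le> ennreal (exp (a * fst x) * exp (b * snd x)) + ennreal (exp ((- a) * fst x) * exp (b * snd x))"
      by (simp only: x fst_conv snd_conv exp_add[symmetric] ennreal_plus[symmetric] exp_ge_zero ennreal_leI)
  qed
  also have "\<dots> = ennreal (exp (a\<^sup>2 / 2 + (b * m + b\<^sup>2 / 2))) + ennreal (exp (a\<^sup>2 / 2 + (b * m + b\<^sup>2 / 2)))"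
    by (subst nn_integral_add) (simp_all only: I power2_minus, simp_all)
  also have "\<dots> = ennreal (2 * real n powr mgf_exponent r s \<rho> \<kappa>)"
    unfolding ba using n by (simp add: powr_def flip: ennreal_plus)
  finally show ?thesis by (simp add: l_def)
qed

lemma S_tail_le:
  fixes r s \<rho> \<kappa> \<tau> :: real
  assumes n: "n \<ge> 1" and r: "r > 0" and s: "s \<ge> 0" and \<rho>: "\<rho> \<ge> 0" and \<kappa>: "0 \<le> \<kappa>" "\<kappa> \<le> 1"
  shows "S_tail n r s (\<tau> * sqrt (2 * ln (real n)))
     \<le> 2 * real n powr (- (2 * \<rho> * \<tau> - mgf_exponent r s \<rho> \<kappa>))"
proof -
  define l where "l = sqrt (2 * ln (real n))"
  define L where "L = mgf_exponent r s \<rho> \<kappa>"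
  have l: "l \<ge> 0" "l * l = 2 * ln (real n)" using n by (simp_all add: l_def)
  interpret prob_space "C_law n r s" by (rule prob_space_C_law)
  have e: "exp (- (\<rho> * l * (\<tau> * l))) = real n powr (- (2 * \<rho> * \<tau>))"
  proof -
    have "\<rho> * l * (\<tau> * l) = \<rho> * \<tau> * (l * l)" by simp
    then show ?thesis unfolding l(2) using n by (simp add: powr_def)
  qed
  have "ennreal (S_tail n r s (\<tau> * l)) = (\<integral>\<^sup>+x. indicator {\<tau> * l<..} x \<partial>C_law n r s)"
    by (simp add: S_tail_C_law emeasure_eq_measure)
  also have "\<dots> \<le> (\<integral>\<^sup>+x. ennreal (exp (- (\<rho> * l * (\<tau> * l)))) * ennreal (exp (\<rho> * l * x)) \<partial>C_law n r s)"
  proof (intro nn_integral_mono)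
    fix x
    have "1 \<le> exp (- (\<rho> * l * (\<tau> * l))) * exp (\<rho> * l * x)" if "\<tau> * l < x"
    proof -
      have "\<rho> * l * (\<tau> * l) \<le> \<rho> * l * x" using that \<rho> l by (intro mult_left_mono) auto
      then show ?thesis unfolding exp_add[symmetric] by simp
    qed
    then show "indicator {\<tau> * l<..} x \<le> ennreal (exp (- (\<rho> * l * (\<tau> * l)))) * ennreal (exp (\<rho> * l * x))"
      by (auto simp: indicator_def simp flip: ennreal_mult)
  qed
  also have "\<dots> = ennreal (exp (- (\<rho> * l * (\<tau> * l)))) * (\<integral>\<^sup>+x. ennreal (exp (\<rho> * l * x)) \<partial>C_law n r s)"
    by (rule nn_integral_cmult) simp
  also have "\<dots> \<le> ennreal (exp (- (\<rho> * l * (\<tau> * l)))) * ennreal (2 * real n powr L)"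
    unfolding l_def L_def by (intro mult_left_mono C_law_mgf n r s \<rho> \<kappa>) simp
  also have "\<dots> = ennreal (2 * real n powr (- (2 * \<rho> * \<tau> - L)))"
    unfolding e by (simp add: algebra_simps flip: ennreal_mult powr_add)
  finally show ?thesis by (simp add: l_def L_def)
qed

lemma normal_law_unit_interval_ge:
  "measure (normal_law m) {y..y + 1} \<ge> exp (- (\<bar>y - m\<bar> + 1)\<^sup>2 / 2) / sqrt (2 * pi)"
proof -
  interpret prob_space "normal_law m" by (rule prob_space_normal_law)
  have "ennreal (exp (- (\<bar>y - m\<bar> + 1)\<^sup>2 / 2) / sqrt (2 * pi))
      = (\<integral>\<^sup>+x. ennreal (exp (- (\<bar>y - m\<bar> + 1)\<^sup>2 / 2) / sqrt (2 * pi)) * indicator {y..y+1} x \<partial>lborel)"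
    by (simp add: nn_integral_cmult_indicator)
  also have "\<dots> \<le> (\<integral>\<^sup>+x. ennreal (normal_density m 1 x) * indicator {y..y+1} x \<partial>lborel)"
  proof (intro nn_integral_mono)
    fix x
    have "exp (- (\<bar>y - m\<bar> + 1)\<^sup>2 / 2) \<le> exp (- (x - m)\<^sup>2 / 2)" if "x \<in> {y..y+1}"
    proof -
      have "\<bar>x - m\<bar> \<le> \<bar>\<bar>y - m\<bar> + 1\<bar>" using that by auto
      then have "(x - m)\<^sup>2 \<le> (\<bar>y - m\<bar> + 1)\<^sup>2" by (simp only: abs_le_square_iff)
      then show ?thesis by simp
    qed
    then show "ennreal (exp (- (\<bar>y - m\<bar> + 1)\<^sup>2 / 2) / sqrt (2 * pi)) * indicator {y..y+1} x
        \<le> ennreal (normal_density m 1 x) * indicator {y..y+1} x"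
      by (auto simp: normal_density_def indicator_def intro!: ennreal_leI divide_right_mono)
  qed
  also have "\<dots> = ennreal (measure (normal_law m) {y..y+1})"
    unfolding emeasure_eq_measure[symmetric] by (simp add: normal_law_def emeasure_density)
  finally show ?thesis by simp
qed

text \<open>A unit box with lower corner (u l, v l) already carries the right exponent: the density
  on it falls short only by a factor of order exp (- c l), which \<xi> ln n absorbs. Across the box
  the absolute value in the statistic grows by at most sqrt r + sqrt s, which (\<tau> - \<tau>') l
  absorbs.\<close>

lemma eventually_C_law_box:
  fixes r s u v \<tau> \<tau>' \<xi> :: real
  assumes r: "r > 0" and s: "s \<ge> 0" and v: "v \<ge> 0" and \<tau>: "\<tau>' < \<tau>" "\<tau> \<le> sqrt (r + s) * v - \<bar>sqrt r * u + sqrt s * v\<bar>"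
    and \<xi>: "\<xi> > 0"
  shows "\<forall>\<^sub>F n in sequentially. measure (C_law n r s) {..<- (\<tau>' * sqrt (2 * ln (real n)))}
      \<ge> real n powr (- (u\<^sup>2 + (v - sqrt (r + s))\<^sup>2 + \<xi>))"
proof -
  define w where "w = sqrt (r + s)"
  define c where "c = \<bar>u\<bar> + \<bar>v - w\<bar>"
  have "\<forall>\<^sub>F n::nat in sequentially. sqrt r + sqrt s < (\<tau> - \<tau>') * sqrt (2 * ln (real n))"
    using \<tau>(1) by real_asymp
  moreover have "\<forall>\<^sub>F n::nat in sequentially. c * sqrt (2 * ln (real n)) + 1 + ln (2 * pi) \<le> \<xi> * ln (real n)"
    using \<xi> by real_asymp
  moreover have "\<forall>\<^sub>F n::nat in sequentially. n \<ge> 1" by (rule eventually_ge_at_top)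
  ultimately show ?thesis
  proof eventually_elim
    case (elim n)
    define l where "l = sqrt (2 * ln (real n))"
    define m where "m = sqrt (2 * (r + s) * ln (real n))"
    have l: "l \<ge> 0" "l\<^sup>2 = 2 * ln (real n)" using elim(3) by (simp_all add: l_def)
    have m: "m = w * l" unfolding m_def l_def w_def real_sqrt_mult[symmetric] by (simp add: mult_ac)
    interpret M1: prob_space "normal_law 0" by (rule prob_space_normal_law)
    interpret M2: prob_space "normal_law m" by (rule prob_space_normal_law)
    interpret P: prob_space "normal_law 0 \<Otimes>\<^sub>M normal_law m" by (rule prob_space_pair_normal_law)
    let ?g = "\<lambda>(u, v). \<bar>sqrt r * u + sqrt s * v\<bar> - sqrt (r + s) * \<bar>v\<bar>"
    have "real n powr (- (u\<^sup>2 + (v - w)\<^sup>2 + \<xi>)) \<le>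
        exp (- (\<bar>u * l - 0\<bar> + 1)\<^sup>2 / 2) / sqrt (2 * pi) * (exp (- (\<bar>v * l - m\<bar> + 1)\<^sup>2 / 2) / sqrt (2 * pi))"
    proof -
      have a1: "\<bar>u * l - 0\<bar> = \<bar>u\<bar> * l" using l by (simp add: abs_mult)
      have a2: "\<bar>v * l - m\<bar> = \<bar>v - w\<bar> * l" using l unfolding m by (simp add: left_diff_distrib[symmetric] abs_mult)
      have "- (\<bar>u * l - 0\<bar> + 1)\<^sup>2 / 2 + - (\<bar>v * l - m\<bar> + 1)\<^sup>2 / 2 = - ((u\<^sup>2 + (v - w)\<^sup>2) * (l\<^sup>2 / 2)) - c * l - 1"
        unfolding a1 a2 c_def by (simp add: power2_sum power_mult_distrib field_simps)
      also have "\<dots> = - ((u\<^sup>2 + (v - w)\<^sup>2) * ln (real n)) - c * l - 1" unfolding l by simp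
      finally have eq: "- (\<bar>u * l - 0\<bar> + 1)\<^sup>2 / 2 + - (\<bar>v * l - m\<bar> + 1)\<^sup>2 / 2 = - ((u\<^sup>2 + (v - w)\<^sup>2) * ln (real n)) - c * l - 1" .
      have "real n powr (- (u\<^sup>2 + (v - w)\<^sup>2 + \<xi>)) = exp (- ((u\<^sup>2 + (v - w)\<^sup>2) * ln (real n)) - \<xi> * ln (real n))"
        using elim(3) by (simp add: powr_def algebra_simps)
      also have "\<dots> \<le> exp (- ((u\<^sup>2 + (v - w)\<^sup>2) * ln (real n)) - c * l - 1 - ln (2 * pi))"
        using elim(2) by (simp add: l_def)
      also have "\<dots> = exp (- (\<bar>u * l - 0\<bar> + 1)\<^sup>2 / 2 + - (\<bar>v * l - m\<bar> + 1)\<^sup>2 / 2) / (2 * pi)"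
        unfolding eq exp_diff[of _ "ln (2 * pi)"] by simp
      finally show ?thesis by (simp only: exp_add) simp
    qed
    also have "\<dots> \<le> measure (normal_law 0) {u * l..u * l + 1} * measure (normal_law m) {v * l..v * l + 1}"
      by (intro mult_mono normal_law_unit_interval_ge) simp_all
    also have "\<dots> = measure (normal_law 0 \<Otimes>\<^sub>M normal_law m) ({u * l..u * l + 1} \<times> {v * l..v * l + 1})"
      by (simp add: measure_def M2.emeasure_pair_measure_Times enn2real_mult)
    also have "\<dots> \<le> measure (normal_law 0 \<Otimes>\<^sub>M normal_law m) (?g -` {..<- (\<tau>' * l)} \<inter> space (normal_law 0 \<Otimes>\<^sub>M normal_law m))"
    proof (intro P.finite_measure_mono)
      show "?g -` {..<- (\<tau>' * l)} \<inter> space (normal_law 0 \<Otimes>\<^sub>M normal_law m) \<in> sets (normal_law 0 \<Otimes>\<^sub>M normal_law m)"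
        by (rule measurable_sets[where A=borel]) simp_all
      show "{u * l..u * l + 1} \<times> {v * l..v * l + 1} \<subseteq> ?g -` {..<- (\<tau>' * l)} \<inter> space (normal_law 0 \<Otimes>\<^sub>M normal_law m)"
      proof safe
        fix x y assume x: "x \<in> {u * l..u * l + 1}" and y: "y \<in> {v * l..v * l + 1}"
        have "0 \<le> v * l" using v l by simp
        have "\<bar>sqrt r * x + sqrt s * y\<bar> \<le> \<bar>sqrt r * (u * l) + sqrt s * (v * l)\<bar> + \<bar>sqrt r * (x - u * l) + sqrt s * (y - v * l)\<bar>"
          by (simp add: algebra_simps)
        also have "\<bar>sqrt r * (u * l) + sqrt s * (v * l)\<bar> = \<bar>sqrt r * u + sqrt s * v\<bar> * l"
          using abs_mult[of "sqrt r * u + sqrt s * v" l] l(1) by (simp add: algebra_simps)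
        also have "\<bar>sqrt r * (x - u * l) + sqrt s * (y - v * l)\<bar> \<le> sqrt r * 1 + sqrt s * 1"
        proof -
          have "sqrt r * (x - u * l) \<le> sqrt r * 1" "sqrt s * (y - v * l) \<le> sqrt s * 1"
            using x y r s by (intro mult_left_mono; simp)+
          moreover have "0 \<le> sqrt r * (x - u * l)" "0 \<le> sqrt s * (y - v * l)" using x y r s by simp_all
          ultimately show ?thesis by linarith
        qed
        finally have 1: "\<bar>sqrt r * x + sqrt s * y\<bar> \<le> \<bar>sqrt r * u + sqrt s * v\<bar> * l + (sqrt r + sqrt s)" by simp
        have 2: "w * \<bar>y\<bar> \<ge> w * v * l"
          using y \<open>0 \<le> v * l\<close> r s by (simp add: w_def mult.assoc mult_left_mono)
        have "(w * v - \<bar>sqrt r * u + sqrt s * v\<bar>) * l \<ge> \<tau> * l"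
          using \<tau>(2) l by (intro mult_right_mono) (simp_all add: w_def)
        moreover have "sqrt r + sqrt s < \<tau> * l - \<tau>' * l" using elim(1) by (simp add: l_def algebra_simps)
        ultimately show "(x, y) \<in> ?g -` {..<- (\<tau>' * l)}"
          using 1 2 by (simp add: w_def[symmetric] algebra_simps)
      qed (simp add: space_pair_measure)
    qed
    also have "\<dots> = measure (C_law n r s) {..<- (\<tau>' * l)}"
      unfolding C_law_def m_def[symmetric] by (simp add: measure_distr)
    finally show ?case by (simp add: l_def w_def)
  qed
qed


section \<open>The supremum of the standardized empirical process\<close>

lemma exp_le_quadratic:
  fixes x a :: real assumes "\<bar>x\<bar> \<le> a"
  shows "exp x \<le> 1 + x + x\<^sup>2 / 2 * exp a"
proof -
  obtain t where t: "\<bar>t\<bar> \<le> \<bar>x\<bar>" "exp x = (\<Sum>m<2. x ^ m / fact m) + exp t / fact 2 * x ^ 2"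
    using Maclaurin_exp_le[of x 2] by blast
  have "exp t \<le> exp a" using t(1) assms by simp
  then have "x\<^sup>2 / 2 * exp t \<le> x\<^sup>2 / 2 * exp a" by (intro mult_left_mono) auto
  then show ?thesis using t(2) by (simp add: lessThan_nat_numeral fact_numeral mult.commute)
qed

text \<open>Upper tails, ordered by decreasing threshold, and lower tails, ordered by increasing
  threshold, are both instances; each is used where its probability is at most 1/2. The laws
  \<open>M i\<close> may differ, because the labels do, but they agree on the sets.\<close>

locale nested_sample =
  fixes n :: nat and M :: "nat \<Rightarrow> 'a measure" and A :: "real \<Rightarrow> 'a set" and p :: "real \<Rightarrow> real" and T :: "real set"
  assumes n_pos: "n > 0"
    and prob_M: "\<And>i. prob_space (M i)"
    and sets_A: "\<And>i t. t \<in> T \<Longrightarrow> A t \<in> sets (M i)"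
    and mono_A: "\<And>t u. t \<in> T \<Longrightarrow> u \<in> T \<Longrightarrow> t \<le> u \<Longrightarrow> A t \<subseteq> A u"
    and measure_A: "\<And>i t. i < n \<Longrightarrow> t \<in> T \<Longrightarrow> measure (M i) (A t) = p t"
    and finite_T: "finite T"
    and p_half: "\<And>t. t \<in> T \<Longrightarrow> p t \<le> 1/2"
begin

abbreviation P where "P \<equiv> PiM {..<n} M"

text \<open>The normalization makes \<open>m t\<close> equal to 1 on all of \<open>A t\<close>, for
  every t, so that an observation that has entered the sets contributes no further increments.
  \<open>v t\<close> is the variance of \<open>Z t\<close>.\<close>

definition m :: "real \<Rightarrow> 'a \<Rightarrow> real" where "m t y = (indicator (A t) y - p t) / (1 - p t)"
definition Z :: "real \<Rightarrow> (nat \<Rightarrow> 'a) \<Rightarrow> real" where "Z t x = (\<Sum>i<n. m t (x i))"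
definition v :: "real \<Rightarrow> real" where "v t = real n * (p t / (1 - p t))"
abbreviation exceedance where "exceedance x \<equiv> {\<omega>\<in>space P. \<exists>t\<in>T. \<bar>Z t \<omega>\<bar> > x * sqrt (v t)}"

sublocale M: prob_space "M i" for i by (rule prob_M)
sublocale product_prob_space M "{..<n}" by standard
sublocale P: prob_space P by (rule prob_space_PiM) (rule prob_M)

lemma p_nonneg: "t \<in> T \<Longrightarrow> p t \<ge> 0"
  using measure_A[of 0 t] n_pos measure_nonneg[of "M 0" "A t"] by simp

lemma measurable_m [measurable]: "t \<in> T \<Longrightarrow> m t \<in> borel_measurable (M i)"
  unfolding m_def[abs_def] using sets_A[of t i] by measurable

lemma measurable_Z [measurable]: "t \<in> T \<Longrightarrow> Z t \<in> borel_measurable P"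
  unfolding Z_def[abs_def] by measurable

lemma m_in: "t \<in> T \<Longrightarrow> y \<in> A t \<Longrightarrow> m t y = 1"
  using p_half[of t] by (simp add: m_def)

lemma m_notin: "y \<notin> A t \<Longrightarrow> m t y = - (p t / (1 - p t))"
  by (simp add: m_def)

lemma odds_le_1: "t \<in> T \<Longrightarrow> p t / (1 - p t) \<le> 1" and odds_nonneg: "t \<in> T \<Longrightarrow> 0 \<le> p t / (1 - p t)"
  using p_half[of t] p_nonneg[of t] by (simp_all add: divide_le_eq)

lemma abs_m_le: "t \<in> T \<Longrightarrow> \<bar>m t y\<bar> \<le> 1"
proof (cases "y \<in> A t")
  case False
  assume t: "t \<in> T"
  have "\<bar>m t y\<bar> = p t / (1 - p t)"
    unfolding m_notin[OF False] abs_minus_cancel using odds_nonneg[OF t] by (rule abs_of_nonneg)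
  then show ?thesis using odds_le_1[OF t] by simp
qed (simp add: m_in)

lemma abs_Z_le: "t \<in> T \<Longrightarrow> \<bar>Z t x\<bar> \<le> real n"
proof -
  assume t: "t \<in> T"
  have "\<bar>Z t x\<bar> \<le> (\<Sum>i<n. \<bar>m t (x i)\<bar>)" unfolding Z_def by (rule sum_abs)
  also have "\<dots> \<le> (\<Sum>i<n. 1)" by (intro sum_mono abs_m_le t)
  finally show ?thesis by simp
qed

lemma integrable_m: "t \<in> T \<Longrightarrow> integrable (M i) (m t)"
  by (rule M.integrable_const_bound[where B=1]) (auto simp: abs_m_le)

lemma integral_m: "i < n \<Longrightarrow> t \<in> T \<Longrightarrow> (\<integral>y. m t y \<partial>M i) = 0"
proof -
  assume i: "i < n" and t: "t \<in> T"
  have "integrable (M i) (indicator (A t) :: 'a \<Rightarrow> real)" using sets_A[OF t] by (simp add: M.emeasure_eq_measure)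
  then have "(\<integral>y. m t y \<partial>M i) = (measure (M i) (A t) - p t) / (1 - p t)"
    unfolding m_def using sets_A[OF t] M.prob_space by simp
  then show ?thesis using measure_A[OF i t] by simp
qed

text \<open>
  \<open>Z\<close> is a martingale in \<open>t\<close>. No filtration is needed: that \<open>h\<close> depends on an observation outside
  \<open>A t\<close> only through being outside is what measurability with respect to the past amounts to.
\<close>

lemma integral_increment:
  assumes t: "t \<in> T" "u \<in> T" "t \<le> u" and h[measurable]: "h \<in> borel_measurable P" and bd: "\<And>x. \<bar>h x\<bar> \<le> B"
    and loc: "\<And>i x a b. i < n \<Longrightarrow> a \<notin> A t \<Longrightarrow> b \<notin> A t \<Longrightarrow> h (x(i := a)) = h (x(i := b))"
  shows "(\<integral>x. (Z u x - Z t x) * h x \<partial>P) = 0"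
proof -
  note [measurable] = t(1,2)
  have bd2: "\<bar>(m u y - m t y) * h x\<bar> \<le> 2 * B" for y x
  proof -
    have "\<bar>m u y - m t y\<bar> \<le> 2" using abs_m_le[OF t(1), of y] abs_m_le[OF t(2), of y] by linarith
    then show ?thesis unfolding abs_mult using bd[of x] by (intro mult_mono) auto
  qed
  have int: "integrable P (\<lambda>x. (m u (x i) - m t (x i)) * h x)" if "i < n" for i
    by (rule P.integrable_const_bound[where B="2 * B"]) (use bd2 that in auto)
  have zero: "(\<integral>x. (m u (x i) - m t (x i)) * h x \<partial>P) = 0" if i: "i < n" for i
  proof -
    define J where "J = {..<n} - {i}"
    have J: "finite J" "i \<notin> J" "insert i J = {..<n}" using i by (auto simp: J_def)
    have "(\<integral>x. (m u (x i) - m t (x i)) * h x \<partial>P)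
        = (\<integral>x. (\<integral>y. (m u y - m t y) * h (x(i := y)) \<partial>M i) \<partial>PiM J M)"
      using product_integral_insert[OF J(1,2), of "\<lambda>x. (m u (x i) - m t (x i)) * h x"] int[OF i]
      by (simp add: J(3))
    also have "\<dots> = (\<integral>x. 0 \<partial>PiM J M)"
    proof (intro Bochner_Integration.integral_cong refl)
      fix x :: "nat \<Rightarrow> 'a"
      \<comment> \<open>\<open>c\<close> is the common value of \<open>h\<close> for all i-th
        observations outside \<open>A t\<close>. Inside \<open>A t\<close> the increment vanishes,
        since both of its terms are 1.\<close>
      define c where "c = (if \<exists>y. y \<notin> A t then h (x(i := (SOME y. y \<notin> A t))) else 0)"
      have "(m u y - m t y) * h (x(i := y)) = c * (m u y - m t y)" for y
      proof (cases "y \<in> A t")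
        case True
        then have "y \<in> A u" using mono_A[OF t] by auto
        then show ?thesis using True t by (simp add: m_in)
      next
        case False
        then have "(SOME y. y \<notin> A t) \<notin> A t" by (rule someI)
        from loc[OF i False this] have "h (x(i := y)) = c" unfolding c_def using False by metis
        then show ?thesis by simp
      qed
      then have "(\<integral>y. (m u y - m t y) * h (x(i := y)) \<partial>M i) = c * (\<integral>y. m u y - m t y \<partial>M i)"
        by (simp only: integral_mult_right_zero)
      also have "(\<integral>y. m u y - m t y \<partial>M i) = 0"
        unfolding Bochner_Integration.integral_diff[OF integrable_m[OF t(2)] integrable_m[OF t(1)]]
          integral_m[OF i t(2)] integral_m[OF i t(1)] by simp
      finally show "(\<integral>y. (m u y - m t y) * h (x(i := y)) \<partial>M i) = 0" by (simp only: mult_zero_right)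
    qed
    also have "\<dots> = 0" by (rule integral_zero)
    finally show ?thesis .
  qed
  have eq: "(Z u x - Z t x) * h x = (\<Sum>i<n. (m u (x i) - m t (x i)) * h x)" for x
  proof -
    have "Z u x - Z t x = (\<Sum>i<n. (m u (x i) - m t (x i)))"
      unfolding Z_def by (rule sum_subtractf[symmetric])
    then show ?thesis by (simp only: sum_distrib_right)
  qed
  have "(\<integral>x. (\<Sum>i<n. (m u (x i) - m t (x i)) * h x) \<partial>P) = (\<Sum>i<n. \<integral>x. (m u (x i) - m t (x i)) * h x \<partial>P)"
    using int by (intro Bochner_Integration.integral_sum) simp
  also have "\<dots> = 0" by (intro sum.neutral ballI zero) simp
  finally show ?thesis unfolding eq .
qed

text \<open>Doob's argument: the event is split by the first \<open>t\<close> at which the level is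
  reached. The exponential at \<open>u\<close> lies above its tangent at the value for
  \<open>t\<close>, and the linear term integrates to zero by \<open>integral_increment\<close>,
  which stands in for conditional expectations.\<close>

lemma maximal_inequality:
  assumes u: "u \<in> T" "\<And>t. t \<in> T \<Longrightarrow> t \<le> u"
  shows "exp y * P.prob {x\<in>space P. \<exists>t\<in>T. \<alpha> * Z t x \<ge> y} \<le> (\<integral>x. exp (\<alpha> * Z u x) \<partial>P)"
proof -
  note [measurable] = u(1)
  define B where "B t = {x\<in>space P. \<alpha> * Z t x \<ge> y \<and> (\<forall>t'\<in>T. t' < t \<longrightarrow> \<alpha> * Z t' x < y)}" for t
  have B[measurable]: "B t \<in> sets P" if "t \<in> T" for t
  proof -
    have [measurable]: "t' \<in> T \<Longrightarrow> Z t' \<in> borel_measurable P" for t' by simp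
    show ?thesis unfolding B_def using finite_T that by measurable
  qed
  have expbd: "exp (\<alpha> * Z t x) \<le> exp (\<bar>\<alpha>\<bar> * real n)" if "t \<in> T" for t x
  proof -
    have "\<alpha> * Z t x \<le> \<bar>\<alpha>\<bar> * \<bar>Z t x\<bar>" by (metis abs_ge_self abs_mult)
    also have "\<dots> \<le> \<bar>\<alpha>\<bar> * real n" using abs_Z_le[OF that] by (intro mult_left_mono) auto
    finally show ?thesis by simp
  qed
  have int: "integrable P (\<lambda>x. exp (\<alpha> * Z u x))"
    by (rule P.integrable_const_bound[where B="exp (\<bar>\<alpha>\<bar> * real n)"]) (use expbd u in auto)
  have step: "exp y * P.prob (B t) \<le> (\<integral>x. exp (\<alpha> * Z u x) * indicator (B t) x \<partial>P)" if t: "t \<in> T" for t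
  proof -
    note [measurable] = t B[OF t]
    define C where "C x = (\<alpha> * Z t x \<ge> y \<and> (\<forall>t'\<in>T. t' < t \<longrightarrow> \<alpha> * Z t' x < y))" for x
    define h where "h x = exp (\<alpha> * Z t x) * of_bool (C x)" for x
    have Zloc: "Z t' (x(i := a)) = Z t' (x(i := b))" if "i < n" "a \<notin> A t" "b \<notin> A t" "t' \<in> T" "t' \<le> t" for i x a b t'
    proof -
      have "a \<notin> A t'" "b \<notin> A t'" using that mono_A[OF that(4) t] by auto
      then show ?thesis unfolding Z_def by (intro sum.cong) (auto simp: m_notin)
    qed
    have [measurable]: "t' \<in> T \<Longrightarrow> Z t' \<in> borel_measurable P" for t' by simp
    have [measurable]: "h \<in> borel_measurable P" unfolding h_def C_def using finite_T by measurable
    have hloc: "h (x(i := a)) = h (x(i := b))" if "i < n" "a \<notin> A t" "b \<notin> A t" for i x a b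
    proof -
      have "Z t' (x(i := a)) = Z t' (x(i := b))" if "t' \<in> T" "t' \<le> t" for t'
        by (rule Zloc) (use that \<open>i < n\<close> \<open>a \<notin> A t\<close> \<open>b \<notin> A t\<close> in auto)
      then show ?thesis unfolding h_def C_def using t by auto
    qed
    have hbd: "\<bar>h x\<bar> \<le> exp (\<bar>\<alpha>\<bar> * real n)" for x using expbd[OF t, of x] by (simp add: h_def)
    have hB: "h x = exp (\<alpha> * Z t x) * indicator (B t) x" if "x \<in> space P" for x
      using that by (simp add: h_def C_def B_def indicator_def)
    have inth: "integrable P h" by (rule P.integrable_const_bound) (use hbd in auto)
    have intZh: "integrable P (\<lambda>x. (Z u x - Z t x) * h x)"
    proof (rule P.integrable_const_bound[where B="2 * real n * exp (\<bar>\<alpha>\<bar> * real n)"])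
      have "\<bar>(Z u x - Z t x) * h x\<bar> \<le> 2 * real n * exp (\<bar>\<alpha>\<bar> * real n)" for x
        unfolding abs_mult using abs_Z_le[OF t, of x] abs_Z_le[OF u(1), of x] hbd[of x] by (intro mult_mono) auto
      then show "AE x in P. norm ((Z u x - Z t x) * h x) \<le> 2 * real n * exp (\<bar>\<alpha>\<bar> * real n)" by simp
    qed simp
    have "exp y * P.prob (B t) = (\<integral>x. exp y * indicator (B t) x \<partial>P)" by simp
    also have "\<dots> \<le> (\<integral>x. h x \<partial>P)"
    proof (intro integral_mono inth)
      show "integrable P (\<lambda>x. exp y * indicator (B t) x)"
        using B[OF t] by (simp add: P.emeasure_eq_measure)
    qed (auto simp: hB B_def indicator_def)
    also have "\<dots> = (\<integral>x. h x + \<alpha> * ((Z u x - Z t x) * h x) \<partial>P)"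
      using integral_increment[OF t u(1) u(2)[OF t] \<open>h \<in> borel_measurable P\<close> hbd hloc] inth intZh by simp
    also have "\<dots> \<le> (\<integral>x. exp (\<alpha> * Z u x) * indicator (B t) x \<partial>P)"
    proof (intro integral_mono)
      show "integrable P (\<lambda>x. h x + \<alpha> * ((Z u x - Z t x) * h x))" using inth intZh by auto
      show "integrable P (\<lambda>x. exp (\<alpha> * Z u x) * indicator (B t) x)"
        using int by (rule integrable_real_mult_indicator[OF B[OF t]])
      fix x assume x: "x \<in> space P"
      have "exp (\<alpha> * Z t x) * (1 + \<alpha> * (Z u x - Z t x)) \<le> exp (\<alpha> * Z t x) * exp (\<alpha> * (Z u x - Z t x))"
        by (intro mult_left_mono exp_ge_add_one_self) simp
      also have "\<dots> = exp (\<alpha> * Z u x)" by (simp add: algebra_simps flip: exp_add)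
      finally show "h x + \<alpha> * ((Z u x - Z t x) * h x) \<le> exp (\<alpha> * Z u x) * indicator (B t) x"
        using hB[OF x] by (auto simp: indicator_def algebra_simps)
    qed
    finally show ?thesis .
  qed
  have sum_B: "(\<Sum>t\<in>T. indicator (B t) x) \<le> (1::real)" for x
  proof (cases "\<exists>t\<in>T. x \<in> B t")
    case True
    then obtain t where t: "t \<in> T" "x \<in> B t" by auto
    have "x \<notin> B t'" if "t' \<in> T" "t' \<noteq> t" for t' using t that by (auto simp: B_def not_le neq_iff dest: leD)
    then have "(\<Sum>t'\<in>T. indicator (B t') x) = (\<Sum>t'\<in>T. if t' = t then 1 else (0::real))"
      using t by (intro sum.cong) (auto simp: indicator_def)
    then show ?thesis using finite_T t by simp
  qed simp
  have "{x\<in>space P. \<exists>t\<in>T. \<alpha> * Z t x \<ge> y} \<subseteq> (\<Union>t\<in>T. B t)"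
  proof
    fix x assume x: "x \<in> {x\<in>space P. \<exists>t\<in>T. \<alpha> * Z t x \<ge> y}"
    define S where "S = {t\<in>T. \<alpha> * Z t x \<ge> y}"
    have S: "finite S" "S \<noteq> {}" using finite_T x by (auto simp: S_def)
    then have "Min S \<in> S" by simp
    moreover have "\<And>t'. t' \<in> T \<Longrightarrow> t' < Min S \<Longrightarrow> \<alpha> * Z t' x < y"
      using Min_le[OF S(1)] by (force simp: S_def not_le)
    ultimately have "x \<in> B (Min S)" "Min S \<in> T" using x by (auto simp: B_def S_def)
    then show "x \<in> (\<Union>t\<in>T. B t)" by auto
  qed
  then have "P.prob {x\<in>space P. \<exists>t\<in>T. \<alpha> * Z t x \<ge> y} \<le> P.prob (\<Union>t\<in>T. B t)"
    using finite_T B by (intro P.finite_measure_mono) auto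
  also have "\<dots> \<le> (\<Sum>t\<in>T. P.prob (B t))"
    using finite_T B by (intro P.finite_measure_subadditive_finite) auto
  finally have "exp y * P.prob {x\<in>space P. \<exists>t\<in>T. \<alpha> * Z t x \<ge> y} \<le> (\<Sum>t\<in>T. exp y * P.prob (B t))"
    by (simp flip: sum_distrib_left)
  also have "\<dots> \<le> (\<Sum>t\<in>T. \<integral>x. exp (\<alpha> * Z u x) * indicator (B t) x \<partial>P)" by (intro sum_mono step)
  also have "\<dots> = (\<integral>x. (\<Sum>t\<in>T. exp (\<alpha> * Z u x) * indicator (B t) x) \<partial>P)"
    using integrable_real_mult_indicator[OF B int] by (subst Bochner_Integration.integral_sum) auto
  also have "\<dots> \<le> (\<integral>x. exp (\<alpha> * Z u x) \<partial>P)"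
  proof (intro integral_mono int Bochner_Integration.integrable_sum)
    show "integrable P (\<lambda>x. exp (\<alpha> * Z u x) * indicator (B t) x)" if "t \<in> T" for t
      by (rule integrable_real_mult_indicator[OF B[OF that] int])
    fix x
    have "(\<Sum>t\<in>T. exp (\<alpha> * Z u x) * indicator (B t) x) = exp (\<alpha> * Z u x) * (\<Sum>t\<in>T. indicator (B t) x)"
      by (simp add: sum_distrib_left)
    also have "\<dots> \<le> exp (\<alpha> * Z u x) * 1" by (intro mult_left_mono sum_B) simp
    finally show "(\<Sum>t\<in>T. exp (\<alpha> * Z u x) * indicator (B t) x) \<le> exp (\<alpha> * Z u x)" by simp
  qed
  finally show ?thesis .
qed

text \<open>For each observation the linear terms of the two values cancel, (1 - p) g = p, and the
  quadratic terms add up to the variance, p + p g = g. The price is the factor exp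
  \<bar>\<alpha>\<bar>, which is close to 1 for small \<alpha>.\<close>

lemma mgf_Z:
  assumes u: "u \<in> T"
  shows "(\<integral>x. exp (\<alpha> * Z u x) \<partial>P) \<le> exp (\<alpha>\<^sup>2 / 2 * exp \<bar>\<alpha>\<bar> * v u)"
proof -
  note [measurable] = u
  define g where "g = p u / (1 - p u)"
  have g: "0 \<le> g" "g \<le> 1" using odds_le_1[OF u] odds_nonneg[OF u] by (simp_all add: g_def)
  have p: "0 \<le> p u" "p u \<le> 1/2" using p_nonneg[OF u] p_half[OF u] by simp_all
  have pg: "(1 - p u) * g = p u" using p by (simp add: g_def)
  have int: "integrable (M i) (\<lambda>y. exp (\<alpha> * m u y))" for i
  proof (rule M.integrable_const_bound[where B="exp \<bar>\<alpha>\<bar>"])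
    have "\<alpha> * m u y \<le> \<bar>\<alpha>\<bar>" for y
    proof -
      have "\<alpha> * m u y \<le> \<bar>\<alpha>\<bar> * \<bar>m u y\<bar>" by (metis abs_ge_self abs_mult)
      also have "\<dots> \<le> \<bar>\<alpha>\<bar> * 1" by (intro mult_left_mono abs_m_le u) simp
      finally show ?thesis by simp
    qed
    then show "AE y in M i. norm (exp (\<alpha> * m u y)) \<le> exp \<bar>\<alpha>\<bar>" by simp
  qed simp
  have one: "(\<integral>y. exp (\<alpha> * m u y) \<partial>M i) \<le> exp (\<alpha>\<^sup>2 / 2 * exp \<bar>\<alpha>\<bar> * g)" if i: "i < n" for i
  proof -
    have iA: "integrable (M i) (indicator (A u) :: 'a \<Rightarrow> real)" using sets_A[OF u] by (simp add: M.emeasure_eq_measure)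
    have "exp (\<alpha> * m u y) = exp (- (\<alpha> * g)) + (exp \<alpha> - exp (- (\<alpha> * g))) * indicator (A u) y" for y
      using u by (cases "y \<in> A u") (simp_all add: m_in m_notin g_def)
    then have "(\<integral>y. exp (\<alpha> * m u y) \<partial>M i) = exp (- (\<alpha> * g)) + (exp \<alpha> - exp (- (\<alpha> * g))) * p u"
      using iA M.prob_space sets_A[OF u] measure_A[OF i u] by simp
    also have "\<dots> = p u * exp \<alpha> + (1 - p u) * exp (- (\<alpha> * g))" by (simp add: algebra_simps)
    also have "\<dots> \<le> p u * (1 + \<alpha> + \<alpha>\<^sup>2 / 2 * exp \<bar>\<alpha>\<bar>) + (1 - p u) * (1 + - (\<alpha> * g) + (- (\<alpha> * g))\<^sup>2 / 2 * exp \<bar>\<alpha>\<bar>)"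
    proof (intro add_mono mult_left_mono exp_le_quadratic)
      show "\<bar>- (\<alpha> * g)\<bar> \<le> \<bar>\<alpha>\<bar>" using g by (simp add: abs_mult mult_left_le)
    qed (use p in auto)
    also have "\<dots> = 1 + \<alpha> * (p u - (1 - p u) * g) + \<alpha>\<^sup>2 / 2 * exp \<bar>\<alpha>\<bar> * (p u + ((1 - p u) * g) * g)"
      by (simp add: power2_eq_square field_simps)
    also have "\<dots> = 1 + \<alpha>\<^sup>2 / 2 * exp \<bar>\<alpha>\<bar> * g"
    proof -
      have "p u + p u * g = g" using pg by (simp add: algebra_simps)
      then show ?thesis unfolding pg by simp
    qed
    also have "\<dots> \<le> exp (\<alpha>\<^sup>2 / 2 * exp \<bar>\<alpha>\<bar> * g)" by (rule exp_ge_add_one_self)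
    finally show ?thesis .
  qed
  have "(\<integral>x. exp (\<alpha> * Z u x) \<partial>P) = (\<integral>x. (\<Prod>i<n. exp (\<alpha> * m u (x i))) \<partial>P)"
    by (simp add: Z_def sum_distrib_left exp_sum)
  also have "\<dots> = (\<Prod>i<n. \<integral>y. exp (\<alpha> * m u y) \<partial>M i)"
    using int by (intro product_integral_prod) auto
  also have "\<dots> \<le> (\<Prod>i<n. exp (\<alpha>\<^sup>2 / 2 * exp \<bar>\<alpha>\<bar> * g))"
    using one by (intro prod_mono) (auto intro!: integral_nonneg)
  also have "\<dots> = exp (\<alpha>\<^sup>2 / 2 * exp \<bar>\<alpha>\<bar> * v u)"
    by (simp add: v_def g_def flip: exp_of_nat_mult)
  finally show ?thesis .
qed

lemma nested_sample_subset:
  assumes T': "T' \<subseteq> T" shows "nested_sample n M A p T'"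
proof
  show "finite T'" using T' finite_T by (rule finite_subset)
  show "A t \<subseteq> A u" if "t \<in> T'" "u \<in> T'" "t \<le> u" for t u
    using that T' by (intro mono_A) auto
qed (use T' in \<open>blast intro: n_pos prob_M sets_A measure_A p_half\<close>)+

text \<open>Within a block the level is taken at the smallest variance and the exponential moment at
  the largest, so the loss is governed by V / c. The factor 2 accounts for both signs of
  \<open>Z\<close>.\<close>

lemma block_bound:
  assumes c: "c > 0" and V: "\<And>t. t \<in> T \<Longrightarrow> c \<le> v t" "\<And>t. t \<in> T \<Longrightarrow> v t \<le> V" and x: "x > 0" and l: "\<alpha> > 0"
  shows "P.prob (exceedance x) \<le> 2 * exp (\<alpha>\<^sup>2 / 2 * exp \<alpha> * V - \<alpha> * x * sqrt c)"
proof (cases "T = {}")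
  case False
  define u where "u = Max T"
  have u: "u \<in> T" "\<And>t. t \<in> T \<Longrightarrow> t \<le> u" using False finite_T by (auto simp: u_def)
  have [measurable]: "t' \<in> T \<Longrightarrow> Z t' \<in> borel_measurable P" for t' by simp
  define y where "y = \<alpha> * x * sqrt c"
  have ev: "P.prob {\<omega>\<in>space P. \<exists>t\<in>T. \<mu> * Z t \<omega> \<ge> y} \<le> exp (\<alpha>\<^sup>2 / 2 * exp \<alpha> * V - y)" if "\<bar>\<mu>\<bar> = \<alpha>" for \<mu>
  proof -
    have "exp y * P.prob {\<omega>\<in>space P. \<exists>t\<in>T. \<mu> * Z t \<omega> \<ge> y} \<le> exp (\<mu>\<^sup>2 / 2 * exp \<bar>\<mu>\<bar> * v u)"
      using maximal_inequality[OF u] mgf_Z[OF u(1)] by (rule order_trans)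
    also have "\<mu>\<^sup>2 = \<alpha>\<^sup>2" using that by (metis power2_abs)
    also have "exp (\<alpha>\<^sup>2 / 2 * exp \<bar>\<mu>\<bar> * v u) \<le> exp (\<alpha>\<^sup>2 / 2 * exp \<alpha> * V)"
      using V(2)[OF u(1)] that by (simp add: mult_left_mono)
    finally show ?thesis by (simp add: exp_diff pos_le_divide_eq mult.commute)
  qed
  have "exceedance x
      \<subseteq> {\<omega>\<in>space P. \<exists>t\<in>T. \<alpha> * Z t \<omega> \<ge> y} \<union> {\<omega>\<in>space P. \<exists>t\<in>T. (- \<alpha>) * Z t \<omega> \<ge> y}"
  proof
    fix \<omega> assume w: "\<omega> \<in> exceedance x"
    then obtain t where t: "t \<in> T" "\<bar>Z t \<omega>\<bar> > x * sqrt (v t)" by auto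
    have "x * sqrt c \<le> x * sqrt (v t)" using V(1)[OF t(1)] x by (intro mult_left_mono) auto
    with t have "x * sqrt c \<le> \<bar>Z t \<omega>\<bar>" by linarith
    then have "\<alpha> * (x * sqrt c) \<le> \<alpha> * \<bar>Z t \<omega>\<bar>" using l by (intro mult_left_mono) auto
    also have "\<alpha> * \<bar>Z t \<omega>\<bar> = \<bar>\<alpha> * Z t \<omega>\<bar>" using l by (simp add: abs_mult)
    finally have "y \<le> \<alpha> * Z t \<omega> \<or> y \<le> (- \<alpha>) * Z t \<omega>" by (auto simp: y_def mult.assoc abs_if split: if_splits)
    then show "\<omega> \<in> {\<omega>\<in>space P. \<exists>t\<in>T. \<alpha> * Z t \<omega> \<ge> y} \<union> {\<omega>\<in>space P. \<exists>t\<in>T. (- \<alpha>) * Z t \<omega> \<ge> y}"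
      using w t(1) by auto
  qed
  moreover have S: "{\<omega>\<in>space P. \<exists>t\<in>T. \<mu> * Z t \<omega> \<ge> y} \<in> sets P" for \<mu>
    using finite_T by measurable
  ultimately have "P.prob (exceedance x)
      \<le> P.prob ({\<omega>\<in>space P. \<exists>t\<in>T. \<alpha> * Z t \<omega> \<ge> y} \<union> {\<omega>\<in>space P. \<exists>t\<in>T. (- \<alpha>) * Z t \<omega> \<ge> y})"
    by (intro P.finite_measure_mono sets.Un S)
  also have "\<dots> \<le> P.prob {\<omega>\<in>space P. \<exists>t\<in>T. \<alpha> * Z t \<omega> \<ge> y} + P.prob {\<omega>\<in>space P. \<exists>t\<in>T. (- \<alpha>) * Z t \<omega> \<ge> y}"
    by (intro measure_subadditive S) (simp_all add: P.emeasure_eq_measure)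
  also have "\<dots> \<le> exp (\<alpha>\<^sup>2 / 2 * exp \<alpha> * V - y) + exp (\<alpha>\<^sup>2 / 2 * exp \<alpha> * V - y)"
    using l by (intro add_mono ev) auto
  finally show ?thesis by (simp add: y_def)
qed simp

end

context nested_sample begin

lemma prob_component: "i < n \<Longrightarrow> t \<in> T \<Longrightarrow> P.prob {\<omega>\<in>space P. \<omega> i \<in> A t} = p t"
proof -
  assume i: "i < n" and t: "t \<in> T"
  have "P.prob {\<omega>\<in>space P. \<omega> i \<in> A t} = measure (distr P (M i) (\<lambda>\<omega>. \<omega> i)) (A t)"
    using i sets_A[OF t] by (subst measure_distr) (auto intro!: arg_cong[where f="measure P"])
  also have "distr P (M i) (\<lambda>\<omega>. \<omega> i) = M i"
    using i by (intro distr_PiM_component prob_M) auto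
  finally show ?thesis using measure_A[OF i t] by simp
qed

text \<open>
  With high probability no observation lies in the largest of these sets, and then \<open>Z t = - v t\<close>.
\<close>

lemma small_odds_bound:
  assumes c: "c > 0" "sqrt c < x" and V: "\<And>t. t \<in> T \<Longrightarrow> v t < c"
  shows "P.prob (exceedance x) \<le> c"
proof (cases "T = {}")
  case False
  define u where "u = Max T"
  have u: "u \<in> T" "\<And>t. t \<in> T \<Longrightarrow> t \<le> u" using False finite_T by (auto simp: u_def)
  have S: "{\<omega>\<in>space P. \<omega> i \<in> A u} \<in> sets P" if "i < n" for i
    using that by (intro sets_Collect_single sets_A u) simp
  have "exceedance x \<subseteq> (\<Union>i<n. {\<omega>\<in>space P. \<omega> i \<in> A u})"
  proof (rule ccontr)
    assume "\<not> ?thesis"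
    then obtain \<omega> t where w: "\<omega> \<in> space P" "t \<in> T" "\<bar>Z t \<omega>\<bar> > x * sqrt (v t)" "\<And>i. i < n \<Longrightarrow> \<omega> i \<notin> A u" by auto
    have "\<And>i. i < n \<Longrightarrow> \<omega> i \<notin> A t" using w(4) mono_A[OF w(2) u(1) u(2)[OF w(2)]] by auto
    then have "Z t \<omega> = - v t" unfolding Z_def v_def by (simp add: m_notin)
    moreover have v0: "v t \<ge> 0" unfolding v_def by (intro mult_nonneg_nonneg odds_nonneg w) simp
    ultimately have "\<bar>Z t \<omega>\<bar> = sqrt (v t) * sqrt (v t)" by simp
    also have "\<dots> \<le> x * sqrt (v t)"
    proof (intro mult_right_mono)
      have "sqrt (v t) \<le> sqrt c" using V[OF w(2)] by simp
      then show "sqrt (v t) \<le> x" using c by linarith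
    qed (use v0 in simp)
    finally show False using w(3) by simp
  qed
  then have "P.prob (exceedance x) \<le> P.prob (\<Union>i<n. {\<omega>\<in>space P. \<omega> i \<in> A u})"
    using S by (intro P.finite_measure_mono) auto
  also have "\<dots> \<le> (\<Sum>i<n. P.prob {\<omega>\<in>space P. \<omega> i \<in> A u})"
    using S by (intro P.finite_measure_subadditive_finite) auto
  also have "\<dots> = real n * p u" using u(1) by (simp add: prob_component)
  also have "\<dots> \<le> v u"
  proof -
    have "p u * 1 \<le> p u * (1 / (1 - p u))"
      using p_nonneg[OF u(1)] p_half[OF u(1)] by (intro mult_left_mono) (simp_all add: le_divide_eq)
    then show ?thesis unfolding v_def by (intro mult_left_mono) auto
  qed
  also have "\<dots> \<le> c" using V[OF u(1)] by simp
  finally show ?thesis .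
qed (use c in simp)

text \<open>
  The Chernoff parameter is \<open>x / sqrt V\<close> in the Gaussian range, where it is below \<open>a\<close>, and \<open>a\<close> in the
  Poisson range. A sharp constant in the first term requires \<open>\<kappa>\<close> close to \<open>1/2\<close>, so \<open>g\<close> close to \<open>1\<close>
  and \<open>a\<close> close to \<open>0\<close>.
\<close>

lemma geometric_block_bound:
  fixes g a c V x :: real
  assumes a: "a > 0" and c: "c > 0" and g: "g > 1" and x: "x > 0" and V: "V = g\<^sup>2 * c"
    "\<And>t. t \<in> T \<Longrightarrow> c \<le> v t" "\<And>t. t \<in> T \<Longrightarrow> v t \<le> V"
  defines "\<kappa> \<equiv> 1 / g - exp a / 2"
  shows "P.prob (exceedance x)
    \<le> 2 * (exp (- (\<kappa> * x\<^sup>2)) + exp (- (\<kappa> * x * a * sqrt V)))"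
proof -
  have V0: "V > 0" using V(1) c g by simp
  have sc: "sqrt c = sqrt V / g" using V(1) g by (simp add: real_sqrt_mult)
  show ?thesis
  proof (cases "x \<le> a * sqrt V")
    case True
    define l where "l = x / sqrt V"
    have l: "l > 0" "l \<le> a" "l * sqrt V = x" using True V0 x by (simp_all add: l_def divide_le_eq)
    have "l\<^sup>2 / 2 * exp l * V - l * x * sqrt c = (l * sqrt V)\<^sup>2 / 2 * exp l - (l * sqrt V) * x / g"
      using V0 by (simp add: sc power_mult_distrib mult_ac)
    also have "\<dots> \<le> x\<^sup>2 / 2 * exp a - x\<^sup>2 / g"
      unfolding l(3) using l by (simp add: power2_eq_square mult_left_mono)
    also have "\<dots> = - (\<kappa> * x\<^sup>2)" by (simp add: \<kappa>_def algebra_simps)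
    finally have "2 * exp (l\<^sup>2 / 2 * exp l * V - l * x * sqrt c) \<le> 2 * exp (- (\<kappa> * x\<^sup>2))" by simp
    moreover have "P.prob (exceedance x) \<le> 2 * exp (l\<^sup>2 / 2 * exp l * V - l * x * sqrt c)"
      by (rule block_bound[OF c _ _ x l(1)]) (rule V; assumption)+
    ultimately have "P.prob (exceedance x) \<le> 2 * exp (- (\<kappa> * x\<^sup>2))" by (blast intro: order_trans)
    then show ?thesis unfolding distrib_left
      using exp_ge_zero[of "- (\<kappa> * x * a * sqrt V)"] by linarith
  next
    case False
    have "a\<^sup>2 / 2 * exp a * V - a * x * sqrt c = (a * sqrt V)\<^sup>2 / 2 * exp a - a * sqrt V * x / g"
      using V0 by (simp add: sc power_mult_distrib mult_ac)
    also have "\<dots> = a * sqrt V * (a * sqrt V) / 2 * exp a - a * sqrt V * x / g" by (simp only: power2_eq_square)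
    also have "\<dots> \<le> a * sqrt V * x / 2 * exp a - a * sqrt V * x / g"
      using False a V0 by (intro diff_right_mono mult_right_mono divide_right_mono mult_left_mono) auto
    also have "\<dots> = - (\<kappa> * x * a * sqrt V)" by (simp add: \<kappa>_def algebra_simps)
    finally have "2 * exp (a\<^sup>2 / 2 * exp a * V - a * x * sqrt c) \<le> 2 * exp (- (\<kappa> * x * a * sqrt V))" by simp
    moreover have "P.prob (exceedance x) \<le> 2 * exp (a\<^sup>2 / 2 * exp a * V - a * x * sqrt c)"
      by (rule block_bound[OF c _ _ x a]) (rule V; assumption)+
    ultimately have "P.prob (exceedance x) \<le> 2 * exp (- (\<kappa> * x * a * sqrt V))" by (blast intro: order_trans)
    then show ?thesis unfolding distrib_left
      using exp_ge_zero[of "- (\<kappa> * x\<^sup>2)"] by linarith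
  qed
qed

text \<open>Sets with \<open>v t < c\<close> form one exceptional block. Above c each block allows
  \<open>v\<close> to grow by the factor g^2, and K blocks reach n, which bounds \<open>v\<close>
  because the odds are at most 1.\<close>

lemma one_sided_bound:
  fixes g a c x :: real
  assumes a: "a > 0" and c: "c > 0" "sqrt c < x" and g: "g > 1" and K: "K > 0" "real n \<le> c * g ^ (2 * K)"
  defines "\<kappa> \<equiv> 1 / g - exp a / 2"
  shows "P.prob (exceedance x)
    \<le> c + (\<Sum>k<K. 2 * (exp (- (\<kappa> * x\<^sup>2)) + exp (- (\<kappa> * x * a * (sqrt c * g ^ (k + 1))))))"
proof -
  have x: "x > 0" using c by (meson less_trans real_sqrt_gt_zero)
  define T0 where "T0 = {t\<in>T. v t < c}"
  define T1 where "T1 k = {t\<in>T. c * g ^ (2 * k) \<le> v t \<and> v t \<le> c * g ^ (2 * (k + 1))}" for k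
  define E where "E S = {\<omega>\<in>space P. \<exists>t\<in>S. \<bar>Z t \<omega>\<bar> > x * sqrt (v t)}" for S
  have E: "E S \<in> sets P" if "S \<subseteq> T" for S
  proof -
    have "finite S" using that finite_T by (rule finite_subset)
    moreover have [measurable]: "t \<in> S \<Longrightarrow> Z t \<in> borel_measurable P" for t using that by auto
    ultimately show ?thesis unfolding E_def by measurable
  qed
  have cover: "T \<subseteq> T0 \<union> (\<Union>k<K. T1 k)"
  proof
    fix t assume t: "t \<in> T"
    have "v t \<le> real n * 1" unfolding v_def by (intro mult_left_mono odds_le_1 t) simp
    then have vK: "v t \<le> c * g ^ (2 * K)" using K(2) by simp
    have T1_step: "\<exists>k<Suc j. t \<in> T1 k" if "c \<le> v t" "v t \<le> c * g ^ (2 * Suc j)" for j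
      using that
    proof (induction j)
      case 0
      then show ?case using t by (simp add: T1_def power2_eq_square)
    next
      case (Suc j)
      show ?case
      proof (cases "v t \<le> c * g ^ (2 * Suc j)")
        case True
        with Suc show ?thesis by (meson less_SucI)
      next
        case False
        then have "t \<in> T1 (Suc j)" using Suc.prems t by (simp add: T1_def)
        then show ?thesis by auto
      qed
    qed
    obtain j where j: "K = Suc j" using K(1) by (cases K) auto
    show "t \<in> T0 \<union> (\<Union>k<K. T1 k)"
    proof (cases "c \<le> v t")
      case True
      then show ?thesis using T1_step[of j] vK unfolding j by blast
    qed (simp add: T0_def t)
  qed
  have "E T \<subseteq> E T0 \<union> (\<Union>k<K. E (T1 k))" unfolding E_def using cover by blast
  then have "P.prob (E T) \<le> P.prob (E T0 \<union> (\<Union>k<K. E (T1 k)))"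
    by (intro P.finite_measure_mono sets.Un E sets.finite_UN) (auto simp: T0_def T1_def)
  also have "\<dots> \<le> P.prob (E T0) + P.prob (\<Union>k<K. E (T1 k))"
    by (intro measure_subadditive E sets.finite_UN) (auto simp: T0_def T1_def P.emeasure_eq_measure)
  also have "\<dots> \<le> c + (\<Sum>k<K. P.prob (E (T1 k)))"
  proof (intro add_mono P.finite_measure_subadditive_finite)
    interpret T0: nested_sample n M A p T0 by (rule nested_sample_subset) (auto simp: T0_def)
    show "P.prob (E T0) \<le> c" unfolding E_def by (rule T0.small_odds_bound[OF c]) (auto simp: T0_def)
    show "(\<lambda>k. E (T1 k)) ` {..<K} \<subseteq> sets P" using E by (auto simp: T1_def)
  qed simp
  also have "(\<Sum>k<K. P.prob (E (T1 k))) \<le> (\<Sum>k<K. 2 * (exp (- (\<kappa> * x\<^sup>2)) + exp (- (\<kappa> * x * a * (sqrt c * g ^ (k + 1))))))"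
  proof (intro sum_mono)
    fix k
    interpret T1: nested_sample n M A p "T1 k" by (rule nested_sample_subset) (auto simp: T1_def)
    have sq: "sqrt (c * g ^ (2 * (k + 1))) = sqrt c * g ^ (k + 1)"
    proof -
      have "sqrt ((g ^ (k + 1))\<^sup>2) = g ^ (k + 1)" using g by (intro real_sqrt_unique) auto
      then show ?thesis by (simp only: real_sqrt_mult power_even_eq)
    qed
    have "P.prob (E (T1 k)) \<le> 2 * (exp (- ((1 / g - exp a / 2) * x\<^sup>2)) + exp (- ((1 / g - exp a / 2) * x * a * sqrt (c * g ^ (2 * (k + 1))))))"
      unfolding E_def
      by (rule T1.geometric_block_bound[OF a _ g x, of "c * g ^ (2 * k)"]) (use c g in \<open>auto simp: T1_def power2_eq_square\<close>)
    then show "P.prob (E (T1 k)) \<le> 2 * (exp (- (\<kappa> * x\<^sup>2)) + exp (- (\<kappa> * x * a * (sqrt c * g ^ (k + 1)))))"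
      unfolding sq \<kappa>_def .
  qed
  finally show ?thesis by (simp add: E_def)
qed

end

text \<open>Bernoulli's inequality, g^(k + 1) \<ge> 1 + k (g - 1), reduces the sum to a geometric
  series, so the bound does not depend on \<open>K\<close>.\<close>

lemma sum_exp_geometric_le:
  fixes g y :: real
  assumes "g > 1" "y > 0"
  shows "(\<Sum>k<K. exp (- (y * g ^ (k + 1)))) \<le> exp (- y) / (1 - exp (- (y * (g - 1))))"
proof -
  define q where "q = exp (- (y * (g - 1)))"
  have q: "0 < q" "q < 1" using assms by (simp_all add: q_def)
  have "(\<Sum>k<K. exp (- (y * g ^ (k + 1)))) \<le> (\<Sum>k<K. exp (- y) * q ^ k)"
  proof (intro sum_mono)
    fix k
    have "1 + real (k + 1) * (g - 1) \<le> (1 + (g - 1)) ^ (k + 1)" using assms by (intro Bernoulli_inequality) auto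
    moreover have "real k * (g - 1) \<le> real (k + 1) * (g - 1)" using assms by (intro mult_right_mono) auto
    ultimately have "1 + real k * (g - 1) \<le> g ^ (k + 1)" by simp
    then have "y * (1 + real k * (g - 1)) \<le> y * g ^ (k + 1)" using assms by (intro mult_left_mono) auto
    then have "exp (- (y * g ^ (k + 1))) \<le> exp (- y + real k * (- (y * (g - 1))))" by (simp add: algebra_simps)
    also have "\<dots> = exp (- y) * q ^ k" unfolding q_def exp_of_nat_mult[symmetric] exp_add ..
    finally show "exp (- (y * g ^ (k + 1))) \<le> exp (- y) * q ^ k" .
  qed
  also have "\<dots> = exp (- y) * (\<Sum>k<K. q ^ k)" by (simp add: sum_distrib_left)
  also have "(\<Sum>k<K. q ^ k) \<le> 1 / (1 - q)"
    using q by (simp add: sum_gp_strict divide_right_mono)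
  finally show ?thesis using q by (simp add: q_def mult_left_mono)
qed


section \<open>From nested sets to the empirical process on the line\<close>

lemma standardized_odds:
  fixes k p x n :: real
  assumes p: "0 \<le> p" "p \<le> 1/2" and x: "x > 0" and n: "n > 0" and gt: "\<bar>k - n * p\<bar> / sqrt (n * p * (1 - p)) > x"
  shows "\<bar>(k - n * p) / (1 - p)\<bar> > x * sqrt (n * (p / (1 - p)))"
proof -
  define d where "d = sqrt (n * p * (1 - p))"
  have d: "d > 0"
  proof -
    \<comment> \<open>With d = 0 the quotient in \<open>gt\<close> would be 0.\<close>
    have "d \<noteq> 0" using gt x by (auto simp: d_def)
    moreover have "d \<ge> 0" using p n by (simp add: d_def)
    ultimately show ?thesis by simp
  qed
  have "n * p * (1 - p) = n * (p / (1 - p)) * (1 - p)\<^sup>2" using p by (simp add: power2_eq_square)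
  then have "d = sqrt (n * (p / (1 - p))) * (1 - p)" using p by (simp only: d_def real_sqrt_mult real_sqrt_abs)
  moreover have "x * d < \<bar>k - n * p\<bar>" using gt d by (simp add: d_def pos_less_divide_eq)
  ultimately show ?thesis using p by (simp add: pos_less_divide_eq mult.assoc)
qed

text \<open>The observations themselves have different laws, according to their labels; only their
  images under \<open>C\<close> are identically distributed.\<close>

locale iid_sample =
  fixes n :: nat and N :: "'a measure" and M :: "nat \<Rightarrow> 'a measure" and C :: "'a \<Rightarrow> real" and D :: "real measure"
  assumes n_pos: "n > 0"
    and prob_M: "\<And>i. prob_space (M i)"
    and sets_M [measurable_cong]: "\<And>i. sets (M i) = sets N"
    and C [measurable]: "C \<in> borel_measurable N"
    and distr_C: "\<And>i. i < n \<Longrightarrow> distr (M i) borel C = D"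
begin

sublocale M: prob_space "M i" for i by (rule prob_M)
abbreviation P where "P \<equiv> PiM {..<n} M"
sublocale P: prob_space P by (rule prob_space_PiM) (rule prob_M)

definition S :: "real \<Rightarrow> real" where "S t = measure D {t<..}"
definition count :: "real \<Rightarrow> (nat \<Rightarrow> 'a) \<Rightarrow> real" where "count t \<omega> = (\<Sum>i<n. of_bool (C (\<omega> i) > t))"
definition ratio :: "real \<Rightarrow> (nat \<Rightarrow> 'a) \<Rightarrow> real" where
  "ratio t \<omega> = \<bar>count t \<omega> - real n * S t\<bar> / sqrt (real n * S t * (1 - S t))"

lemma space_M: "space (M i) = space N"
  using sets_M by (rule sets_eq_imp_space_eq)

sublocale D: real_distribution D
proof -
  have "real_distribution (distr (M 0) borel C)" by (rule M.real_distribution_distr) simp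
  then show "real_distribution D" using distr_C[OF n_pos] by simp
qed

lemma measure_C: "i < n \<Longrightarrow> B \<in> sets borel \<Longrightarrow> measure (M i) {y\<in>space N. C y \<in> B} = measure D B"
  using distr_C[of i] by (subst (asm) eq_commute)
    (auto simp: measure_distr space_M intro!: arg_cong[where f="measure (M i)"])

lemma S_compl: "measure D {..t} = 1 - S t"
proof -
  have "measure D {..t} = measure D (space D - {t<..})" by (intro arg_cong[where f="measure D"]) auto
  also have "\<dots> = 1 - S t" unfolding S_def by (rule D.prob_compl) simp
  finally show ?thesis .
qed

lemma S_le_1: "S t \<le> 1" and S_nonneg: "S t \<ge> 0" by (simp_all add: S_def)

lemma measurable_count [measurable]: "count t \<in> borel_measurable P"
  unfolding count_def[abs_def] by measurable

lemma measurable_ratio [measurable]: "ratio t \<in> borel_measurable P"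
  unfolding ratio_def[abs_def] by measurable

lemma count_M: "\<omega> \<in> space P \<Longrightarrow> i < n \<Longrightarrow> \<omega> i \<in> space N"
  by (auto simp: space_PiM space_M PiE_iff)

lemma finite_sup_bound:
  fixes g a c x :: real
  assumes a: "a > 0" and c: "c > 0" "sqrt c < x" and g: "g > 1" and K: "K > 0" "real n \<le> c * g ^ (2 * K)"
    and T: "finite T"
  defines "\<kappa> \<equiv> 1 / g - exp a / 2"
  shows "P.prob {\<omega>\<in>space P. \<exists>t\<in>T. ratio t \<omega> > x}
    \<le> 2 * (c + (\<Sum>k<K. 2 * (exp (- (\<kappa> * x\<^sup>2)) + exp (- (\<kappa> * x * a * (sqrt c * g ^ (k + 1)))))))"
    (is "_ \<le> 2 * ?B")
proof -
  have x: "x > 0" using c by (meson less_trans real_sqrt_gt_zero)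
  \<comment> \<open>Each threshold is handled on the side where its tail has probability at most
    1/2. The change of sign turns the shrinking upper tails into growing sets.\<close>
  define T1 where "T1 = uminus ` {t\<in>T. S t \<le> 1/2}"
  define T2 where "T2 = {t\<in>T. S t > 1/2}"
  define A1 where "A1 u = {y\<in>space N. C y > - u}" for u
  define A2 where "A2 t = {y\<in>space N. C y \<le> t}" for t
  interpret L: nested_sample n M A1 "\<lambda>u. S (- u)" T1
  proof
    show "A1 t \<in> sets (M i)" for i t unfolding A1_def sets_M by measurable
    show "measure (M i) (A1 t) = S (- t)" if "i < n" for i t
      using measure_C[OF that, of "{- t<..}"] by (simp add: A1_def S_def)
  qed (use T n_pos in \<open>auto simp: A1_def T1_def\<close>)
  interpret R: nested_sample n M A2 "\<lambda>t. 1 - S t" T2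
  proof
    show "A2 t \<in> sets (M i)" for i t unfolding A2_def sets_M by measurable
    show "measure (M i) (A2 t) = 1 - S t" if "i < n" for i t
      using measure_C[OF that, of "{..t}"] by (simp add: A2_def S_compl)
  qed (use T n_pos in \<open>auto simp: A2_def T2_def\<close>)
  define E1 where "E1 = {\<omega>\<in>space P. \<exists>t\<in>T1. \<bar>L.Z t \<omega>\<bar> > x * sqrt (L.v t)}"
  define E2 where "E2 = {\<omega>\<in>space P. \<exists>t\<in>T2. \<bar>R.Z t \<omega>\<bar> > x * sqrt (R.v t)}"
  have E: "E1 \<in> sets P" "E2 \<in> sets P"
  proof -
    have [measurable]: "\<And>t. t \<in> T1 \<Longrightarrow> L.Z t \<in> borel_measurable P" "\<And>t. t \<in> T2 \<Longrightarrow> R.Z t \<in> borel_measurable P"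
      by (rule L.measurable_Z R.measurable_Z; assumption)+
    note [simp] = L.finite_T R.finite_T
    show "E1 \<in> sets P" "E2 \<in> sets P" unfolding E1_def E2_def by measurable
  qed
  have "{\<omega>\<in>space P. \<exists>t\<in>T. ratio t \<omega> > x} \<subseteq> E1 \<union> E2"
  proof
    fix \<omega> assume "\<omega> \<in> {\<omega>\<in>space P. \<exists>t\<in>T. ratio t \<omega> > x}"
    then obtain t where w: "\<omega> \<in> space P" and t: "t \<in> T" "ratio t \<omega> > x" by auto
    note wN = count_M[OF w]
    show "\<omega> \<in> E1 \<union> E2"
    proof (cases "S t \<le> 1/2")
      case True
      have "L.Z (- t) \<omega> = (count t \<omega> - real n * S t) / (1 - S t)"
        using wN by (simp add: L.Z_def L.m_def count_def A1_def indicator_def of_bool_def sum_subtractf flip: sum_divide_distrib)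
      moreover have "\<bar>(count t \<omega> - real n * S t) / (1 - S t)\<bar> > x * sqrt (real n * (S t / (1 - S t)))"
        using t(2) True n_pos x S_nonneg by (intro standardized_odds) (auto simp: ratio_def)
      ultimately have "\<bar>L.Z (- t) \<omega>\<bar> > x * sqrt (L.v (- t))" by (simp add: L.v_def)
      then have "\<omega> \<in> E1" using w t True by (auto simp: E1_def T1_def)
      then show ?thesis by simp
    next
      case False
      have "R.Z t \<omega> = ((real n - count t \<omega>) - real n * (1 - S t)) / (1 - (1 - S t))"
      proof -
        have "(\<Sum>i<n. indicator (A2 t) (\<omega> i)) = (\<Sum>i<n. 1 - of_bool (C (\<omega> i) > t) :: real)"
          using wN by (intro sum.cong) (auto simp: A2_def indicator_def)
        also have "\<dots> = real n - count t \<omega>" by (simp add: count_def sum_subtractf)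
        finally show ?thesis by (simp add: R.Z_def R.m_def sum_subtractf flip: sum_divide_distrib)
      qed
      moreover have "\<bar>((real n - count t \<omega>) - real n * (1 - S t)) / (1 - (1 - S t))\<bar> > x * sqrt (real n * ((1 - S t) / (1 - (1 - S t))))"
      proof (intro standardized_odds x)
        have "\<bar>real n - count t \<omega> - real n * (1 - S t)\<bar> = \<bar>count t \<omega> - real n * S t\<bar>" by (simp add: algebra_simps abs_minus_commute)
        then show "x < \<bar>real n - count t \<omega> - real n * (1 - S t)\<bar> / sqrt (real n * (1 - S t) * (1 - (1 - S t)))"
          using t(2) by (simp add: ratio_def mult_ac)
      qed (use False n_pos S_le_1 in auto)
      ultimately have "\<bar>R.Z t \<omega>\<bar> > x * sqrt (R.v t)" by (simp add: R.v_def)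
      then have "\<omega> \<in> E2" using w t False by (auto simp: E2_def T2_def)
      then show ?thesis by simp
    qed
  qed
  then have "P.prob {\<omega>\<in>space P. \<exists>t\<in>T. ratio t \<omega> > x} \<le> P.prob (E1 \<union> E2)"
    using E by (intro P.finite_measure_mono) auto
  also have "\<dots> \<le> P.prob E1 + P.prob E2"
    using E by (intro measure_subadditive) (auto simp: P.emeasure_eq_measure)
  also have "\<dots> \<le> ?B + ?B"
    unfolding E1_def E2_def \<kappa>_def by (intro add_mono L.one_sided_bound R.one_sided_bound a c g K)
  finally show ?thesis by simp
qed

text \<open>Counts and tail probabilities are right continuous, so a strict exceedance persists on
  an interval to the right of \<open>t\<close>. The denominator at \<open>t\<close> is nonzero,
  since otherwise the ratio would be 0.\<close>

lemma ratio_rational: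
  assumes x: "x \<ge> 0" and gt: "ratio t \<omega> > x"
  shows "\<exists>q\<in>\<rat>. ratio q \<omega> > x"
proof -
  have S: "(S \<longlongrightarrow> S t) (at_right t)"
  proof -
    have "((\<lambda>u. 1 - cdf D u) \<longlongrightarrow> 1 - cdf D t) (at_right t)"
      using D.cdf_is_right_cont[of t] by (intro tendsto_intros) (simp add: continuous_within)
    then show ?thesis by (simp add: cdf_def S_compl)
  qed
  have "\<forall>\<^sub>F u in at_right t. \<forall>i\<in>{..<n}. (C (\<omega> i) > u) = (C (\<omega> i) > t)"
  proof (intro eventually_ball_finite ballI)
    fix i
    show "\<forall>\<^sub>F u in at_right t. (C (\<omega> i) > u) = (C (\<omega> i) > t)"
    proof (cases "C (\<omega> i) > t")
      case True
      then have "\<forall>\<^sub>F u in at_right t. u < C (\<omega> i)" by (rule eventually_at_right_real[THEN eventually_mono]) simp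
      then show ?thesis using True by simp
    next
      case False
      have "\<forall>\<^sub>F u in at_right t. u > t" by (simp add: eventually_at_right_less)
      then show ?thesis by eventually_elim (use False in auto)
    qed
  qed simp
  then have "\<forall>\<^sub>F u in at_right t. count u \<omega> = count t \<omega>"
    by eventually_elim (simp add: count_def)
  then have cnt: "((\<lambda>u. count u \<omega>) \<longlongrightarrow> count t \<omega>) (at_right t)"
    by (rule tendsto_eventually)
  have "sqrt (real n * S t * (1 - S t)) \<noteq> 0" using gt x n_pos by (auto simp: ratio_def)
  then have "((\<lambda>u. ratio u \<omega>) \<longlongrightarrow> ratio t \<omega>) (at_right t)"
    unfolding ratio_def by (intro tendsto_intros cnt S)
  then have "\<forall>\<^sub>F u in at_right t. ratio u \<omega> > x" using gt by (rule order_tendstoD)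
  then obtain b where b: "b > t" "\<And>y. y > t \<Longrightarrow> y < b \<Longrightarrow> ratio y \<omega> > x"
    by (auto simp: eventually_at_right_field)
  obtain q where "q \<in> \<rat>" "t < q" "q < b" using Rats_dense_in_real[OF b(1)] by auto
  then show ?thesis using b(2) by auto
qed

text \<open>By \<open>ratio_rational\<close> the event is covered by an increasing union of events
  with finitely many rational thresholds, and the bound passes to the union by monotone
  continuity.\<close>

lemma sup_bound:
  assumes x: "x \<ge> 0" and fin: "\<And>T. finite T \<Longrightarrow> P.prob {\<omega>\<in>space P. \<exists>t\<in>T. ratio t \<omega> > x} \<le> B"
  shows "(\<integral>\<^sup>+\<omega>. of_bool (\<exists>t. ratio t \<omega> > x) \<partial>P) \<le> ennreal B"
proof -
  define E where "E k = {\<omega>\<in>space P. \<exists>t\<in>from_nat_into \<rat> ` {..k::nat}. ratio t \<omega> > x}" for k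
  have E: "range E \<subseteq> sets P" unfolding E_def by auto
  have inc: "incseq E" unfolding E_def by (auto simp: incseq_def intro: order_trans)
  have "(\<integral>\<^sup>+\<omega>. of_bool (\<exists>t. ratio t \<omega> > x) \<partial>P) \<le> (\<integral>\<^sup>+\<omega>. indicator (\<Union>k. E k) \<omega> \<partial>P)"
  proof (intro nn_integral_mono)
    fix \<omega> assume w: "\<omega> \<in> space P"
    have "\<omega> \<in> (\<Union>k. E k)" if t: "ratio t \<omega> > x" for t
    proof -
      obtain q where q: "q \<in> \<rat>" "ratio q \<omega> > x" using ratio_rational[OF x t] by auto
      obtain k where "from_nat_into \<rat> k = q"
        using from_nat_into_surj[OF countable_rat q(1)] by auto
      then have "\<omega> \<in> E k" using w q by (auto simp: E_def)
      then show ?thesis by auto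
    qed
    then show "of_bool (\<exists>t. ratio t \<omega> > x) \<le> (indicator (\<Union>k. E k) \<omega> :: ennreal)"
      by (auto simp: of_bool_def)
  qed
  also have "\<dots> = emeasure P (\<Union>k. E k)" using E by (intro nn_integral_indicator) auto
  also have "\<dots> = (SUP k. emeasure P (E k))" by (rule SUP_emeasure_incseq[OF E inc, symmetric])
  also have "\<dots> \<le> ennreal B"
  proof (intro SUP_least)
    fix k
    have "P.prob (E k) \<le> B" unfolding E_def by (rule fin) simp
    then show "emeasure P (E k) \<le> ennreal B" by (simp add: P.emeasure_eq_measure ennreal_leI)
  qed
  finally show ?thesis .
qed

end

text \<open>For g = 1 + h and a = h the expression tends to 1 + \<delta> as h decreases to
  0.\<close>

lemma block_parameters:
  fixes \<delta> :: real assumes "\<delta> > 0"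
  obtains g a where "g > 1" "a > 0" "2 * (1 + \<delta>) * (1 / g - exp a / 2) > 1"
proof -
  have "((\<lambda>h::real. 2 * (1 + \<delta>) * (1 / (1 + h) - exp h / 2)) \<longlongrightarrow> 1 + \<delta>) (at_right 0)"
    by real_asymp
  then have "\<forall>\<^sub>F h in at_right (0::real). 2 * (1 + \<delta>) * (1 / (1 + h) - exp h / 2) > 1"
    by (rule order_tendstoD) (use assms in simp)
  moreover have "\<forall>\<^sub>F h in at_right (0::real). h > 0" by (simp add: eventually_at_right_less)
  ultimately have "\<forall>\<^sub>F h in at_right (0::real). h > 0 \<and> 2 * (1 + \<delta>) * (1 / (1 + h) - exp h / 2) > 1"
    by eventually_elim simp
  then obtain h :: real where "h > 0" "2 * (1 + \<delta>) * (1 / (1 + h) - exp h / 2) > 1"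
    using eventually_happens'[OF trivial_limit_at_right_real] by blast
  then show thesis by (intro that[of "1 + h" h]) auto
qed

text \<open>
  The starting level \<open>c = 1 / x\<close> of the blocks is small enough for a first observation to be unlikely
  below it, and large enough for the number of blocks in the Poisson range not to matter.
\<close>

lemma empirical_sup_null_bound:
  fixes \<delta> :: real assumes \<delta>: "\<delta> > 0"
  obtains B :: "nat \<Rightarrow> real" where "B \<longlonglongrightarrow> 0"
    "\<forall>\<^sub>F n in sequentially. \<forall>N M C D. iid_sample n (N :: 'a measure) M C D \<longrightarrow>
       (\<integral>\<^sup>+\<omega>. of_bool (\<exists>t. iid_sample.ratio n C D t \<omega> > sqrt (2 * (1 + \<delta>) * ln (ln (real n)))) \<partial>PiM {..<n} M) \<le> ennreal (B n)"
proof -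
  obtain g a where ga: "g > 1" "a > 0" "2 * (1 + \<delta>) * (1 / g - exp a / 2) > 1"
    using block_parameters[OF \<delta>] by metis
  define \<kappa> where "\<kappa> = 1 / g - exp a / 2"
  define \<mu> where "\<mu> = 2 * (1 + \<delta>)"
  have \<mu>: "\<mu> > 0" "\<mu> * \<kappa> > 1" using \<delta> ga by (simp_all add: \<mu>_def \<kappa>_def)
  then have \<kappa>: "\<kappa> > 0" by (metis less_trans zero_less_mult_pos zero_less_one)
  define G where "G = 2 * ln g"
  define h where "h = g - 1"
  define \<alpha> where "\<alpha> = \<kappa> * a"
  have pos: "G > 0" "h > 0" "\<alpha> > 0" using ga \<kappa> by (simp_all add: G_def h_def \<alpha>_def)
  define X where "X n = sqrt (\<mu> * ln (ln (real n)))" for n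
  \<comment> \<open>The terms are the exceptional block, about ln n / G blocks in the Gaussian range
    with (ln n) powr (- \<mu> \<kappa>) each, and the blocks in the Poisson range. The second
    vanishes because \<mu> \<kappa> > 1; this is what the constant 2 (1 + \<delta>) in the level of
    the test provides.\<close>
  define B where "B n = 2 * (1 / X n + (2 * ((ln (real n * X n) / G + 2) * exp (- (\<mu> * \<kappa> * ln (ln (real n)))))
     + 2 * (exp (- (\<alpha> * sqrt (X n))) / (1 - exp (- (\<alpha> * sqrt (X n) * h))))))" for n
  have "B \<longlonglongrightarrow> 0"
  proof -
    have 1: "(\<lambda>n. 1 / X n) \<longlonglongrightarrow> 0" unfolding X_def using \<mu>(1) by real_asymp
    have 2: "(\<lambda>n::nat. (ln (real n * X n) / G + 2) * exp (- (\<mu> * \<kappa> * ln (ln (real n))))) \<longlonglongrightarrow> 0"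
    proof -
      define e where "e = \<mu> * \<kappa>"
      have "e > 1" using \<mu> by (simp add: e_def)
      then have "(\<lambda>n::nat. (ln (real n * sqrt (\<mu> * ln (ln (real n)))) / G + 2) * exp (- (e * ln (ln (real n))))) \<longlonglongrightarrow> 0"
        using \<mu>(1) pos(1) by real_asymp
      then show ?thesis by (simp add: e_def X_def)
    qed
    have 3: "(\<lambda>n. exp (- (\<alpha> * sqrt (X n))) / (1 - exp (- (\<alpha> * sqrt (X n) * h)))) \<longlonglongrightarrow> 0"
      unfolding X_def using \<mu>(1) pos by real_asymp
    have "(\<lambda>n. 2 * (1 / X n + (2 * ((ln (real n * X n) / G + 2) * exp (- (\<mu> * \<kappa> * ln (ln (real n)))))
     + 2 * (exp (- (\<alpha> * sqrt (X n))) / (1 - exp (- (\<alpha> * sqrt (X n) * h))))))) \<longlonglongrightarrow> 2 * (0 + (2 * 0 + 2 * 0))"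
      by (intro tendsto_intros 1 2 3)
    then show ?thesis by (simp add: B_def[abs_def])
  qed
  moreover have "\<forall>\<^sub>F n in sequentially. X n > 1" unfolding X_def using \<mu>(1) by real_asymp
  \<comment> \<open>The laws are quantified inside, since they depend on n and on the labels, over
    which the risk takes a supremum.\<close>
  then have "\<forall>\<^sub>F n in sequentially. \<forall>N M C D. iid_sample n (N :: 'a measure) M C D \<longrightarrow>
       (\<integral>\<^sup>+\<omega>. of_bool (\<exists>t. iid_sample.ratio n C D t \<omega> > X n) \<partial>PiM {..<n} M) \<le> ennreal (B n)"
    using eventually_ge_at_top[of 3]
  proof eventually_elim
    case (elim n)
    define x where "x = X n"
    have x: "x > 1" using elim by (simp add: x_def)
    have lln: "ln (ln (real n)) > 0"
    proof (rule ccontr)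
      assume "\<not> ?thesis"
      then have "X n \<le> sqrt 0" unfolding X_def using \<mu>(1) by (intro real_sqrt_le_mono) (simp add: mult_nonneg_nonpos)
      then show False using elim by simp
    qed
    \<comment> \<open>Enough blocks of ratio g^2 to climb from 1 / x to n; \<open>Suc\<close> keeps
      \<open>K\<close> positive.\<close>
    define K where "K = Suc (nat \<lceil>ln (real n * x) / G\<rceil>)"
    have nx: "real n * x \<ge> 1" using mult_mono[of 1 "real n" 1 x] x elim(2) by simp
    have lnx: "ln (real n * x) \<ge> 0" using nx by simp
    have K1: "real K \<le> ln (real n * x) / G + 2"
    proof -
      have "ln (real n * x) / G \<ge> 0" using lnx pos by simp
      then have "real (nat \<lceil>ln (real n * x) / G\<rceil>) \<le> ln (real n * x) / G + 1" by linarith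
      then show ?thesis by (simp add: K_def)
    qed
    have K2: "real n \<le> 1 / x * g ^ (2 * K)"
    proof -
      have "ln (real n * x) / G \<le> real K" unfolding K_def by linarith
      then have "ln (real n * x) \<le> real (2 * K) * ln g" using pos by (simp add: pos_divide_le_eq G_def mult_ac)
      then have "exp (ln (real n * x)) \<le> exp (real (2 * K) * ln g)" by simp
      also have "exp (real (2 * K) * ln g) = g ^ (2 * K)" using ga by (simp only: exp_of_nat_mult) simp
      also have "exp (ln (real n * x)) = real n * x" using nx by simp
      finally show ?thesis using x by (simp add: field_simps)
    qed
    define y where "y = \<alpha> * sqrt x"
    have y: "y > 0" using x pos by (simp add: y_def)
    have sx: "x * sqrt (1 / x) = sqrt x" using x by (simp add: real_sqrt_divide real_div_sqrt)
    have "2 * (1 / x + (\<Sum>k<K. 2 * (exp (- ((1 / g - exp a / 2) * x\<^sup>2)) + exp (- ((1 / g - exp a / 2) * x * a * (sqrt (1 / x) * g ^ (k + 1))))))) \<le> B n"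
    proof -
      have e1: "(1 / g - exp a / 2) * x\<^sup>2 = \<mu> * \<kappa> * ln (ln (real n))"
        using lln \<mu> by (simp add: x_def X_def \<kappa>_def)
      have e2: "(1 / g - exp a / 2) * x * a * (sqrt (1 / x) * g ^ (k + 1)) = y * g ^ (k + 1)" for k
        unfolding \<kappa>_def[symmetric] y_def \<alpha>_def sx[symmetric] by (simp add: mult_ac)
      have "(\<Sum>k<K. 2 * (exp (- (\<mu> * \<kappa> * ln (ln (real n)))) + exp (- (y * g ^ (k + 1)))))
          = 2 * (real K * exp (- (\<mu> * \<kappa> * ln (ln (real n))))) + 2 * (\<Sum>k<K. exp (- (y * g ^ (k + 1))))"
        by (simp add: sum.distrib algebra_simps flip: sum_distrib_left)
      also have "\<dots> \<le> 2 * ((ln (real n * x) / G + 2) * exp (- (\<mu> * \<kappa> * ln (ln (real n))))) + 2 * (exp (- y) / (1 - exp (- (y * (g - 1)))))"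
        using K1 by (intro add_mono mult_left_mono mult_right_mono sum_exp_geometric_le ga y) auto
      finally show ?thesis unfolding e1 e2 B_def x_def[symmetric] y_def[symmetric] h_def[symmetric] by simp
    qed
    note le = this
    show ?case
    proof (intro allI impI)
      fix N :: "'a measure" and M C D
      assume "iid_sample n N M C D"
      then interpret I: iid_sample n N M C D .
      show "(\<integral>\<^sup>+\<omega>. of_bool (\<exists>t. I.ratio t \<omega> > X n) \<partial>I.P) \<le> ennreal (B n)"
        unfolding x_def[symmetric]
      proof (rule I.sup_bound)
        fix T :: "real set" assume T: "finite T"
        have "sqrt (1 / x) < x"
        proof -
          have "sqrt (1 / x) < 1" using x by simp
          then show ?thesis using x by linarith
        qed
        then show "I.P.prob {\<omega>\<in>space I.P. \<exists>t\<in>T. x < I.ratio t \<omega>} \<le> B n"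
          using I.finite_sup_bound[of a "1 / x" x g K T] ga x K2 T le by (simp add: K_def)
      qed (use x in simp)
    qed
  qed
  ultimately show thesis
    by (intro that[of B]) (simp_all add: X_def \<mu>_def)
qed


section \<open>Power of the test\<close>

text \<open>Chernoff's bound with parameter d / m. For h \<ge> 0 one has exp (- h) \<le> 1 - h + h^2
  / 2, because the cubic Taylor remainder is nonpositive, so the Gaussian exponent holds for
  deviations of every size.\<close>

lemma count_lower_tail:
  fixes M :: "nat \<Rightarrow> 'a measure" and n :: nat
  assumes prob: "\<And>i. prob_space (M i)" and A: "\<And>i. A \<in> sets (M i)"
  defines "m \<equiv> \<Sum>i<n. measure (M i) A"
  assumes m: "m > 0" and d: "d \<ge> 0"
  shows "(\<integral>\<^sup>+\<omega>. of_bool ((\<Sum>i<n. indicator A (\<omega> i)) \<le> m - d) \<partial>PiM {..<n} M) \<le> ennreal (exp (- (d\<^sup>2 / (2 * m))))"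
proof -
  interpret M: prob_space "M i" for i by (rule prob)
  interpret product_prob_space M "{..<n}" by standard
  define h where "h = d / m"
  have h: "h \<ge> 0" using m d by (simp add: h_def)
  have mgf: "(\<integral>\<^sup>+y. ennreal (exp (- (h * indicator A y))) \<partial>M i) \<le> ennreal (exp ((- h + h\<^sup>2 / 2) * measure (M i) A))" for i
  proof -
    have "(\<integral>\<^sup>+y. ennreal (exp (- (h * indicator A y))) \<partial>M i)
        = (\<integral>\<^sup>+y. ennreal (exp (- h)) * indicator A y + indicator (space (M i) - A) y \<partial>M i)"
      by (intro nn_integral_cong) (auto simp: indicator_def)
    also have "\<dots> = ennreal (exp (- h)) * emeasure (M i) A + emeasure (M i) (space (M i) - A)"
      using A by (subst nn_integral_add) (auto simp: nn_integral_cmult)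
    also have "\<dots> = ennreal (exp (- h) * measure (M i) A + (1 - measure (M i) A))"
      using A by (simp add: M.emeasure_eq_measure M.prob_compl ennreal_mult ennreal_plus)
    also have "\<dots> \<le> ennreal (exp ((- h + h\<^sup>2 / 2) * measure (M i) A))"
    proof (intro ennreal_leI)
      have "exp (- h) \<le> 1 - h + h\<^sup>2 / 2"
      proof -
        obtain t where t: "\<bar>t\<bar> \<le> \<bar>- h\<bar>" "exp (- h) = (\<Sum>j<3. (- h) ^ j / fact j) + exp t / fact 3 * (- h) ^ 3"
          using Maclaurin_exp_le[of "- h" 3] by blast
        have "exp t / fact 3 * (- h) ^ 3 \<le> 0" using h by (intro mult_nonneg_nonpos) auto
        then show ?thesis using t(2) by (simp add: lessThan_nat_numeral fact_numeral)
      qed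
      then have "(exp (- h) - 1) * measure (M i) A \<le> (- h + h\<^sup>2 / 2) * measure (M i) A"
        by (intro mult_right_mono) auto
      also have "1 + \<dots> \<le> exp \<dots>" by (rule exp_ge_add_one_self)
      finally show "exp (- h) * measure (M i) A + (1 - measure (M i) A) \<le> exp ((- h + h\<^sup>2 / 2) * measure (M i) A)"
        by (simp add: algebra_simps)
    qed
    finally show ?thesis .
  qed
  have "(\<integral>\<^sup>+\<omega>. of_bool ((\<Sum>i<n. indicator A (\<omega> i)) \<le> m - d) \<partial>PiM {..<n} M)
     \<le> (\<integral>\<^sup>+\<omega>. ennreal (exp (h * (m - d))) * (\<Prod>i<n. ennreal (exp (- (h * indicator A (\<omega> i))))) \<partial>PiM {..<n} M)"
  proof (intro nn_integral_mono)
    fix \<omega> :: "nat \<Rightarrow> 'a"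
    have "1 \<le> exp (h * (m - d) + (\<Sum>i<n. - (h * indicator A (\<omega> i))))" if "(\<Sum>i<n. indicator A (\<omega> i)) \<le> m - d"
    proof -
      have "h * (\<Sum>i<n. indicator A (\<omega> i)) \<le> h * (m - d)" using that h by (intro mult_left_mono)
      then show ?thesis by (simp add: sum_negf sum_distrib_left)
    qed
    then show "of_bool ((\<Sum>i<n. indicator A (\<omega> i)) \<le> m - d)
        \<le> ennreal (exp (h * (m - d))) * (\<Prod>i<n. ennreal (exp (- (h * indicator A (\<omega> i)))))"
      by (auto simp: of_bool_def prod_ennreal exp_add exp_sum prod_nonneg simp flip: ennreal_mult)
  qed
  also have "\<dots> = ennreal (exp (h * (m - d))) * (\<integral>\<^sup>+\<omega>. (\<Prod>i<n. ennreal (exp (- (h * indicator A (\<omega> i))))) \<partial>PiM {..<n} M)"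
  proof (rule nn_integral_cmult)
    have [measurable]: "(\<lambda>y. ennreal (exp (- (h * indicator A y)))) \<in> borel_measurable (M i)" for i
      using A[of i] by measurable
    show "(\<lambda>\<omega>. \<Prod>i<n. ennreal (exp (- (h * indicator A (\<omega> i))))) \<in> borel_measurable (PiM {..<n} M)"
      by measurable
  qed
  also have "(\<integral>\<^sup>+\<omega>. (\<Prod>i<n. ennreal (exp (- (h * indicator A (\<omega> i))))) \<partial>PiM {..<n} M)
      = (\<Prod>i<n. \<integral>\<^sup>+y. ennreal (exp (- (h * indicator A y))) \<partial>M i)"
    using A by (intro product_nn_integral_prod) auto
  also have "\<dots> \<le> (\<Prod>i<n. ennreal (exp ((- h + h\<^sup>2 / 2) * measure (M i) A)))"
    by (intro prod_mono_ennreal mgf)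
  also have "\<dots> = ennreal (exp ((- h + h\<^sup>2 / 2) * m))"
    by (simp add: prod_ennreal m_def sum_distrib_left flip: exp_sum)
  also have "ennreal (exp (h * (m - d))) * \<dots> = ennreal (exp (h * (m - d) + (- h + h\<^sup>2 / 2) * m))"
    by (simp add: exp_add ennreal_mult)
  also have "h * (m - d) + (- h + h\<^sup>2 / 2) * m = - (d\<^sup>2 / (2 * m))"
    using m by (simp add: h_def field_simps power2_eq_square)
  finally show ?thesis by (simp add: mult_left_mono)
qed

text \<open>Since \<open>S\<close> is at most half of \<open>S1\<close>, every mismatched
  observation raises the expected count by at least S1 / 2. The deviation from n S that goes
  undetected is at most half of the total excess \<Delta>, so failure to detect forces the count
  \<Delta> / 2 below its mean.\<close>

lemma count_below_threshold_bound:
  fixes M :: "nat \<Rightarrow> 'a measure" and n :: nat and D :: "real measure" and t x \<epsilon> :: real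
  defines "S \<equiv> measure D {t<..}" and "S1 \<equiv> measure D {..<- t}"
  assumes n: "n > 0" and prob: "\<And>i. prob_space (M i)" and sets_M: "\<And>i. sets (M i) = sets N"
    and C: "C \<in> borel_measurable N"
    and null: "\<And>i. i < n \<Longrightarrow> i \<notin> J \<Longrightarrow> distr (M i) borel C = D"
    and alt: "\<And>i. i < n \<Longrightarrow> i \<in> J \<Longrightarrow> distr (M i) borel (\<lambda>y. - C y) = D"
    and J: "real (card (J \<inter> {..<n})) \<ge> real n * \<epsilon>" and \<epsilon>: "\<epsilon> > 0"
    and S: "0 < S" "S \<le> S1 / 2" "S < 1" and x: "x \<ge> 0" "x * sqrt (real n * S) \<le> real n * \<epsilon> * S1 / 4"
  shows "(\<integral>\<^sup>+\<omega>. of_bool (\<bar>(\<Sum>i<n. of_bool (C (\<omega> i) > t)) - real n * S\<bar> / sqrt (real n * S * (1 - S)) \<le> x) \<partial>PiM {..<n} M)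
     \<le> ennreal (exp (- ((real n * \<epsilon> * S1 / 2)\<^sup>2 / (16 * (real n * S)))) + exp (- (real n * \<epsilon> * S1 / 2 / 16)))"
proof -
  define A where "A = {y\<in>space N. C y > t}"
  have spN: "space (M i) = space N" for i using sets_M by (rule sets_eq_imp_space_eq)
  have CM: "C \<in> borel_measurable (M i)" for i using C by (simp add: measurable_cong_sets[OF sets_M refl])
  have A: "A \<in> sets (M i)" for i unfolding A_def sets_M using C by measurable
  define K where "K = J \<inter> {..<n}"
  have pN: "measure (M i) A = S" if "i < n" "i \<notin> K" for i
  proof -
    have "S = measure (distr (M i) borel C) {t<..}" using null that by (simp add: S_def K_def)
    also have "\<dots> = measure (M i) A" using CM by (subst measure_distr) (auto simp: A_def spN intro!: arg_cong[where f="measure (M i)"])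
    finally show ?thesis ..
  qed
  have pA: "measure (M i) A = S1" if "i \<in> K" for i
  proof -
    have "S1 = measure (distr (M i) borel (\<lambda>y. - C y)) {..<- t}" using alt that by (simp add: S1_def K_def)
    also have "\<dots> = measure (M i) A" using CM by (subst measure_distr) (auto simp: A_def spN intro!: arg_cong[where f="measure (M i)"])
    finally show ?thesis ..
  qed
  define k where "k = real (card K)"
  have K: "finite K" "K \<subseteq> {..<n}" by (auto simp: K_def)
  define m where "m = (\<Sum>i<n. measure (M i) A)"
  define \<Delta> where "\<Delta> = k * (S1 - S)"
  have m: "m = real n * S + \<Delta>"
  proof -
    have "m = (\<Sum>i<n. S + (S1 - S) * of_bool (i \<in> K))"
      unfolding m_def using pN pA by (intro sum.cong) auto
    also have "\<dots> = real n * S + (S1 - S) * (\<Sum>i<n. of_bool (i \<in> K))"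
      by (simp add: sum.distrib sum_distrib_left)
    also have "(\<Sum>i<n. of_bool (i \<in> K) :: real) = k"
      using K by (simp add: k_def of_bool_def sum.If_cases Int_absorb1)
    finally show ?thesis by (simp add: \<Delta>_def mult.commute)
  qed
  define D0 where "D0 = real n * \<epsilon> * S1 / 2"
  have S1: "S1 > 0" using S by linarith
  have D0: "D0 > 0" using n \<epsilon> S1 by (simp add: D0_def)
  have \<Delta>: "\<Delta> \<ge> D0"
  proof -
    have "D0 = real n * \<epsilon> * (S1 / 2)" by (simp add: D0_def)
    also have "\<dots> \<le> k * (S1 - S)"
      using J S n \<epsilon> S1 by (intro mult_mono) (auto simp: k_def K_def)
    finally show ?thesis by (simp add: \<Delta>_def)
  qed
  define v where "v = real n * S"
  have v: "v > 0" using n S by (simp add: v_def)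
  have m0: "m > 0" using m v \<Delta> D0 by (simp add: v_def)
  have "(\<integral>\<^sup>+\<omega>. of_bool (\<bar>(\<Sum>i<n. of_bool (C (\<omega> i) > t)) - real n * S\<bar> / sqrt (real n * S * (1 - S)) \<le> x) \<partial>PiM {..<n} M)
     \<le> (\<integral>\<^sup>+\<omega>. of_bool ((\<Sum>i<n. indicator A (\<omega> i)) \<le> m - \<Delta> / 2) \<partial>PiM {..<n} M)"
  proof (intro nn_integral_mono)
    fix \<omega> assume w: "\<omega> \<in> space (PiM {..<n} M)"
    have "(\<Sum>i<n. of_bool (C (\<omega> i) > t) :: real) = (\<Sum>i<n. indicator A (\<omega> i))"
      using w by (intro sum.cong) (auto simp: A_def indicator_def space_PiM spN PiE_iff)
    moreover have "(\<Sum>i<n. indicator A (\<omega> i)) \<le> m - \<Delta> / 2"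
      if "\<bar>(\<Sum>i<n. indicator A (\<omega> i)) - v\<bar> / sqrt (v * (1 - S)) \<le> x"
    proof -
      have "sqrt (v * (1 - S)) > 0" using v S by simp
      then have "\<bar>(\<Sum>i<n. indicator A (\<omega> i)) - v\<bar> \<le> x * sqrt (v * (1 - S))"
        using that by (simp add: pos_divide_le_eq)
      also have "\<dots> \<le> x * sqrt v" using x v S by (intro mult_left_mono real_sqrt_le_mono) (auto simp: mult_left_le)
      also have "\<dots> \<le> D0 / 2" using x(2) by (simp add: v_def D0_def)
      finally have "(\<Sum>i<n. indicator A (\<omega> i)) - v \<le> \<Delta> / 2" using \<Delta> by linarith
      then show ?thesis by (simp add: m v_def)
    qed
    ultimately show "of_bool (\<bar>(\<Sum>i<n. of_bool (C (\<omega> i) > t)) - real n * S\<bar> / sqrt (real n * S * (1 - S)) \<le> x)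
       \<le> (of_bool ((\<Sum>i<n. indicator A (\<omega> i)) \<le> m - \<Delta> / 2) :: ennreal)"
      by (auto simp: v_def)
  qed
  also have "\<dots> \<le> ennreal (exp (- ((\<Delta> / 2)\<^sup>2 / (2 * m))))"
    unfolding m_def by (intro count_lower_tail prob A) (use m0 \<Delta> D0 in \<open>auto simp: m_def\<close>)
  also have "\<dots> \<le> ennreal (exp (- (D0\<^sup>2 / (16 * v))) + exp (- (D0 / 16)))"
  proof (intro ennreal_leI)
    \<comment> \<open>The mean is v + \<Delta>. If v dominates, the exponent is quadratic in
      \<Delta>, otherwise it is linear in \<Delta>.\<close>
    have "exp (- ((\<Delta> / 2)\<^sup>2 / (2 * m))) \<le> exp (- (D0\<^sup>2 / (16 * v))) \<or> exp (- ((\<Delta> / 2)\<^sup>2 / (2 * m))) \<le> exp (- (D0 / 16))"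
    proof (cases "\<Delta> \<le> v")
      case True
      have "D0\<^sup>2 / (16 * v) \<le> \<Delta>\<^sup>2 / (8 * m)"
        using True D0 \<Delta> v m0 by (intro frac_le power_mono) (auto simp: m v_def mult.commute)
      then show ?thesis by (simp add: power_divide)
    next
      case False
      have "D0 / 16 \<le> \<Delta> / 16" using \<Delta> by simp
      also have "\<dots> = \<Delta>\<^sup>2 / (8 * (\<Delta> + \<Delta>))" using D0 \<Delta> by (simp add: power2_eq_square)
      also have "\<dots> \<le> \<Delta>\<^sup>2 / (8 * m)"
        using False D0 \<Delta> v m0 by (intro divide_left_mono) (auto simp: m v_def)
      finally show ?thesis by (simp add: power_divide)
    qed
    then show "exp (- ((\<Delta> / 2)\<^sup>2 / (2 * m))) \<le> exp (- (D0\<^sup>2 / (16 * v))) + exp (- (D0 / 16))"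
      using exp_ge_zero[of "- (D0\<^sup>2 / (16 * v))"] exp_ge_zero[of "- (D0 / 16)"] by linarith
  qed
  finally show ?thesis by (simp add: D0_def v_def)
qed


text \<open>
  If \<^const>\<open>S_tail\<close> vanished at some \<open>t\<close>, division by zero would make the term of
  \<^const>\<open>hc_stat\<close> at \<open>t\<close> equal to \<open>0\<close> and useless for detection.
\<close>

lemma S_tail_pos:
  assumes r: "r > 0" and s: "s \<ge> 0" shows "S_tail n r s t > 0"
proof -
  define m where "m = sqrt (2 * (r + s) * ln (real n))"
  \<comment> \<open>For v between 0 and 1 the subtracted term is at most sqrt (r + s), so every u
    above \<open>y\<close> exceeds \<open>t\<close>.\<close>
  define y where "y = (\<bar>t\<bar> + 1 + sqrt (r + s)) / sqrt r"
  interpret M1: prob_space "normal_law 0" by (rule prob_space_normal_law)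
  interpret M2: prob_space "normal_law m" by (rule prob_space_normal_law)
  interpret P: prob_space "normal_law 0 \<Otimes>\<^sub>M normal_law m" by (rule prob_space_pair_normal_law)
  let ?g = "\<lambda>(u, v). \<bar>sqrt r * u + sqrt s * v\<bar> - sqrt (r + s) * \<bar>v\<bar>"
  have pos: "measure (normal_law a) {b..b + 1} > 0" for a b
    by (rule less_le_trans[OF _ normal_law_unit_interval_ge]) simp
  have "0 < measure (normal_law 0) {y..y + 1} * measure (normal_law m) {0..0 + 1}"
    by (intro mult_pos_pos pos)
  also have "\<dots> = measure (normal_law 0 \<Otimes>\<^sub>M normal_law m) ({y..y + 1} \<times> {0..0 + 1})"
    by (simp add: measure_def M2.emeasure_pair_measure_Times enn2real_mult)
  also have "\<dots> \<le> measure (normal_law 0 \<Otimes>\<^sub>M normal_law m) (?g -` {t<..} \<inter> space (normal_law 0 \<Otimes>\<^sub>M normal_law m))"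
  proof (intro P.finite_measure_mono)
    show "?g -` {t<..} \<inter> space (normal_law 0 \<Otimes>\<^sub>M normal_law m) \<in> sets (normal_law 0 \<Otimes>\<^sub>M normal_law m)"
      by (rule measurable_sets[where A=borel]) simp_all
    show "{y..y + 1} \<times> {0..0 + 1} \<subseteq> ?g -` {t<..} \<inter> space (normal_law 0 \<Otimes>\<^sub>M normal_law m)"
    proof safe
      fix u v :: real assume u: "u \<in> {y..y + 1}" and v: "v \<in> {0..0 + 1}"
      have "\<bar>t\<bar> + 1 + sqrt (r + s) = sqrt r * y" using r by (simp add: y_def)
      also have "\<dots> \<le> sqrt r * u" using u r by (intro mult_left_mono) auto
      also have "\<dots> \<le> \<bar>sqrt r * u + sqrt s * v\<bar>"
      proof -
        have "0 \<le> sqrt s * v" using v s by simp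
        then show ?thesis by linarith
      qed
      moreover have "sqrt (r + s) * \<bar>v\<bar> \<le> sqrt (r + s) * 1" using v r s by (intro mult_left_mono) auto
      ultimately have "\<bar>sqrt r * u + sqrt s * v\<bar> - sqrt (r + s) * \<bar>v\<bar> > t" by linarith
      then show "(u, v) \<in> ?g -` {t<..}" by simp
    qed (simp add: space_pair_measure)
  qed
  also have "\<dots> = measure (C_law n r s) {t<..}"
    unfolding C_law_def m_def[symmetric] by (simp add: measure_distr)
  finally show ?thesis by (simp add: S_tail_C_law)
qed

section \<open>The testing problem at a fixed sample size\<close>

locale testing_setup =
  fixes r s :: real and n p q :: nat and \<theta> \<eta> :: "nat \<Rightarrow> real"
  assumes n: "n \<ge> 2" and r: "r > 0" and s: "s \<ge> 0"
    and norms: "2 * L2_set \<theta> {..<p} * L2_set \<eta> {..<q} / sqrt ((L2_set \<theta> {..<p})\<^sup>2 + (L2_set \<eta> {..<q})\<^sup>2) = sqrt (2 * r * ln (real n))"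
      "\<bar>(L2_set \<theta> {..<p})\<^sup>2 - (L2_set \<eta> {..<q})\<^sup>2\<bar> / sqrt ((L2_set \<theta> {..<p})\<^sup>2 + (L2_set \<eta> {..<q})\<^sup>2) = sqrt (2 * s * ln (real n))"
begin

definition l :: real where "l = sqrt (2 * ln (real n))"
definition C where "C x = C_minus p q \<theta> \<eta> x / l"
abbreviation sample where "sample a b \<equiv> std_normal_vec p (\<lambda>j. a * \<theta> j) \<Otimes>\<^sub>M std_normal_vec q (\<lambda>j. b * \<eta> j)"
abbreviation sample_space where "sample_space \<equiv> PiM {..<p} (\<lambda>_. borel :: real measure) \<Otimes>\<^sub>M PiM {..<q} (\<lambda>_. borel :: real measure)"
abbreviation law where "law \<equiv> joint_law n p q \<theta> \<eta>"

lemma l_pos: "l > 0"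
  using n by (simp add: l_def)

text \<open>Replacing \<eta> and \<sigma> by their negatives keeps the law of the data and turns
  \<open>C_minus\<close> into \<open>C_plus\<close>. Hence only \<open>C_minus\<close> is analysed;
  everything about \<open>C_plus\<close> comes from a second interpretation of the locale.\<close>

lemma flip: "testing_setup r s n p q \<theta> (\<lambda>j. - \<eta> j)"
proof -
  have "L2_set (\<lambda>j. - \<eta> j) {..<q} = L2_set \<eta> {..<q}" by (simp add: L2_set_def)
  then show ?thesis using n r s norms by (simp add: testing_setup_def)
qed

lemma prob_space_sample: "prob_space (sample a b)"
proof -
  interpret A: prob_space "std_normal_vec p (\<lambda>j. a * \<theta> j)" by (rule prob_space_std_normal_vec)
  interpret B: prob_space "std_normal_vec q (\<lambda>j. b * \<eta> j)" by (rule prob_space_std_normal_vec)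
  interpret pair_prob_space "std_normal_vec p (\<lambda>j. a * \<theta> j)" "std_normal_vec q (\<lambda>j. b * \<eta> j)" ..
  show ?thesis by (rule P.prob_space_axioms)
qed

lemma sets_sample: "sets (sample a b) = sets sample_space"
  by (intro sets_pair_measure_cong sets_std_normal_vec)

lemma C_measurable: "C \<in> borel_measurable sample_space"
  unfolding C_def[abs_def] by measurable

lemma distr_C: "z \<in> {-1, 1} \<Longrightarrow> distr (sample z z) borel C = C_law n r s"
  unfolding C_def[abs_def] l_def by (rule distr_C_minus[OF n r s _ norms])

lemma distr_C_opposite:
  assumes z: "z \<in> {-1, 1}" shows "distr (sample z (- z)) borel (\<lambda>x. - C x) = C_law n r s"
proof -
  interpret F: testing_setup r s n p q \<theta> "\<lambda>j. - \<eta> j" by (rule flip)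
  have "(\<lambda>x. - C x) = F.C"
    by (auto simp: fun_eq_iff C_def F.C_def C_minus_def dot_def sum_negf F.l_def l_def diff_divide_distrib)
  moreover have "sample z (- z) = F.sample z z" by simp
  ultimately show ?thesis using F.distr_C[OF z] by simp
qed

definition stat :: "real \<Rightarrow> data \<Rightarrow> real" where
  "stat t x = \<bar>(\<Sum>i<n. of_bool (C (x i) > t)) - real n * S_tail n r s t\<bar> / sqrt (real n * S_tail n r s t * (1 - S_tail n r s t))"

lemma stat_measurable: "stat t \<in> borel_measurable (joint_law n p q \<theta>' \<eta>' z \<sigma>)"
proof -
  note [measurable] = C_measurable
  have "stat t \<in> borel_measurable (PiM {..<n} (\<lambda>_. sample_space))"
    unfolding stat_def[abs_def] by measurable
  moreover have "sets (joint_law n p q \<theta>' \<eta>' z \<sigma>) = sets (PiM {..<n} (\<lambda>_. sample_space))"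
    unfolding joint_law_def by (intro sets_PiM_cong refl sets_pair_measure_cong sets_std_normal_vec)
  ultimately show ?thesis by (subst measurable_cong_sets[OF _ refl])
qed

lemma hc_stat_greater_iff: "hc_stat n r s (C_minus p q \<theta> \<eta>) x > ereal X \<longleftrightarrow> (\<exists>t. stat t x > X)"
proof -
  have "(C (x i) > t) = (C_minus p q \<theta> \<eta> (x i) > t * sqrt (2 * ln (real n)))" for t i
    unfolding C_def l_def[symmetric] using l_pos by (rule pos_less_divide_eq)
  then show ?thesis unfolding stat_def hc_stat_def less_SUP_iff by simp
qed

lemma null_sample:
  assumes "\<And>i. i < n \<Longrightarrow> z i \<in> {-1, 1}" "\<And>i. i < n \<Longrightarrow> \<sigma> i = z i"
  shows "iid_sample n sample_space (\<lambda>i. sample (z i) (\<sigma> i)) C (C_law n r s)"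
proof (rule iid_sample.intro)
  show "distr (sample (z i) (\<sigma> i)) borel C = C_law n r s" if "i < n" for i
    using assms[OF that] distr_C[of "z i"] by simp
  show "n > 0" using n by simp
qed (rule prob_space_sample sets_sample C_measurable)+

lemma null_hc_bound:
  assumes z: "\<And>i. i < n \<Longrightarrow> z i \<in> {-1, 1}" "\<And>i. i < n \<Longrightarrow> \<sigma> i = z i"
    and B: "\<And>N M C D. iid_sample n (N :: ((nat \<Rightarrow> real) \<times> (nat \<Rightarrow> real)) measure) M C D \<Longrightarrow>
       (\<integral>\<^sup>+\<omega>. of_bool (\<exists>t. iid_sample.ratio n C D t \<omega> > X) \<partial>PiM {..<n} M) \<le> ennreal B"
  shows "(\<integral>\<^sup>+x. of_bool (hc_stat n r s (C_minus p q \<theta> \<eta>) x > ereal X) \<partial>law z \<sigma>) \<le> ennreal B"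
proof -
  interpret I: iid_sample n sample_space "\<lambda>i. sample (z i) (\<sigma> i)" C "C_law n r s"
    by (rule null_sample[OF z])
  have "hc_stat n r s (C_minus p q \<theta> \<eta>) x > ereal X \<longleftrightarrow> (\<exists>t. I.ratio t x > X)" for x
    unfolding hc_stat_greater_iff stat_def I.ratio_def I.count_def I.S_def S_tail_C_law ..
  then show ?thesis using B[OF I.iid_sample_axioms] by (simp add: joint_law_def)
qed

lemma alternative_hc_bound:
  fixes \<epsilon> t X :: real
  assumes z: "\<And>i. i < n \<Longrightarrow> z i \<in> {-1, 1}" "\<And>i. i < n \<Longrightarrow> \<sigma> i \<in> {-1, 1}"
    and J: "real (card ({i. \<sigma> i \<noteq> z i} \<inter> {..<n})) \<ge> real n * \<epsilon>" and \<epsilon>: "\<epsilon> > 0"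
  defines "S \<equiv> S_tail n r s t" and "S1 \<equiv> measure (C_law n r s) {..<- t}"
  assumes S: "S \<le> S1 / 2" "S < 1" and X: "X \<ge> 0" "X * sqrt (real n * S) \<le> real n * \<epsilon> * S1 / 4"
  shows "(\<integral>\<^sup>+x. of_bool (stat t x \<le> X) \<partial>law z \<sigma>)
     \<le> ennreal (exp (- ((real n * \<epsilon> * S1 / 2)\<^sup>2 / (16 * (real n * S)))) + exp (- (real n * \<epsilon> * S1 / 2 / 16)))"
proof -
  have S0: "0 < S" unfolding S_def by (rule S_tail_pos[OF r s])
  show ?thesis
    unfolding stat_def joint_law_def S_def S1_def S_tail_C_law
  proof (rule count_below_threshold_bound[OF _ prob_space_sample sets_sample C_measurable _ _ J \<epsilon>])
    show "distr (sample (z i) (\<sigma> i)) borel C = C_law n r s" if "i < n" "i \<notin> {i. \<sigma> i \<noteq> z i}" for i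
      using that z[OF that(1)] distr_C[of "z i"] by simp
    show "distr (sample (z i) (\<sigma> i)) borel (\<lambda>x. - C x) = C_law n r s" if "i < n" "i \<in> {i. \<sigma> i \<noteq> z i}" for i
    proof -
      have "\<sigma> i = - z i" using that z[OF that(1)] by auto
      then show ?thesis using distr_C_opposite[of "z i"] z[OF that(1)] by simp
    qed
  qed (use n S0 S X in \<open>simp_all add: S_def S1_def S_tail_C_law\<close>)
qed

lemma flip_joint_law: "joint_law n p q \<theta> (\<lambda>j. - \<eta> j) z (\<lambda>i. - \<sigma> i) = law z \<sigma>"
  by (simp add: joint_law_def)

lemma flip_C_minus: "C_minus p q \<theta> (\<lambda>j. - \<eta> j) = C_plus p q \<theta> \<eta>"
  by (auto simp: fun_eq_iff C_plus_def C_minus_def dot_def sum_negf)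

end

lemma labels_in: "z \<in> labels n \<Longrightarrow> i < n \<Longrightarrow> z i \<in> {-1, 1}"
  by (auto simp: labels_def)

lemma label_dist_zero:
  assumes n: "n > 0" and 0: "label_dist n z \<sigma> = 0"
  shows "(\<forall>i<n. z i = \<sigma> i) \<or> (\<forall>i<n. z i = - \<sigma> i)"
proof -
  have "(\<Sum>i<n. of_bool (z i \<noteq> \<sigma> i) :: real) = 0 \<or> (\<Sum>i<n. of_bool (z i \<noteq> - \<sigma> i) :: real) = 0"
    using n 0 by (auto simp: label_dist_def min_def split: if_splits)
  then show ?thesis by (auto simp: sum_nonneg_eq_0_iff of_bool_def split: if_splits)
qed

text \<open>The distance is a minimum, so under the alternative both disagreement counts are large.
  This gives power to both statistics at once, as rejection by their minimum requires.\<close>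

lemma label_dist_gt:
  assumes n: "n > 0" and gt: "label_dist n z \<sigma> > \<epsilon>"
  shows "real (card ({i. \<sigma> i \<noteq> z i} \<inter> {..<n})) \<ge> real n * \<epsilon>" "real (card ({i. - \<sigma> i \<noteq> z i} \<inter> {..<n})) \<ge> real n * \<epsilon>"
proof -
  have 1: "(\<Sum>i<n. of_bool (z i \<noteq> f i) :: real) = real (card ({i. f i \<noteq> z i} \<inter> {..<n}))" for f :: "nat \<Rightarrow> real"
    by (simp add: of_bool_def sum.If_cases Int_def conj_commute eq_commute[of "z _"])
  show "real (card ({i. \<sigma> i \<noteq> z i} \<inter> {..<n})) \<ge> real n * \<epsilon>" "real (card ({i. - \<sigma> i \<noteq> z i} \<inter> {..<n})) \<ge> real n * \<epsilon>"
    using gt n 1[of \<sigma>] 1[of "\<lambda>i. - \<sigma> i"] by (auto simp: label_dist_def field_simps)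
qed

text \<open>
  Measurability of \<^const>\<open>psi_dot\<close> is never used: both integrals are bounded through measurable
  majorants, since the integral of a nonmeasurable function need not be subadditive.
\<close>

lemma test_risk_psi_dot_le:
  fixes \<epsilon> t \<delta> :: real
  assumes "testing_setup r s n p q \<theta> \<eta>" and \<epsilon>: "\<epsilon> > 0"
  defines "X \<equiv> sqrt (2 * (1 + \<delta>) * ln (ln (real n)))"
  assumes B: "\<And>N M C D. iid_sample n (N :: ((nat \<Rightarrow> real) \<times> (nat \<Rightarrow> real)) measure) M C D \<Longrightarrow>
       (\<integral>\<^sup>+\<omega>. of_bool (\<exists>t. iid_sample.ratio n C D t \<omega> > X) \<partial>PiM {..<n} M) \<le> ennreal B"
  defines "S \<equiv> S_tail n r s t" and "S1 \<equiv> measure (C_law n r s) {..<- t}"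
  assumes S: "S \<le> S1 / 2" "S < 1" and X: "X \<ge> 0" "X * sqrt (real n * S) \<le> real n * \<epsilon> * S1 / 4"
  shows "test_risk n p q (psi_dot n p q r s \<delta> \<theta> \<eta>) \<theta> \<eta> \<epsilon> \<le> ennreal B +
     2 * ennreal (exp (- ((real n * \<epsilon> * S1 / 2)\<^sup>2 / (16 * (real n * S)))) + exp (- (real n * \<epsilon> * S1 / 2 / 16)))"
    (is "_ \<le> _ + 2 * ?A")
proof -
  interpret T: testing_setup r s n p q \<theta> \<eta> by fact
  interpret F: testing_setup r s n p q \<theta> "\<lambda>j. - \<eta> j" by (rule T.flip)
  have n0: "n > 0" using T.n by simp
  let ?m = "hc_stat n r s (C_minus p q \<theta> \<eta>)" and ?p = "hc_stat n r s (C_plus p q \<theta> \<eta>)"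
  let ?\<psi> = "psi_dot n p q r s \<delta> \<theta> \<eta>"
  have psi: "?\<psi> x = of_bool (?m x > ereal X \<and> ?p x > ereal X)" for x
    by (simp add: psi_dot_def X_def)
  \<comment> \<open>The minimum exceeds the level only if both statistics do, so it suffices to
    bound the one that fits the global sign of the labels.\<close>
  have null: "(\<integral>\<^sup>+x. ennreal (?\<psi> x) \<partial>T.law z \<sigma>) \<le> ennreal B"
    if z: "z \<in> labels n" "\<sigma> \<in> labels n" "label_dist n z \<sigma> = 0" for z \<sigma>
    using label_dist_zero[OF n0 z(3)]
  proof
    assume eq: "\<forall>i<n. z i = \<sigma> i"
    have "(\<integral>\<^sup>+x. ennreal (?\<psi> x) \<partial>T.law z \<sigma>) \<le> (\<integral>\<^sup>+x. of_bool (?m x > ereal X) \<partial>T.law z \<sigma>)"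
      by (intro nn_integral_mono) (simp add: psi)
    also have "\<dots> \<le> ennreal B"
      by (rule T.null_hc_bound[OF _ _ B]) (use z eq in \<open>auto dest: labels_in\<close>)
    finally show ?thesis .
  next
    assume eq: "\<forall>i<n. z i = - \<sigma> i"
    have "(\<integral>\<^sup>+x. ennreal (?\<psi> x) \<partial>T.law z \<sigma>) \<le> (\<integral>\<^sup>+x. of_bool (?p x > ereal X) \<partial>T.law z \<sigma>)"
      by (intro nn_integral_mono) (simp add: psi)
    also have "\<dots> \<le> ennreal B"
      unfolding T.flip_C_minus[symmetric] T.flip_joint_law[symmetric]
      by (rule F.null_hc_bound[OF _ _ B]) (use z eq in \<open>auto dest: labels_in\<close>)
    finally show ?thesis .
  qed
  \<comment> \<open>If the test accepts, one of the two suprema stays below the level, and in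
    particular its term at the fixed threshold \<open>t\<close>.\<close>
  have alt: "(\<integral>\<^sup>+x. ennreal (1 - ?\<psi> x) \<partial>T.law z \<sigma>) \<le> 2 * ?A"
    if z: "z \<in> labels n" "\<sigma> \<in> labels n" "label_dist n z \<sigma> > \<epsilon>" for z \<sigma>
  proof -
    have z1: "i < n \<Longrightarrow> z i \<in> {-1, 1}" and s1: "i < n \<Longrightarrow> \<sigma> i \<in> {-1, 1}" for i
      using labels_in z by blast+
    have s2: "i < n \<Longrightarrow> - \<sigma> i \<in> {-1, 1}" for i using s1[of i] by auto
    have "(\<integral>\<^sup>+x. ennreal (1 - ?\<psi> x) \<partial>T.law z \<sigma>)
        \<le> (\<integral>\<^sup>+x. of_bool (T.stat t x \<le> X) + of_bool (F.stat t x \<le> X) \<partial>T.law z \<sigma>)"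
    proof (intro nn_integral_mono)
      fix x
      have "?m x > ereal X" if "T.stat t x > X" using that T.hc_stat_greater_iff by blast
      moreover have "?p x > ereal X" if "F.stat t x > X"
        using that F.hc_stat_greater_iff unfolding T.flip_C_minus by blast
      ultimately show "ennreal (1 - ?\<psi> x) \<le> of_bool (T.stat t x \<le> X) + of_bool (F.stat t x \<le> X)"
        by (cases "T.stat t x \<le> X"; cases "F.stat t x \<le> X") (auto simp: psi not_le)
    qed
    also have "\<dots> = (\<integral>\<^sup>+x. of_bool (T.stat t x \<le> X) \<partial>T.law z \<sigma>)
         + (\<integral>\<^sup>+x. of_bool (F.stat t x \<le> X) \<partial>T.law z \<sigma>)"
    proof (rule nn_integral_add)
      note [measurable] = T.stat_measurable F.stat_measurable
      show "(\<lambda>x. of_bool (T.stat t x \<le> X) :: ennreal) \<in> borel_measurable (T.law z \<sigma>)"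
        "(\<lambda>x. of_bool (F.stat t x \<le> X) :: ennreal) \<in> borel_measurable (T.law z \<sigma>)"
        by measurable
    qed
    also have "\<dots> \<le> ?A + ?A"
    proof (intro add_mono)
      show "(\<integral>\<^sup>+x. of_bool (T.stat t x \<le> X) \<partial>T.law z \<sigma>) \<le> ?A"
        unfolding S_def S1_def
        by (rule T.alternative_hc_bound[OF z1 s1 label_dist_gt(1)[OF n0 z(3)] \<epsilon>]) (use S X in \<open>simp_all add: S_def S1_def\<close>)
      show "(\<integral>\<^sup>+x. of_bool (F.stat t x \<le> X) \<partial>T.law z \<sigma>) \<le> ?A"
        unfolding S_def S1_def T.flip_joint_law[symmetric]
        by (rule F.alternative_hc_bound[OF z1 s2 label_dist_gt(2)[OF n0 z(3)] \<epsilon>]) (use S X in \<open>simp_all add: S_def S1_def\<close>)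
    qed
    finally show ?thesis by (simp only: mult_2)
  qed
  show ?thesis
    unfolding test_risk_def by (intro add_mono SUP_least; clarify; rule null alt; assumption)
qed


text \<open>\<open>e1\<close> is the exponent of the expected excess n \<epsilon> \<open>S1\<close>,
  and \<open>e2\<close> that of its square divided by the variance n \<open>S\<close>. The
  inequalities of \<open>beta_star_witness\<close> make both positive for \<beta> <
  \<open>beta_star\<close>, with room for a small loss \<xi>.\<close>

lemma psi_dot_risk_tendsto:
  fixes \<beta> r s \<delta> :: real
    and p q :: "nat \<Rightarrow> nat"
    and \<theta> \<eta> :: "nat \<Rightarrow> nat \<Rightarrow> real"
    and \<epsilon> :: "nat \<Rightarrow> real"
  assumes r: "r > 0" and s: "s \<ge> 0" and \<delta>: "\<delta> > 0"
    and eps: "\<And>n. \<epsilon> n = real n powr (- \<beta>)"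
    and hyp: "\<And>n. n \<ge> 2 \<Longrightarrow> testing_setup r s n (p n) (q n) (\<theta> n) (\<eta> n)"
    and \<beta>: "\<beta> < beta_star r s"
  shows "(\<lambda>n. test_risk n (p n) (q n) (psi_dot n (p n) (q n) r s \<delta> (\<theta> n) (\<eta> n)) (\<theta> n) (\<eta> n) (\<epsilon> n)) \<longlonglongrightarrow> 0"
proof -
  define w where "w = sqrt (r + s)"
  obtain \<rho> \<kappa> \<tau> u v where \<rho>: "1 \<le> \<rho>" "\<rho> \<le> 2" and \<kappa>: "0 \<le> \<kappa>" "\<kappa> \<le> 1" and \<tau>: "\<tau> > 0" and v: "v \<ge> 0"
    and box: "w * v - \<bar>sqrt r * u + sqrt s * v\<bar> \<ge> \<tau>"
    and b1: "beta_star r s \<le> 1 - (u\<^sup>2 + (v - w)\<^sup>2)"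
    and b2: "beta_star r s \<le> (1 + (2 * \<rho> * \<tau> - mgf_exponent r s \<rho> \<kappa>)) / 2 - (u\<^sup>2 + (v - w)\<^sup>2)"
    and b3: "2 * \<rho> * \<tau> - mgf_exponent r s \<rho> \<kappa> > u\<^sup>2 + (v - w)\<^sup>2"
    unfolding w_def by (rule beta_star_witness[OF r s]) blast
  define a where "a = u\<^sup>2 + (v - w)\<^sup>2"
  define L where "L = mgf_exponent r s \<rho> \<kappa>"
  define b where "b = 2 * \<rho> * \<tau> - L"
  have g: "1 - \<beta> - a > 0" "1 - 2 * \<beta> - 2 * a + b > 0" "b - a > 0"
    using b1 b2 b3 \<beta> by (simp_all add: a_def b_def L_def field_simps)
  \<comment> \<open>The loss is \<xi> in the exponent of \<open>S1\<close> and 2 \<rho> \<xi> \<le>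
    4 \<xi> in that of \<open>S\<close>, the latter from lowering the threshold by \<xi>. A tenth of
    the smallest gap covers both.\<close>
  define \<xi> where "\<xi> = min (1 - \<beta> - a) (min (1 - 2 * \<beta> - 2 * a + b) (b - a)) / 10"
  have \<xi>: "\<xi> > 0" "10 * \<xi> \<le> 1 - \<beta> - a" "10 * \<xi> \<le> 1 - 2 * \<beta> - 2 * a + b" "10 * \<xi> \<le> b - a"
    using g by (simp_all add: \<xi>_def)
  define a' where "a' = a + \<xi>"
  define b' where "b' = 2 * \<rho> * (\<tau> - \<xi>) - L"
  have "\<rho> * \<xi> \<le> 2 * \<xi>" using \<rho> \<xi> by (intro mult_right_mono) auto
  then have b'b: "b' \<ge> b - 4 * \<xi>" by (simp add: b'_def b_def algebra_simps)
  define e1 where "e1 = 1 - \<beta> - a'"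
  define e2 where "e2 = 2 * e1 - (1 - b')"
  have e: "e1 > 0" "e2 > 0" "a' < b'" using \<xi> b'b by (simp_all add: e1_def e2_def a'_def)
  define X where "X n = sqrt (2 * (1 + \<delta>) * ln (ln (real n)))" for n
  define t where "t n = (\<tau> - \<xi>) * sqrt (2 * ln (real n))" for n
  define S where "S n = S_tail n r s (t n)" for n
  define S1 where "S1 n = measure (C_law n r s) {..<- t n}" for n
  obtain B :: "nat \<Rightarrow> real" where B: "B \<longlonglongrightarrow> 0"
    "\<forall>\<^sub>F n in sequentially. \<forall>N M C D. iid_sample n (N :: ((nat \<Rightarrow> real) \<times> (nat \<Rightarrow> real)) measure) M C D \<longrightarrow>
       (\<integral>\<^sup>+\<omega>. of_bool (\<exists>t. iid_sample.ratio n C D t \<omega> > X n) \<partial>PiM {..<n} M) \<le> ennreal (B n)"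
    unfolding X_def by (rule empirical_sup_null_bound[OF \<delta>])
  \<comment> \<open>The constants 128 and 32 result from inserting the excess n powr
    \<open>e1\<close> / 2 and the variance bound 2 n powr (1 - b') into the two exponential
    bounds.\<close>
  define B' where "B' n = exp (- (real n powr e2 / 128)) + exp (- (real n powr e1 / 32))" for n
  have "(\<lambda>n. exp (- (real n powr e2 / 128))) \<longlonglongrightarrow> 0" "(\<lambda>n. exp (- (real n powr e1 / 32))) \<longlonglongrightarrow> 0"
    using e(1,2) by real_asymp+
  from tendsto_add[OF this] have "B' \<longlonglongrightarrow> 0" by (simp add: B'_def[abs_def])
  have lim: "(\<lambda>n. ennreal (B n) + 2 * ennreal (B' n)) \<longlonglongrightarrow> ennreal 0 + 2 * ennreal 0"
    by (intro tendsto_add tendsto_mult_ennreal tendsto_const tendsto_ennrealI B(1) \<open>B' \<longlonglongrightarrow> 0\<close>) auto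
  have "\<forall>\<^sub>F n in sequentially. S1 n \<ge> real n powr (- a')"
    unfolding S1_def t_def a'_def a_def w_def
    by (rule eventually_C_law_box[OF r s v _ _ \<xi>(1)]) (use box \<xi> in \<open>auto simp: w_def\<close>)
  moreover have "\<forall>\<^sub>F n in sequentially. 2 * real n powr (- b') \<le> real n powr (- a') / 2"
    using e(3) by real_asymp
  moreover have "\<forall>\<^sub>F n in sequentially. X n * sqrt (2 * real n powr (1 - b')) \<le> real n powr e1 / 4"
  proof -
    define c where "c = (1 - b') / 2"
    have "c < e1" using e(2) by (simp add: e2_def c_def)
    then have "\<forall>\<^sub>F n in sequentially. sqrt (2 * (1 + \<delta>) * ln (ln (real n))) * (sqrt 2 * real n powr c) \<le> real n powr e1 / 4"
      using \<delta> e(1) by real_asymp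
    moreover have "sqrt (2 * real n powr (1 - b')) = sqrt 2 * real n powr c" for n
      by (simp add: real_sqrt_mult c_def powr_half_sqrt_powr)
    ultimately show ?thesis by (simp add: X_def)
  qed
  moreover have "\<forall>\<^sub>F n in sequentially. X n > 0" unfolding X_def using \<delta> by real_asymp
  moreover have "\<forall>\<^sub>F n::nat in sequentially. n \<ge> 2" by (rule eventually_ge_at_top)
  ultimately have "\<forall>\<^sub>F n in sequentially. test_risk n (p n) (q n) (psi_dot n (p n) (q n) r s \<delta> (\<theta> n) (\<eta> n)) (\<theta> n) (\<eta> n) (\<epsilon> n)
      \<le> ennreal (B n) + 2 * ennreal (B' n)"
    using B(2)
  proof eventually_elim
    case (elim n)
    interpret T: testing_setup r s n "p n" "q n" "\<theta> n" "\<eta> n" by (rule hyp) (rule elim)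
    have n: "real n > 0" using elim(5) by simp
    have \<epsilon>: "\<epsilon> n > 0" "real n * \<epsilon> n = real n powr (1 - \<beta>)"
      using n by (simp_all add: eps powr_diff powr_minus field_simps)
    have Sle: "S n \<le> 2 * real n powr (- b')"
      unfolding S_def t_def b'_def L_def
      by (rule S_tail_le) (use r s \<rho> \<kappa> elim(5) in auto)
    have S0: "S n > 0" unfolding S_def by (rule S_tail_pos[OF r s])
    have S1: "S1 n \<ge> real n powr (- a')" by (rule elim)
    have S_half: "S n \<le> S1 n / 2" using Sle S1 elim(2) by linarith
    interpret D: prob_space "C_law n r s" by (rule prob_space_C_law)
    have "S1 n \<le> 1" by (simp add: S1_def)
    then have S_1: "S n < 1" using S_half by simp
    have nS: "real n * S n \<le> 2 * real n powr (1 - b')"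
    proof -
      have "real n * S n \<le> real n * (2 * real n powr (- b'))" using Sle n by (intro mult_left_mono) auto
      also have "\<dots> = 2 * real n powr (1 - b')" using n by (simp add: powr_diff powr_minus field_simps)
      finally show ?thesis .
    qed
    have nS1: "real n powr e1 \<le> real n * \<epsilon> n * S1 n"
    proof -
      have "real n powr e1 = real n powr (1 - \<beta>) * real n powr (- a')" by (simp add: e1_def flip: powr_add)
      also have "\<dots> \<le> real n * \<epsilon> n * S1 n" unfolding \<epsilon>(2) using S1 by (intro mult_left_mono) auto
      finally show ?thesis .
    qed
    have "X n * sqrt (real n * S n) \<le> X n * sqrt (2 * real n powr (1 - b'))"
      using nS elim(4) by (intro mult_left_mono) auto
    also have "\<dots> \<le> real n powr e1 / 4" by (rule elim)
    also have "\<dots> \<le> real n * \<epsilon> n * S1 n / 4" using nS1 by simp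
    finally have XS: "X n * sqrt (real n * S n) \<le> real n * \<epsilon> n * S1 n / 4" .
    have "test_risk n (p n) (q n) (psi_dot n (p n) (q n) r s \<delta> (\<theta> n) (\<eta> n)) (\<theta> n) (\<eta> n) (\<epsilon> n) \<le> ennreal (B n) +
       2 * ennreal (exp (- ((real n * \<epsilon> n * S1 n / 2)\<^sup>2 / (16 * (real n * S n)))) + exp (- (real n * \<epsilon> n * S1 n / 2 / 16)))"
      unfolding S1_def S_def
    proof (rule test_risk_psi_dot_le[OF T.testing_setup_axioms \<epsilon>(1)])
      fix N :: "((nat \<Rightarrow> real) \<times> (nat \<Rightarrow> real)) measure" and M C D
      assume "iid_sample n N M C D"
      then show "(\<integral>\<^sup>+\<omega>. of_bool (\<exists>t. iid_sample.ratio n C D t \<omega> > sqrt (2 * (1 + \<delta>) * ln (ln (real n)))) \<partial>PiM {..<n} M) \<le> ennreal (B n)"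
        using elim(6) by (simp add: X_def)
    qed (use S_half S_1 XS elim(4) in \<open>simp_all add: S_def S1_def X_def\<close>)
    also have "\<dots> \<le> ennreal (B n) + 2 * ennreal (B' n)"
    proof (intro add_left_mono mult_left_mono ennreal_leI)
      have "real n powr e2 / 128 = (real n powr e1 / 2)\<^sup>2 / (16 * (2 * real n powr (1 - b')))"
      proof -
        have 1: "(real n powr e1)\<^sup>2 = real n powr (2 * e1)" by (simp add: power2_eq_square flip: powr_add)
        have 2: "real n powr e2 = real n powr (2 * e1) / real n powr (1 - b')" by (simp only: e2_def powr_diff)
        show ?thesis unfolding power_divide 1 2 by simp
      qed
      also have "\<dots> \<le> (real n * \<epsilon> n * S1 n / 2)\<^sup>2 / (16 * (real n * S n))"
        using nS nS1 n S0 by (intro frac_le power_mono divide_right_mono mult_left_mono) auto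
      finally have 1: "real n powr e2 / 128 \<le> (real n * \<epsilon> n * S1 n / 2)\<^sup>2 / (16 * (real n * S n))" .
      show "exp (- ((real n * \<epsilon> n * S1 n / 2)\<^sup>2 / (16 * (real n * S n)))) + exp (- (real n * \<epsilon> n * S1 n / 2 / 16)) \<le> B' n"
        unfolding B'_def using 1 nS1 by (intro add_mono) auto
    qed simp
    finally show ?case .
  qed
  note bound = this
  have "(\<lambda>n. ennreal (B n) + 2 * ennreal (B' n)) \<longlonglongrightarrow> 0" using lim by simp
  then show ?thesis
    by (rule tendsto_sandwich[OF always_eventually bound tendsto_const, rotated]) simp
qed


section \<open>The lower bound\<close>

text \<open>Stated for semirings because it serves real prior weights as well as likelihoods in
  \<open>ennreal\<close>. This factorization makes the mixture over all labels a product
  measure.\<close>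

lemma sum_labels_prod:
  fixes f :: "nat \<Rightarrow> real \<Rightarrow> real \<Rightarrow> 'c :: comm_semiring_1"
  shows "(\<Sum>z\<in>labels n. \<Sum>\<sigma>\<in>labels n. \<Prod>i<n. f i (z i) (\<sigma> i)) = (\<Prod>i<n. \<Sum>a\<in>{-1, 1}. \<Sum>b\<in>{-1, 1}. f i a b)"
proof -
  have "(\<Sum>z\<in>labels n. \<Sum>\<sigma>\<in>labels n. \<Prod>i<n. f i (z i) (\<sigma> i)) = (\<Sum>z\<in>labels n. \<Prod>i<n. \<Sum>b\<in>{-1, 1}. f i (z i) b)"
    unfolding labels_def by (intro sum.cong refl prod_sum_PiE[symmetric]) auto
  also have "\<dots> = (\<Prod>i<n. \<Sum>a\<in>{-1, 1}. \<Sum>b\<in>{-1, 1}. f i a b)"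
    unfolding labels_def by (intro prod_sum_PiE[symmetric]) auto
  finally show ?thesis .
qed

section \<open>Gaussian shifts as densities\<close>

lemma PiM_density:
  assumes I: "finite I" and M: "\<And>i. prob_space (M i)" and f [measurable]: "\<And>i. f i \<in> borel_measurable (M i)"
    and fM: "\<And>i. prob_space (density (M i) (f i))"
  shows "PiM I (\<lambda>i. density (M i) (f i)) = density (PiM I M) (\<lambda>x. \<Prod>i\<in>I. f i (x i))"
proof -
  interpret M: product_sigma_finite M
    by (rule product_sigma_finite.intro) (rule prob_space_imp_sigma_finite[OF M])
  interpret D: product_sigma_finite "\<lambda>i. density (M i) (f i)"
    by (rule product_sigma_finite.intro) (rule prob_space_imp_sigma_finite[OF fM])
  show ?thesis
  proof (rule D.PiM_eqI[symmetric, OF I])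
    show "sets (density (PiM I M) (\<lambda>x. \<Prod>i\<in>I. f i (x i))) = sets (PiM I (\<lambda>i. density (M i) (f i)))"
      by (simp, intro sets_PiM_cong) auto
    fix A assume "\<And>i. i \<in> I \<Longrightarrow> A i \<in> sets (density (M i) (f i))"
    then have A: "\<And>i. i \<in> I \<Longrightarrow> A i \<in> sets (M i)" by simp
    have "emeasure (density (PiM I M) (\<lambda>x. \<Prod>i\<in>I. f i (x i))) (Pi\<^sub>E I A)
        = (\<integral>\<^sup>+x. (\<Prod>i\<in>I. f i (x i)) * indicator (Pi\<^sub>E I A) x \<partial>PiM I M)"
      using A I by (intro emeasure_density) (auto intro!: sets_PiM_I_finite)
    also have "\<dots> = (\<integral>\<^sup>+x. (\<Prod>i\<in>I. f i (x i) * indicator (A i) (x i)) \<partial>PiM I M)"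
    proof (intro nn_integral_cong)
      fix x assume x: "x \<in> space (PiM I M)"
      have "(indicator (Pi\<^sub>E I A) x :: ennreal) = (\<Prod>i\<in>I. indicator (A i) (x i))"
      proof (cases "x \<in> Pi\<^sub>E I A")
        case True
        then show ?thesis by (auto simp: PiE_iff)
      next
        case False
        then obtain i where "i \<in> I" "x i \<notin> A i" using x by (auto simp: space_PiM PiE_iff)
        then have "(\<Prod>i\<in>I. indicator (A i) (x i) :: ennreal) = 0" using I by (intro prod_zero) (auto simp: indicator_def)
        then show ?thesis using False by simp
      qed
      then show "(\<Prod>i\<in>I. f i (x i)) * indicator (Pi\<^sub>E I A) x = (\<Prod>i\<in>I. f i (x i) * indicator (A i) (x i))"
        by (simp add: prod.distrib)
    qed
    also have "\<dots> = (\<Prod>i\<in>I. \<integral>\<^sup>+x. f i x * indicator (A i) x \<partial>M i)"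
      using A by (intro M.product_nn_integral_prod I) auto
    also have "\<dots> = (\<Prod>i\<in>I. emeasure (density (M i) (f i)) (A i))"
      using A by (intro prod.cong refl emeasure_density[symmetric]) auto
    finally show "emeasure (density (PiM I M) (\<lambda>x. \<Prod>i\<in>I. f i (x i))) (Pi\<^sub>E I A) = (\<Prod>i\<in>I. emeasure (density (M i) (f i)) (A i))" .
  qed
qed

lemma normal_law_density: "normal_law m = density (normal_law 0) (\<lambda>x. ennreal (exp (m * x - m\<^sup>2 / 2)))"
proof -
  have "normal_density m 1 x = normal_density 0 1 x * exp (m * x - m\<^sup>2 / 2)" for x
  proof -
    have "- (x - m)\<^sup>2 / 2 = - x\<^sup>2 / 2 + (m * x - m\<^sup>2 / 2)" by (simp add: power2_eq_square field_simps)
    then have "exp (- (x - m)\<^sup>2 / 2) = exp (- x\<^sup>2 / 2) * exp (m * x - m\<^sup>2 / 2)" by (simp only: exp_add)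
    then show ?thesis by (simp add: normal_density_def)
  qed
  then show ?thesis
    unfolding normal_law_def by (subst density_density_eq) (auto simp: ennreal_mult)
qed

lemma std_normal_vec_density:
  "std_normal_vec d a = density (std_normal_vec d (\<lambda>_. 0)) (\<lambda>X. ennreal (exp (dot d a X - dot d a a / 2)))"
proof -
  have "std_normal_vec d a = PiM {..<d} (\<lambda>j. density (normal_law 0) (\<lambda>x. ennreal (exp (a j * x - (a j)\<^sup>2 / 2))))"
    by (simp add: std_normal_vec_def normal_law_density[symmetric])
  also have "\<dots> = density (std_normal_vec d (\<lambda>_. 0)) (\<lambda>X. \<Prod>j<d. ennreal (exp (a j * X j - (a j)\<^sup>2 / 2)))"
    unfolding std_normal_vec_def
    by (rule PiM_density) (auto intro: prob_space_normal_law simp: normal_law_density[symmetric])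
  also have "(\<lambda>X. \<Prod>j<d. ennreal (exp (a j * X j - (a j)\<^sup>2 / 2))) = (\<lambda>X. ennreal (exp (dot d a X - dot d a a / 2)))"
    by (simp add: fun_eq_iff prod_ennreal dot_def sum_subtractf sum_divide_distrib power2_eq_square flip: exp_sum)
  finally show ?thesis .
qed

text \<open>With z = sqrt (1 + y) the deficit 1 + y / 2 - z is (z - 1)^2 / 2. Since (z - 1)^2 is
  bounded by both y^2 and \<bar>y\<bar>, it is bounded by every power of \<bar>y\<bar> between
  them.\<close>

lemma sqrt_ge_linear:
  fixes y \<rho> :: real
  assumes y: "y \<ge> -1" and \<rho>: "1 \<le> \<rho>" "\<rho> \<le> 2"
  shows "1 + y / 2 \<le> sqrt (1 + y) + \<bar>y\<bar> powr \<rho> / 2"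
proof -
  define z where "z = sqrt (1 + y)"
  have z: "z \<ge> 0" "z\<^sup>2 = 1 + y" using y by (simp_all add: z_def)
  have yz: "\<bar>y\<bar> = \<bar>z - 1\<bar> * (z + 1)"
  proof -
    have "y = (z - 1) * (z + 1)" using z by (simp add: power2_eq_square algebra_simps)
    then show ?thesis using z by (simp add: abs_mult)
  qed
  have "(z - 1)\<^sup>2 \<le> \<bar>y\<bar> powr \<rho>"
  proof (cases "y = 0")
    case False
    show ?thesis
    proof (cases "\<bar>y\<bar> \<le> 1")
      case True
      have "\<bar>z - 1\<bar> * 1 \<le> \<bar>y\<bar>" unfolding yz using z by (intro mult_left_mono) auto
      then have "\<bar>z - 1\<bar>\<^sup>2 \<le> \<bar>y\<bar>\<^sup>2" by (intro power_mono) auto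
      also have "\<dots> = \<bar>y\<bar> powr 2" using False by simp
      also have "\<dots> \<le> \<bar>y\<bar> powr \<rho>" using True \<rho> False by (intro powr_mono') auto
      finally show ?thesis by simp
    next
      case f: False
      have "(z - 1)\<^sup>2 = \<bar>z - 1\<bar> * \<bar>z - 1\<bar>" by (simp add: power2_eq_square flip: abs_mult)
      also have "\<dots> \<le> \<bar>y\<bar>" unfolding yz using z by (intro mult_left_mono) auto
      also have "\<dots> = \<bar>y\<bar> powr 1" by simp
      also have "\<dots> \<le> \<bar>y\<bar> powr \<rho>" using f \<rho> by (intro powr_mono) auto
      finally show ?thesis .
    qed
  qed (use z_def in simp)
  moreover have "(z - 1)\<^sup>2 = 2 + y - 2 * z" using z by (simp add: power2_eq_square algebra_simps)
  ultimately show ?thesis by (simp add: z_def)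
qed

lemma ennreal_half_add: "0 \<le> A \<Longrightarrow> 0 \<le> B \<Longrightarrow> ennreal ((A + B) / 2) = ennreal (1 / 2) * (ennreal A + ennreal B)"
  by (subst ennreal_plus[symmetric], simp, simp, subst ennreal_mult[symmetric]) auto

context testing_setup begin

abbreviation base where "base \<equiv> sample 0 0"
text \<open>For signs \<open>a\<close> and \<open>b\<close> this is the density of
  \<open>sample a b\<close> with respect to \<open>base\<close>; the squares of the signs are left
  out of the last term.\<close>

definition dens :: "real \<Rightarrow> real \<Rightarrow> (nat \<Rightarrow> real) \<times> (nat \<Rightarrow> real) \<Rightarrow> real" where
  "dens a b x = exp (a * dot p \<theta> (fst x) + b * dot q \<eta> (snd x) - (dot p \<theta> \<theta> + dot q \<eta> \<eta>) / 2)"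

lemma dens_measurable [measurable]: "dens a b \<in> borel_measurable (sample c c')"
proof -
  have "dens a b \<in> borel_measurable sample_space" unfolding dens_def by measurable
  then show ?thesis by (subst measurable_cong_sets[OF sets_sample refl])
qed

lemma dens_pos: "dens a b x > 0" by (simp add: dens_def)

lemma dot_smult_left: "dot d (\<lambda>j. z * a j) b = z * dot d a b"
  by (simp add: dot_def sum_distrib_left mult_ac)

lemma sample_density:
  assumes "a \<in> {-1, 1}" "b \<in> {-1, 1}"
  shows "sample a b = density base (\<lambda>x. ennreal (dens a b x))"
proof -
  have ab: "a * a = 1" "b * b = 1" using assms by auto
  have sf: "sigma_finite_measure (std_normal_vec q (\<lambda>_. 0))" "sigma_finite_measure (std_normal_vec q (\<lambda>j. b * \<eta> j))"
    by (intro prob_space_imp_sigma_finite prob_space_std_normal_vec)+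
  have ms: "(\<lambda>X. ennreal (exp (dot d c X - e))) \<in> borel_measurable (std_normal_vec d c')" for d c c' e
    by (simp cong: measurable_cong_sets add: sets_std_normal_vec)
  have "sample a b = density (std_normal_vec p (\<lambda>_. 0)) (\<lambda>X. ennreal (exp (dot p (\<lambda>j. a * \<theta> j) X - dot p \<theta> \<theta> / 2)))
      \<Otimes>\<^sub>M density (std_normal_vec q (\<lambda>_. 0)) (\<lambda>Y. ennreal (exp (dot q (\<lambda>j. b * \<eta> j) Y - dot q \<eta> \<eta> / 2)))"
    using std_normal_vec_density[of p "\<lambda>j. a * \<theta> j"] std_normal_vec_density[of q "\<lambda>j. b * \<eta> j"]
    by (simp add: dot_smult dot_smult_left ab flip: mult.assoc)
  also have "\<dots> = density (std_normal_vec p (\<lambda>_. 0) \<Otimes>\<^sub>M std_normal_vec q (\<lambda>_. 0))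
      (\<lambda>(X, Y). ennreal (exp (dot p (\<lambda>j. a * \<theta> j) X - dot p \<theta> \<theta> / 2)) * ennreal (exp (dot q (\<lambda>j. b * \<eta> j) Y - dot q \<eta> \<eta> / 2)))"
    using sf std_normal_vec_density[of q "\<lambda>j. b * \<eta> j"]
    by (intro pair_measure_density ms) (simp_all add: dot_smult dot_smult_left ab flip: mult.assoc)
  also have "\<dots> = density base (\<lambda>x. ennreal (dens a b x))"
    by (intro arg_cong2[where f=density])
       (auto simp: fun_eq_iff dens_def dot_smult_left add_divide_distrib algebra_simps simp flip: ennreal_mult exp_add)
  finally show ?thesis .
qed

abbreviation Q where "Q \<equiv> PiM {..<n} (\<lambda>_. base)"

lemma joint_law_density:
  assumes "\<And>i. i < n \<Longrightarrow> z i \<in> {-1, 1}" "\<And>i. i < n \<Longrightarrow> \<sigma> i \<in> {-1, 1}"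
  shows "law z \<sigma> = density Q (\<lambda>x. \<Prod>i<n. ennreal (dens (z i) (\<sigma> i) (x i)))"
proof -
  \<comment> \<open>The labels are continued by 1 beyond \<open>n\<close>, because
    \<open>PiM_density\<close> asks for probability measures at every index.\<close>
  define z' where "z' i = (if i < n then z i else 1)" for i
  define \<sigma>' where "\<sigma>' i = (if i < n then \<sigma> i else 1)" for i
  have z': "z' i \<in> {-1, 1}" "\<sigma>' i \<in> {-1, 1}" for i using assms[of i] by (auto simp: z'_def \<sigma>'_def)
  have "law z \<sigma> = PiM {..<n} (\<lambda>i. density base (\<lambda>x. ennreal (dens (z' i) (\<sigma>' i) x)))"
    unfolding joint_law_def sample_density[OF z', symmetric] by (intro PiM_cong) (auto simp: z'_def \<sigma>'_def)
  also have "\<dots> = density Q (\<lambda>x. \<Prod>i<n. ennreal (dens (z' i) (\<sigma>' i) (x i)))"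
  proof (rule PiM_density)
    show "prob_space (density base (\<lambda>x. ennreal (dens (z' i) (\<sigma>' i) x)))" for i
      unfolding sample_density[OF z', symmetric] by (rule prob_space_sample)
  qed (simp, rule prob_space_sample, measurable)
  also have "(\<lambda>x. \<Prod>i<n. ennreal (dens (z' i) (\<sigma>' i) (x i))) = (\<lambda>x. \<Prod>i<n. ennreal (dens (z i) (\<sigma> i) (x i)))"
    by (intro ext prod.cong) (auto simp: z'_def \<sigma>'_def)
  finally show ?thesis .
qed

text \<open>One observation with equal labels (\<open>F0\<close>) or opposite labels
  (\<open>F1\<close>), averaged over a fair sign.\<close>

definition F0 where "F0 x = (dens 1 1 x + dens (-1) (-1) x) / 2"
definition F1 where "F1 x = (dens 1 (-1) x + dens (-1) 1 x) / 2"

lemma F_measurable [measurable]: "F0 \<in> borel_measurable (sample c c')" "F1 \<in> borel_measurable (sample c c')"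
  unfolding F0_def[abs_def] F1_def[abs_def] by measurable

lemma F_pos: "F0 x > 0" "F1 x > 0"
  using dens_pos[of 1 1 x] dens_pos[of "-1" "-1" x] dens_pos[of 1 "-1" x] dens_pos[of "-1" 1 x]
  by (simp_all add: F0_def F1_def)

lemma nn_integral_dens:
  assumes "a \<in> {-1, 1}" "b \<in> {-1, 1}" "f \<in> borel_measurable sample_space"
  shows "(\<integral>\<^sup>+x. ennreal (dens a b x) * f x \<partial>base) = (\<integral>\<^sup>+x. f x \<partial>sample a b)"
proof -
  have "f \<in> borel_measurable base" using assms(3) by (subst measurable_cong_sets[OF sets_sample refl])
  then show ?thesis unfolding sample_density[OF assms(1,2)] by (subst nn_integral_density) auto
qed

lemma nn_integral_dens_1:
  assumes "a \<in> {-1, 1}" "b \<in> {-1, 1}"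
  shows "(\<integral>\<^sup>+x. ennreal (dens a b x) \<partial>base) = 1"
  using nn_integral_dens[OF assms, of "\<lambda>_. 1"] prob_space.emeasure_space_1[OF prob_space_sample, of a b] by simp

lemma nn_integral_F: "(\<integral>\<^sup>+x. ennreal (F0 x) \<partial>base) = 1" "(\<integral>\<^sup>+x. ennreal (F1 x) \<partial>base) = 1"
proof -
  have half: "(\<integral>\<^sup>+x. ennreal ((dens a b x + dens a' b' x) / 2) \<partial>base) = 1"
    if "a \<in> {-1, 1}" "b \<in> {-1, 1}" "a' \<in> {-1, 1}" "b' \<in> {-1, 1}" for a b a' b'
  proof -
    have "(\<integral>\<^sup>+x. ennreal ((dens a b x + dens a' b' x) / 2) \<partial>base)
        = (\<integral>\<^sup>+x. ennreal (1 / 2) * (ennreal (dens a b x) + ennreal (dens a' b' x)) \<partial>base)"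
      using ennreal_half_add by (intro nn_integral_cong) (simp only: less_imp_le dens_pos)
    also have "\<dots> = ennreal (1 / 2) * (1 + 1)"
      using dens_measurable
      by (subst nn_integral_cmult, measurable, subst nn_integral_add)
         (simp_all only: nn_integral_dens_1[OF that(1,2)] nn_integral_dens_1[OF that(3,4)] measurable_compose[OF _ measurable_ennreal])
    also have "(1 + 1 :: ennreal) = ennreal 2" by simp
    also have "ennreal (1 / 2) * ennreal 2 = ennreal (1 / 2 * 2)" by (rule ennreal_mult[symmetric]) auto
    also have "\<dots> = 1" by simp
    finally show ?thesis .
  qed
  show "(\<integral>\<^sup>+x. ennreal (F0 x) \<partial>base) = 1" "(\<integral>\<^sup>+x. ennreal (F1 x) \<partial>base) = 1"
    unfolding F0_def F1_def by (rule half; simp)+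
qed

end


text \<open>
  Under this prior the pairs of labels are independent, \<open>z\<^sub>i\<close> is a fair sign and \<open>\<sigma>\<^sub>i \<noteq> z\<^sub>i\<close> with
  probability \<open>e\<close>; \<open>e = 0\<close> is a prior on the null hypothesis.
\<close>

definition flip_weight :: "real \<Rightarrow> real \<Rightarrow> real \<Rightarrow> real" where
  "flip_weight e a b = (if a = b then (1 - e) / 2 else e / 2)"

definition label_prior :: "nat \<Rightarrow> real \<Rightarrow> (nat \<Rightarrow> real) \<Rightarrow> (nat \<Rightarrow> real) \<Rightarrow> real" where
  "label_prior n e z \<sigma> = (\<Prod>i<n. flip_weight e (z i) (\<sigma> i))"

lemma flip_weight_nonneg: "0 \<le> e \<Longrightarrow> e \<le> 1 \<Longrightarrow> flip_weight e a b \<ge> 0"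
  by (simp add: flip_weight_def)

lemma label_prior_nonneg: "0 \<le> e \<Longrightarrow> e \<le> 1 \<Longrightarrow> label_prior n e z \<sigma> \<ge> 0"
  unfolding label_prior_def by (intro prod_nonneg ballI flip_weight_nonneg)

lemma sum_label_prior_mult:
  "(\<Sum>z\<in>labels n. \<Sum>\<sigma>\<in>labels n. label_prior n e z \<sigma> * (\<Prod>i<n. f (z i) (\<sigma> i)))
   = ((1 - e) * (f 1 1 + f (-1) (-1)) / 2 + e * (f 1 (-1) + f (-1) 1) / 2) ^ n"
  unfolding label_prior_def prod.distrib[symmetric]
  by (subst sum_labels_prod[where f="\<lambda>i a b. flip_weight e a b * f a b"])
     (simp add: flip_weight_def algebra_simps add_divide_distrib diff_divide_distrib)

lemma sum_label_prior: "(\<Sum>z\<in>labels n. \<Sum>\<sigma>\<in>labels n. label_prior n e z \<sigma>) = 1"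
proof -
  have "(1 - e) * (1 + 1) / 2 + e * (1 + 1) / 2 = 1" by (simp add: field_simps)
  with sum_label_prior_mult[of n e "\<lambda>_ _. 1"] show ?thesis by (simp only:) simp
qed

text \<open>Markov's inequality for the exponential of minus each of the two disagreement counts
  whose minimum is the distance. Under the prior both moments are n-th powers.\<close>

lemma label_prior_close:
  assumes n: "n > 0" and e: "0 \<le> e" "e \<le> 1"
  shows "(\<Sum>z\<in>labels n. \<Sum>\<sigma>\<in>labels n. label_prior n e z \<sigma> * of_bool (label_dist n z \<sigma> \<le> \<epsilon>))
    \<le> exp (real n * \<epsilon>) * ((1 - e + e * exp (-1)) ^ n + ((1 - e) * exp (-1) + e) ^ n)"
proof -
  have "(\<Sum>z\<in>labels n. \<Sum>\<sigma>\<in>labels n. label_prior n e z \<sigma> * of_bool (label_dist n z \<sigma> \<le> \<epsilon>))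
    \<le> (\<Sum>z\<in>labels n. \<Sum>\<sigma>\<in>labels n. label_prior n e z \<sigma> * (exp (real n * \<epsilon>) *
        ((\<Prod>i<n. exp (- of_bool (z i \<noteq> \<sigma> i))) + (\<Prod>i<n. exp (- of_bool (z i \<noteq> - \<sigma> i))))))"
  proof (intro sum_mono mult_left_mono label_prior_nonneg e)
    fix z \<sigma> :: "nat \<Rightarrow> real"
    have one: "1 \<le> exp (real n * \<epsilon>) * (\<Prod>i<n. exp (- of_bool (z i \<noteq> f i)))"
      if "(1 / real n) * (\<Sum>i<n. of_bool (z i \<noteq> f i)) \<le> \<epsilon>" for f :: "nat \<Rightarrow> real"
    proof -
      have "(\<Sum>i<n. of_bool (z i \<noteq> f i)) \<le> real n * \<epsilon>" using that n by (simp add: field_simps)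
      then have "1 \<le> exp (real n * \<epsilon> + (\<Sum>i<n. - of_bool (z i \<noteq> f i)))" by (simp add: sum_negf)
      then show ?thesis by (simp only: exp_add exp_sum finite_lessThan)
    qed
    have pos: "0 \<le> exp (real n * \<epsilon>) * (\<Prod>i<n. exp (- of_bool (z i \<noteq> f i)))" for f :: "nat \<Rightarrow> real"
      by (intro mult_nonneg_nonneg prod_nonneg) auto
    show "of_bool (label_dist n z \<sigma> \<le> \<epsilon>) \<le> exp (real n * \<epsilon>) *
        ((\<Prod>i<n. exp (- of_bool (z i \<noteq> \<sigma> i))) + (\<Prod>i<n. exp (- of_bool (z i \<noteq> - \<sigma> i))))"
    proof (cases "label_dist n z \<sigma> \<le> \<epsilon>")
      case True
      then have "(1 / real n) * (\<Sum>i<n. of_bool (z i \<noteq> \<sigma> i)) \<le> \<epsilon> \<or> (1 / real n) * (\<Sum>i<n. of_bool (z i \<noteq> - \<sigma> i)) \<le> \<epsilon>"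
        unfolding label_dist_def min_le_iff_disj .
      then show ?thesis unfolding distrib_left
      proof
        assume "(1 / real n) * (\<Sum>i<n. of_bool (z i \<noteq> \<sigma> i)) \<le> \<epsilon>"
        from add_mono[OF one[of \<sigma>, OF this] pos[of "\<lambda>i. - \<sigma> i"]]
        show "of_bool (label_dist n z \<sigma> \<le> \<epsilon>) \<le> exp (real n * \<epsilon>) * (\<Prod>i<n. exp (- of_bool (z i \<noteq> \<sigma> i)))
            + exp (real n * \<epsilon>) * (\<Prod>i<n. exp (- of_bool (z i \<noteq> - \<sigma> i)))" using True by simp
      next
        assume "(1 / real n) * (\<Sum>i<n. of_bool (z i \<noteq> - \<sigma> i)) \<le> \<epsilon>"
        from add_mono[OF pos[of \<sigma>] one[of "\<lambda>i. - \<sigma> i", OF this]]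
        show "of_bool (label_dist n z \<sigma> \<le> \<epsilon>) \<le> exp (real n * \<epsilon>) * (\<Prod>i<n. exp (- of_bool (z i \<noteq> \<sigma> i)))
            + exp (real n * \<epsilon>) * (\<Prod>i<n. exp (- of_bool (z i \<noteq> - \<sigma> i)))" using True by simp
      qed
    next
      case False
      have "0 \<le> exp (real n * \<epsilon>) * (\<Prod>i<n. exp (- of_bool (z i \<noteq> \<sigma> i))) + exp (real n * \<epsilon>) * (\<Prod>i<n. exp (- of_bool (z i \<noteq> - \<sigma> i)))"
        by (intro add_nonneg_nonneg pos)
      then show ?thesis using False unfolding distrib_left by simp
    qed
  qed
  also have "\<dots> = exp (real n * \<epsilon>) * ((\<Sum>z\<in>labels n. \<Sum>\<sigma>\<in>labels n. label_prior n e z \<sigma> * (\<Prod>i<n. exp (- of_bool (z i \<noteq> \<sigma> i))))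
       + (\<Sum>z\<in>labels n. \<Sum>\<sigma>\<in>labels n. label_prior n e z \<sigma> * (\<Prod>i<n. exp (- of_bool (z i \<noteq> - \<sigma> i)))))"
    by (simp add: sum_distrib_left sum.distrib distrib_left mult.left_commute)
  also have "\<dots> = exp (real n * \<epsilon>) * ((1 - e + e * exp (-1)) ^ n + ((1 - e) * exp (-1) + e) ^ n)"
    unfolding sum_label_prior_mult[of n e "\<lambda>a b. exp (- of_bool (a \<noteq> b))"] sum_label_prior_mult[of n e "\<lambda>a b. exp (- of_bool (a \<noteq> - b))"]
    by (simp add: diff_divide_distrib)
  finally show ?thesis .
qed

lemma powr_diff_one_le:
  fixes g \<rho> e :: real
  assumes "g \<ge> 0" "e \<ge> 0" "\<rho> \<ge> 0"
  shows "\<bar>e * (g - 1)\<bar> powr \<rho> \<le> e powr \<rho> * (1 + g powr \<rho>)"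
proof -
  have "\<bar>g - 1\<bar> powr \<rho> \<le> 1 + g powr \<rho>"
  proof (cases "g \<le> 1")
    case True
    then have "\<bar>g - 1\<bar> powr \<rho> \<le> 1 powr \<rho>" using assms by (intro powr_mono2) auto
    then show ?thesis by (simp add: add_increasing2)
  next
    case False
    then have "\<bar>g - 1\<bar> powr \<rho> \<le> g powr \<rho>" using assms by (intro powr_mono2) auto
    then show ?thesis by simp
  qed
  then show ?thesis using assms by (simp add: abs_mult powr_mult mult_left_mono)
qed

context testing_setup begin

text \<open>Up to a common factor the two densities are cosh a and cosh b, with cosh a \<le> exp
  \<bar>a\<bar> and cosh b \<ge> exp \<bar>b\<bar> / 2, and \<bar>a\<bar> - \<bar>b\<bar> is
  \<open>C_minus\<close>.\<close>

lemma F1_le: "F1 x \<le> 2 * exp (l * C x) * F0 x"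
proof -
  define a where "a = dot p \<theta> (fst x) - dot q \<eta> (snd x)"
  define b where "b = dot p \<theta> (fst x) + dot q \<eta> (snd x)"
  define E where "E = exp (- ((dot p \<theta> \<theta> + dot q \<eta> \<eta>) / 2))"
  have dens: "dens 1 1 x = E * exp b" "dens (-1) (-1) x = E * exp (- b)" "dens 1 (-1) x = E * exp a" "dens (-1) 1 x = E * exp (- a)"
    by (simp_all add: dens_def a_def b_def E_def algebra_simps flip: exp_add)
  have C: "l * C x = \<bar>a\<bar> - \<bar>b\<bar>"
    using l_pos by (cases x) (simp add: C_def C_minus_def a_def b_def)
  have "E * (exp a + exp (- a)) \<le> E * (exp \<bar>a\<bar> + exp \<bar>a\<bar>)"
    by (intro mult_left_mono add_mono) (simp_all add: E_def)
  then have "F1 x \<le> E * exp \<bar>a\<bar>" by (simp add: F1_def dens algebra_simps)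
  also have "\<dots> = exp (l * C x) * (E * exp \<bar>b\<bar>)" by (simp add: C flip: exp_add)
  also have "\<dots> \<le> exp (l * C x) * (2 * F0 x)"
  proof (intro mult_left_mono)
    have "exp \<bar>b\<bar> \<le> exp b + exp (- b)" by (cases "b \<ge> 0") auto
    then have "E * exp \<bar>b\<bar> \<le> E * (exp b + exp (- b))" by (intro mult_left_mono) (auto simp: E_def)
    then show "E * exp \<bar>b\<bar> \<le> 2 * F0 x" by (simp add: F0_def dens algebra_simps)
  qed simp
  finally show ?thesis by (simp add: mult_ac)
qed

text \<open>The density of one observation under the prior with mismatch probability
  \<open>e\<close>.\<close>

definition G where "G e x = (1 - e) * F0 x + e * F1 x"

lemma G_measurable [measurable]: "G e \<in> borel_measurable (sample c c')"
  unfolding G_def[abs_def] by measurable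

lemma G_nonneg: "0 \<le> e \<Longrightarrow> e \<le> 1 \<Longrightarrow> 0 \<le> G e x"
  using F_pos[of x] by (simp add: G_def)

lemma nn_integral_F0_exp:
  assumes \<rho>: "\<rho> \<ge> 0" and \<kappa>: "0 \<le> \<kappa>" "\<kappa> \<le> 1"
  defines "L \<equiv> mgf_exponent r s \<rho> \<kappa>"
  shows "(\<integral>\<^sup>+x. ennreal (F0 x) * ennreal (exp (\<rho> * l * C x)) \<partial>base) \<le> ennreal (2 * real n powr L)"
proof -
  note [measurable] = C_measurable
  have [measurable]: "C \<in> borel_measurable (sample c c')" for c c'
    using C_measurable by (subst measurable_cong_sets[OF sets_sample refl])
  have I: "(\<integral>\<^sup>+x. ennreal (dens a a x) * ennreal (exp (\<rho> * l * C x)) \<partial>base) \<le> ennreal (2 * real n powr L)"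
    if a: "a \<in> {-1, 1}" for a
  proof -
    have "(\<integral>\<^sup>+x. ennreal (dens a a x) * ennreal (exp (\<rho> * l * C x)) \<partial>base)
        = (\<integral>\<^sup>+x. ennreal (exp (\<rho> * l * C x)) \<partial>sample a a)"
      by (rule nn_integral_dens[OF a a]) measurable
    also have "\<dots> = (\<integral>\<^sup>+y. ennreal (exp (\<rho> * l * y)) \<partial>distr (sample a a) borel C)"
      by (subst nn_integral_distr) auto
    also have "\<dots> \<le> ennreal (2 * real n powr L)"
      unfolding distr_C[OF a] unfolding L_def l_def by (rule C_law_mgf) (use n r s \<rho> \<kappa> in auto)
    finally show ?thesis .
  qed
  have "(\<integral>\<^sup>+x. ennreal (F0 x) * ennreal (exp (\<rho> * l * C x)) \<partial>base)
     = (\<integral>\<^sup>+x. ennreal (1 / 2) * (ennreal (dens 1 1 x) * ennreal (exp (\<rho> * l * C x)) + ennreal (dens (-1) (-1) x) * ennreal (exp (\<rho> * l * C x))) \<partial>base)"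
  proof (intro nn_integral_cong)
    fix x
    have "ennreal (F0 x) = ennreal (1 / 2) * (ennreal (dens 1 1 x) + ennreal (dens (-1) (-1) x))"
      unfolding F0_def by (intro ennreal_half_add less_imp_le dens_pos)
    then show "ennreal (F0 x) * ennreal (exp (\<rho> * l * C x)) = ennreal (1 / 2) *
        (ennreal (dens 1 1 x) * ennreal (exp (\<rho> * l * C x)) + ennreal (dens (-1) (-1) x) * ennreal (exp (\<rho> * l * C x)))"
      by (simp only: distrib_right mult.assoc)
  qed
  also have "\<dots> = ennreal (1 / 2) * ((\<integral>\<^sup>+x. ennreal (dens 1 1 x) * ennreal (exp (\<rho> * l * C x)) \<partial>base)
      + (\<integral>\<^sup>+x. ennreal (dens (-1) (-1) x) * ennreal (exp (\<rho> * l * C x)) \<partial>base))"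
  proof -
    have m: "(\<lambda>x. ennreal (dens a b x) * ennreal (exp (\<rho> * l * C x))) \<in> borel_measurable base" for a b
      by measurable
    show ?thesis
      unfolding nn_integral_cmult[OF borel_measurable_add[OF m m]] nn_integral_add[OF m m] ..
  qed
  also have "\<dots> \<le> ennreal (1 / 2) * (ennreal (2 * real n powr L) + ennreal (2 * real n powr L))"
    by (intro mult_left_mono add_mono I) auto
  also have "\<dots> = ennreal ((2 * real n powr L + 2 * real n powr L) / 2)"
    by (rule ennreal_half_add[symmetric]) auto
  finally show ?thesis by simp
qed

text \<open>Relative to \<open>F0\<close> the density is 1 + y with y = e (g - 1), g the likelihood
  ratio. As y has mean zero, the linear term drops out of 1 minus the affinity and only the
  \<rho>-th moment remains. The 8 is the product of 4, a bound for 2 powr \<rho>, and of the 2 in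
  the exponential moment.\<close>

lemma affinity_bound:
  assumes \<rho>: "1 \<le> \<rho>" "\<rho> \<le> 2" and \<kappa>: "0 \<le> \<kappa>" "\<kappa> \<le> 1" and e: "0 \<le> e" "e \<le> 1"
  defines "L \<equiv> mgf_exponent r s \<rho> \<kappa>"
  shows "1 \<le> (\<integral>\<^sup>+x. ennreal (sqrt (F0 x * G e x)) \<partial>base) + ennreal (e powr \<rho> * (1 + 8 * real n powr L) / 2)"
proof -
  have [measurable]: "C \<in> borel_measurable (sample c c')" for c c'
    using C_measurable by (subst measurable_cong_sets[OF sets_sample refl])
  let ?\<alpha> = "\<integral>\<^sup>+x. ennreal (sqrt (F0 x * G e x)) \<partial>base"
  \<comment> \<open>Both sides are arranged without subtraction, as they are integrated in
    \<open>ennreal\<close>. That y has mean zero then appears as the cancellation of e / 2 at the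
    end.\<close>
  have pw: "F0 x + e / 2 * F1 x \<le> sqrt (F0 x * G e x) + (e / 2 + e powr \<rho> / 2) * F0 x + 2 * e powr \<rho> * (F0 x * exp (\<rho> * l * C x))" for x
  proof -
    define g where "g = F1 x / F0 x"
    have F: "F0 x > 0" "F1 x > 0" by (rule F_pos)+
    have g: "g > 0" "F1 x = g * F0 x" using F by (simp_all add: g_def)
    have "e * g \<ge> 0" using e g by simp
    then have y: "e * (g - 1) \<ge> -1" using e by (simp add: algebra_simps)
    have "1 + e * (g - 1) / 2 \<le> sqrt (1 + e * (g - 1)) + \<bar>e * (g - 1)\<bar> powr \<rho> / 2"
      by (rule sqrt_ge_linear[OF y \<rho>])
    also have "\<bar>e * (g - 1)\<bar> powr \<rho> \<le> e powr \<rho> * (1 + g powr \<rho>)"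
      using g e \<rho> by (intro powr_diff_one_le) auto
    also have "g powr \<rho> \<le> 4 * exp (\<rho> * l * C x)"
    proof -
      have "g \<le> 2 * exp (l * C x)" unfolding g_def using F1_le[of x] F by (simp add: pos_divide_le_eq)
      then have "g powr \<rho> \<le> (2 * exp (l * C x)) powr \<rho>" using g \<rho> by (intro powr_mono2) auto
      also have "\<dots> = 2 powr \<rho> * exp (\<rho> * l * C x)" by (simp add: powr_mult exp_powr_real mult_ac)
      also have "\<dots> \<le> 2 powr 2 * exp (\<rho> * l * C x)" using \<rho> by (intro mult_right_mono powr_mono) auto
      finally show ?thesis by simp
    qed
    finally have "1 + e * (g - 1) / 2 \<le> sqrt (1 + e * (g - 1)) + e powr \<rho> * (1 + 4 * exp (\<rho> * l * C x)) / 2"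
      by (simp add: mult_left_mono)
    then have "F0 x * (1 + e * (g - 1) / 2) \<le> F0 x * (sqrt (1 + e * (g - 1)) + e powr \<rho> * (1 + 4 * exp (\<rho> * l * C x)) / 2)"
      using F by (intro mult_left_mono) auto
    moreover have "F0 x * sqrt (1 + e * (g - 1)) = sqrt (F0 x * G e x)"
    proof -
      have "F0 x * G e x = (F0 x)\<^sup>2 * (1 + e * (g - 1))" by (simp add: G_def g(2) power2_eq_square algebra_simps)
      then show ?thesis using F by (simp only: real_sqrt_mult real_sqrt_abs)
    qed
    moreover have "F0 x * (1 + e * (g - 1) / 2) = F0 x + e / 2 * (g * F0 x) - e / 2 * F0 x"
      by (simp add: field_simps)
    moreover have "F0 x * (sqrt (1 + e * (g - 1)) + e powr \<rho> * (1 + 4 * exp (\<rho> * l * C x)) / 2)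
        = F0 x * sqrt (1 + e * (g - 1)) + e powr \<rho> / 2 * F0 x + 2 * e powr \<rho> * (F0 x * exp (\<rho> * l * C x))"
      by (simp add: field_simps)
    ultimately show ?thesis unfolding g(2) distrib_right by linarith
  qed
  have "1 + ennreal (e / 2) = (\<integral>\<^sup>+x. ennreal (F0 x) + ennreal (e / 2) * ennreal (F1 x) \<partial>base)"
    by (subst nn_integral_add, measurable, subst nn_integral_cmult, measurable) (simp only: nn_integral_F mult_1_right)
  also have "\<dots> \<le> (\<integral>\<^sup>+x. (ennreal (sqrt (F0 x * G e x)) + ennreal (e / 2 + e powr \<rho> / 2) * ennreal (F0 x))
       + ennreal (2 * e powr \<rho>) * (ennreal (F0 x) * ennreal (exp (\<rho> * l * C x))) \<partial>base)"
  proof (intro nn_integral_mono)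
    fix x
    have F: "0 \<le> F0 x" "0 \<le> F1 x" using F_pos[of x] by simp_all
    have "ennreal (F0 x) + ennreal (e / 2) * ennreal (F1 x) = ennreal (F0 x + e / 2 * F1 x)"
      using F e by (simp flip: ennreal_mult ennreal_plus)
    also have "\<dots> \<le> ennreal (sqrt (F0 x * G e x) + (e / 2 + e powr \<rho> / 2) * F0 x + 2 * e powr \<rho> * (F0 x * exp (\<rho> * l * C x)))"
      by (intro ennreal_leI pw)
    also have "\<dots> = (ennreal (sqrt (F0 x * G e x)) + ennreal (e / 2 + e powr \<rho> / 2) * ennreal (F0 x))
       + ennreal (2 * e powr \<rho>) * (ennreal (F0 x) * ennreal (exp (\<rho> * l * C x)))"
    proof -
      have "0 \<le> sqrt (F0 x * G e x)" using F G_nonneg[OF e, of x] by simp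
      moreover have "0 \<le> e / 2 + e powr \<rho> / 2" using e by simp
      ultimately show ?thesis
        using F by (simp flip: ennreal_mult ennreal_plus)
    qed
    finally show "ennreal (F0 x) + ennreal (e / 2) * ennreal (F1 x) \<le> (ennreal (sqrt (F0 x * G e x)) + ennreal (e / 2 + e powr \<rho> / 2) * ennreal (F0 x))
       + ennreal (2 * e powr \<rho>) * (ennreal (F0 x) * ennreal (exp (\<rho> * l * C x)))" .
  qed
  also have "\<dots> = ?\<alpha> + ennreal (e / 2 + e powr \<rho> / 2) + ennreal (2 * e powr \<rho>) * (\<integral>\<^sup>+x. ennreal (F0 x) * ennreal (exp (\<rho> * l * C x)) \<partial>base)"
  proof -
    have m: "(\<lambda>x. ennreal (sqrt (F0 x * G e x))) \<in> borel_measurable base" "(\<lambda>x. ennreal (F0 x)) \<in> borel_measurable base"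
      "(\<lambda>x. ennreal (F0 x) * ennreal (exp (\<rho> * l * C x))) \<in> borel_measurable base"
      by measurable
    have mc: "(\<lambda>x. c * f x) \<in> borel_measurable base" if "f \<in> borel_measurable base" for c and f :: "_ \<Rightarrow> ennreal"
      using that by measurable
    show ?thesis
      unfolding nn_integral_add[OF borel_measurable_add[OF m(1) mc[OF m(2)]] mc[OF m(3)]]
        nn_integral_add[OF m(1) mc[OF m(2)]] nn_integral_cmult[OF m(2)] nn_integral_cmult[OF m(3)] nn_integral_F mult_1_right ..
  qed
  also have "\<dots> \<le> ?\<alpha> + ennreal (e / 2 + e powr \<rho> / 2) + ennreal (2 * e powr \<rho>) * ennreal (2 * real n powr L)"
    unfolding L_def using \<rho> \<kappa> by (intro add_left_mono mult_left_mono nn_integral_F0_exp) auto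
  finally have main: "1 + ennreal (e / 2) \<le> ?\<alpha> + ennreal (e / 2 + e powr \<rho> / 2) + ennreal (2 * e powr \<rho>) * ennreal (2 * real n powr L)" .
  show ?thesis
  proof (cases "?\<alpha>")
    case (real A)
    have "ennreal (1 + e / 2) \<le> ennreal (A + (e / 2 + e powr \<rho> / 2) + 2 * e powr \<rho> * (2 * real n powr L))"
    proof -
      have 1: "1 + ennreal (e / 2) = ennreal (1 + e / 2)" using ennreal_plus[of 1 "e / 2"] e by simp
      have 2: "ennreal A + ennreal X + ennreal Y * ennreal Z = ennreal (A + X + Y * Z)"
        if "0 \<le> X" "0 \<le> Y" "0 \<le> Z" for X Y Z
        using that real(1) by (simp flip: ennreal_mult ennreal_plus)
      have "0 \<le> e / 2 + e powr \<rho> / 2" "0 \<le> 2 * e powr \<rho>" "0 \<le> 2 * real n powr L" using e by simp_all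
      from main[unfolded real(2) 1 2[OF this]] show ?thesis .
    qed
    then have "1 + e / 2 \<le> A + (e / 2 + e powr \<rho> / 2) + 2 * e powr \<rho> * (2 * real n powr L)"
      using real(1) e by (subst (asm) ennreal_le_iff) auto
    then have "ennreal 1 \<le> ennreal (A + e powr \<rho> * (1 + 8 * real n powr L) / 2)"
      by (intro ennreal_leI) (simp add: field_simps)
    then show ?thesis using real e by (simp add: ennreal_plus)
  qed simp
qed

end


lemma prod_sqrt: "(\<Prod>i<n. sqrt (f i)) = sqrt (\<Prod>i<(n::nat). f i)"
  by (induction n) (simp_all add: real_sqrt_mult)

text \<open>
  In place of Le Cam's bound for the testing error by the Hellinger affinity: this linear version
  integrates without the Cauchy--Schwarz inequality.
\<close>

lemma sqrt_mult_le_convex: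
  fixes a b t :: real
  assumes "0 \<le> a" "0 \<le> b" "0 \<le> t" "t \<le> 1"
  shows "sqrt (a * b) \<le> a * t + b * (1 - t) + (a + b) / 4"
proof -
  have main: "sqrt (x * y) \<le> x + y / 4" if "0 \<le> x" "0 \<le> y" for x y :: real
  proof -
    have "0 \<le> (sqrt x - sqrt y / 2)\<^sup>2" by simp
    also have "\<dots> = x + y / 4 - sqrt (x * y)"
      using that by (simp add: power2_diff power_divide real_sqrt_mult)
    finally show ?thesis by simp
  qed
  show ?thesis
  proof (cases "a \<le> b")
    case True
    have "a * t + a * (1 - t) \<le> a * t + b * (1 - t)" using True assms by (intro add_left_mono mult_right_mono) auto
    moreover have "a * t + a * (1 - t) = a" by (simp add: algebra_simps)
    moreover have "sqrt (a * b) \<le> a + b / 4" by (rule main[OF assms(1,2)])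
    ultimately show ?thesis using assms by (simp add: add_divide_distrib)
  next
    case False
    have "b * t + b * (1 - t) \<le> a * t + b * (1 - t)" using False assms by (intro add_right_mono mult_right_mono) auto
    moreover have "b * t + b * (1 - t) = b" by (simp add: algebra_simps)
    moreover have "sqrt (a * b) \<le> b + a / 4" using main[OF assms(2,1)] by (simp add: mult.commute)
    ultimately show ?thesis using assms by (simp add: add_divide_distrib)
  qed
qed

context testing_setup begin

lemma sum_flip_weight_dens:
  assumes e: "0 \<le> e" "e \<le> 1"
  shows "(\<Sum>a\<in>{-1, 1}. \<Sum>b\<in>{-1, 1}. ennreal (flip_weight e a b * dens a b x)) = ennreal (G e x)"
proof -
  have nn: "0 \<le> flip_weight e a b * dens a b x" for a b
    by (intro mult_nonneg_nonneg flip_weight_nonneg e less_imp_le dens_pos)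
  have "(\<Sum>a\<in>{-1, 1}. \<Sum>b\<in>{-1, 1}. ennreal (flip_weight e a b * dens a b x))
      = ennreal (\<Sum>a\<in>{-1, 1::real}. \<Sum>b\<in>{-1, 1::real}. flip_weight e a b * dens a b x)"
    by (simp only: sum_ennreal[OF nn] sum_ennreal[OF sum_nonneg[OF nn]])
  also have "(\<Sum>a\<in>{-1, 1::real}. \<Sum>b\<in>{-1, 1::real}. flip_weight e a b * dens a b x) = G e x"
    by (simp add: G_def F0_def F1_def flip_weight_def algebra_simps add_divide_distrib diff_divide_distrib)
  finally show ?thesis .
qed

text \<open>Prior weights and likelihoods both factorize over the observations, so averaging over
  the labels yields independent observations, each with density \<open>G e\<close>.\<close>

lemma mixture:
  assumes e: "0 \<le> e" "e \<le> 1" and f [measurable]: "f \<in> borel_measurable Q"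
  shows "(\<Sum>z\<in>labels n. \<Sum>\<sigma>\<in>labels n. ennreal (label_prior n e z \<sigma>) * (\<integral>\<^sup>+x. f x \<partial>law z \<sigma>))
    = (\<integral>\<^sup>+x. ennreal (\<Prod>i<n. G e (x i)) * f x \<partial>Q)"
proof -
  let ?d = "\<lambda>z \<sigma> x. ennreal (label_prior n e z \<sigma>) * ((\<Prod>i<n. ennreal (dens (z i) (\<sigma> i) (x i))) * f x)"
  have m: "?d z \<sigma> \<in> borel_measurable Q" for z \<sigma> by measurable
  have "(\<Sum>z\<in>labels n. \<Sum>\<sigma>\<in>labels n. ennreal (label_prior n e z \<sigma>) * (\<integral>\<^sup>+x. f x \<partial>law z \<sigma>))
      = (\<Sum>z\<in>labels n. \<Sum>\<sigma>\<in>labels n. \<integral>\<^sup>+x. ?d z \<sigma> x \<partial>Q)"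
  proof (intro sum.cong refl)
    fix z \<sigma> assume "z \<in> labels n" "\<sigma> \<in> labels n"
    then have "law z \<sigma> = density Q (\<lambda>x. \<Prod>i<n. ennreal (dens (z i) (\<sigma> i) (x i)))"
      by (intro joint_law_density labels_in)
    then have "(\<integral>\<^sup>+x. f x \<partial>law z \<sigma>) = (\<integral>\<^sup>+x. (\<Prod>i<n. ennreal (dens (z i) (\<sigma> i) (x i))) * f x \<partial>Q)"
      by (simp only:) (rule nn_integral_density; measurable)
    then show "ennreal (label_prior n e z \<sigma>) * (\<integral>\<^sup>+x. f x \<partial>law z \<sigma>) = (\<integral>\<^sup>+x. ?d z \<sigma> x \<partial>Q)"
      by (simp only:) (rule nn_integral_cmult[symmetric]; measurable)
  qed
  also have "\<dots> = (\<integral>\<^sup>+x. (\<Sum>z\<in>labels n. \<Sum>\<sigma>\<in>labels n. ?d z \<sigma> x) \<partial>Q)"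
    using m by (simp only: nn_integral_sum borel_measurable_sum)
  also have "\<dots> = (\<integral>\<^sup>+x. ennreal (\<Prod>i<n. G e (x i)) * f x \<partial>Q)"
  proof (intro nn_integral_cong)
    fix x :: data
    have "?d z \<sigma> x = (\<Prod>i<n. ennreal (flip_weight e (z i) (\<sigma> i) * dens (z i) (\<sigma> i) (x i))) * f x" for z \<sigma>
    proof -
      have "ennreal (label_prior n e z \<sigma>) = (\<Prod>i<n. ennreal (flip_weight e (z i) (\<sigma> i)))"
        unfolding label_prior_def by (intro prod_ennreal[symmetric] flip_weight_nonneg e)
      then show ?thesis
        by (simp add: ennreal_mult flip_weight_nonneg e less_imp_le dens_pos prod.distrib mult.assoc)
    qed
    then have "(\<Sum>z\<in>labels n. \<Sum>\<sigma>\<in>labels n. ?d z \<sigma> x)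
       = (\<Sum>z\<in>labels n. \<Sum>\<sigma>\<in>labels n. \<Prod>i<n. ennreal (flip_weight e (z i) (\<sigma> i) * dens (z i) (\<sigma> i) (x i))) * f x"
      by (simp only: sum_distrib_right)
    also have "\<dots> = ennreal (\<Prod>i<n. G e (x i)) * f x"
      unfolding sum_labels_prod[where f="\<lambda>i a b. ennreal (flip_weight e a b * dens a b (x i))"] sum_flip_weight_dens[OF e]
      by (simp only: prod_ennreal G_nonneg[OF e])
    finally show "(\<Sum>z\<in>labels n. \<Sum>\<sigma>\<in>labels n. ?d z \<sigma> x) = ennreal (\<Prod>i<n. G e (x i)) * f x" .
  qed
  finally show ?thesis .
qed

lemma nn_integral_prod_base:
  assumes g: "g \<in> borel_measurable base" and nn: "\<And>x. 0 \<le> g x"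
  shows "(\<integral>\<^sup>+x. ennreal (\<Prod>i<n. g (x i)) \<partial>Q) = (\<integral>\<^sup>+x. ennreal (g x) \<partial>base) ^ n"
proof -
  interpret product_sigma_finite "\<lambda>_::nat. base"
    by (rule product_sigma_finite.intro) (intro prob_space_imp_sigma_finite prob_space_sample)
  have "(\<integral>\<^sup>+x. ennreal (\<Prod>i<n. g (x i)) \<partial>Q) = (\<integral>\<^sup>+x. (\<Prod>i<n. ennreal (g (x i))) \<partial>Q)"
    by (simp only: prod_ennreal nn)
  also have "\<dots> = (\<Prod>i<n. \<integral>\<^sup>+x. ennreal (g x) \<partial>base)"
    using g by (intro product_nn_integral_prod) auto
  finally show ?thesis by (simp only: prod_constant card_lessThan)
qed

lemma nn_integral_G:
  assumes e: "0 \<le> e" "e \<le> 1"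
  shows "(\<integral>\<^sup>+x. ennreal (G e x) \<partial>base) = 1"
proof -
  have m: "(\<lambda>x. ennreal (1 - e) * ennreal (F0 x)) \<in> borel_measurable base" "(\<lambda>x. ennreal e * ennreal (F1 x)) \<in> borel_measurable base"
    "(\<lambda>x. ennreal (F0 x)) \<in> borel_measurable base" "(\<lambda>x. ennreal (F1 x)) \<in> borel_measurable base"
    by measurable
  have "(\<integral>\<^sup>+x. ennreal (G e x) \<partial>base) = (\<integral>\<^sup>+x. ennreal (1 - e) * ennreal (F0 x) + ennreal e * ennreal (F1 x) \<partial>base)"
  proof (intro nn_integral_cong)
    fix x
    show "ennreal (G e x) = ennreal (1 - e) * ennreal (F0 x) + ennreal e * ennreal (F1 x)"
      unfolding G_def using e F_pos[of x] by (simp flip: ennreal_mult ennreal_plus)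
  qed
  also have "\<dots> = ennreal (1 - e) + ennreal e"
    unfolding nn_integral_add[OF m(1,2)] nn_integral_cmult[OF m(3)] nn_integral_cmult[OF m(4)] nn_integral_F mult_1_right ..
  also have "\<dots> = 1" using e by (simp flip: ennreal_plus)
  finally show ?thesis .
qed

text \<open>The worst-case risk dominates an average. The prior with mismatch probability 0 lives on
  z = \<sigma>; the prior with \<open>e\<close> also charges labels too close to the null
  hypothesis, whose mass is paid for by the second term. The 1/2 is the integral of (a + b) / 4 from
  \<open>sqrt_mult_le_convex\<close>, both densities having integral 1.\<close>

lemma test_risk_ge_affinity:
  assumes \<psi>: "\<psi> \<in> tests n p q" and e: "0 \<le> e" "e \<le> 1"
  shows "(\<integral>\<^sup>+x. ennreal (sqrt (F0 x * G e x)) \<partial>base) ^ n \<le> test_risk n p q \<psi> \<theta> \<eta> \<epsilon>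
    + ennreal (\<Sum>z\<in>labels n. \<Sum>\<sigma>\<in>labels n. label_prior n e z \<sigma> * of_bool (label_dist n z \<sigma> \<le> \<epsilon>)) + ennreal (1/2)"
proof -
  define R0 where "R0 = (SUP (z, \<sigma>) \<in> {(z, \<sigma>). z \<in> labels n \<and> \<sigma> \<in> labels n \<and> label_dist n z \<sigma> = 0}.
        \<integral>\<^sup>+ x. ennreal (\<psi> x) \<partial>law z \<sigma>)"
  define R1 where "R1 = (SUP (z, \<sigma>) \<in> {(z, \<sigma>). z \<in> labels n \<and> \<sigma> \<in> labels n \<and> label_dist n z \<sigma> > \<epsilon>}.
        \<integral>\<^sup>+ x. ennreal (1 - \<psi> x) \<partial>law z \<sigma>)"
  have R: "test_risk n p q \<psi> \<theta> \<eta> \<epsilon> = R0 + R1" by (simp add: test_risk_def R0_def R1_def)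
  have n0: "n > 0" using n by simp
  have sQ: "sets Q = sets (data_space n p q)"
    unfolding data_space_def by (intro sets_PiM_cong refl sets_sample)
  have spQ: "space Q = space (data_space n p q)" by (rule sets_eq_imp_space_eq[OF sQ])
  have \<psi>m [measurable]: "\<psi> \<in> borel_measurable Q"
    using \<psi> by (subst measurable_cong_sets[OF sQ refl]) (simp add: tests_def)
  have \<psi>b: "0 \<le> \<psi> x" "\<psi> x \<le> 1" if "x \<in> space Q" for x
    using \<psi> that[unfolded spQ] by (auto simp: tests_def)
  have sJ: "space (law z \<sigma>) = space Q" for z \<sigma>
    unfolding joint_law_def by (intro sets_eq_imp_space_eq sets_PiM_cong refl) (simp only: sets_sample)
  have pJ: "prob_space (law z \<sigma>)" for z \<sigma>
    unfolding joint_law_def by (intro prob_space_PiM prob_space_sample)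
  have sum1: "(\<Sum>z\<in>labels n. \<Sum>\<sigma>\<in>labels n. ennreal (label_prior n e' z \<sigma>)) = 1" if "0 \<le> e'" "e' \<le> 1" for e'
    using sum_label_prior[of n e'] by (simp add: sum_ennreal sum_nonneg label_prior_nonneg that)
  have null: "(\<integral>\<^sup>+x. ennreal (\<Prod>i<n. F0 (x i)) * ennreal (\<psi> x) \<partial>Q) \<le> R0"
  proof -
    have G0: "G 0 = F0" by (simp add: fun_eq_iff G_def)
    have "(\<integral>\<^sup>+x. ennreal (\<Prod>i<n. F0 (x i)) * ennreal (\<psi> x) \<partial>Q)
        = (\<Sum>z\<in>labels n. \<Sum>\<sigma>\<in>labels n. ennreal (label_prior n 0 z \<sigma>) * (\<integral>\<^sup>+x. ennreal (\<psi> x) \<partial>law z \<sigma>))"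
      using mixture[of 0 "\<lambda>x. ennreal (\<psi> x)"] \<psi>m by (simp only: G0) simp
    also have "\<dots> \<le> (\<Sum>z\<in>labels n. \<Sum>\<sigma>\<in>labels n. ennreal (label_prior n 0 z \<sigma>) * R0)"
    proof (intro sum_mono)
      fix z \<sigma> assume z: "z \<in> labels n" "\<sigma> \<in> labels n"
      show "ennreal (label_prior n 0 z \<sigma>) * (\<integral>\<^sup>+x. ennreal (\<psi> x) \<partial>law z \<sigma>) \<le> ennreal (label_prior n 0 z \<sigma>) * R0"
      proof (cases "\<forall>i<n. z i = \<sigma> i")
        case True
        have "label_dist n z \<sigma> = 0"
          unfolding label_dist_def using True by (simp add: min_def sum_nonneg)
        then show ?thesis using z unfolding R0_def by (intro mult_left_mono SUP_upper2[of "(z, \<sigma>)"]) auto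
      next
        case False
        then have "label_prior n 0 z \<sigma> = 0" unfolding label_prior_def by (auto simp: flip_weight_def)
        then show ?thesis by simp
      qed
    qed
    also have "\<dots> = R0" using sum1[of 0] by (simp add: sum_distrib_right[symmetric])
    finally show ?thesis .
  qed
  define bad where "bad = (\<Sum>z\<in>labels n. \<Sum>\<sigma>\<in>labels n. label_prior n e z \<sigma> * of_bool (label_dist n z \<sigma> \<le> \<epsilon>))"
  have alt: "(\<integral>\<^sup>+x. ennreal (\<Prod>i<n. G e (x i)) * ennreal (1 - \<psi> x) \<partial>Q) \<le> R1 + ennreal bad"
  proof -
    have "(\<integral>\<^sup>+x. ennreal (\<Prod>i<n. G e (x i)) * ennreal (1 - \<psi> x) \<partial>Q)
        = (\<Sum>z\<in>labels n. \<Sum>\<sigma>\<in>labels n. ennreal (label_prior n e z \<sigma>) * (\<integral>\<^sup>+x. ennreal (1 - \<psi> x) \<partial>law z \<sigma>))"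
      by (rule mixture[OF e, symmetric]) measurable
    also have "\<dots> \<le> (\<Sum>z\<in>labels n. \<Sum>\<sigma>\<in>labels n. ennreal (label_prior n e z \<sigma>) * (R1 + of_bool (label_dist n z \<sigma> \<le> \<epsilon>)))"
    proof (intro sum_mono mult_left_mono)
      fix z \<sigma> assume z: "z \<in> labels n" "\<sigma> \<in> labels n"
      show "(\<integral>\<^sup>+x. ennreal (1 - \<psi> x) \<partial>law z \<sigma>) \<le> R1 + of_bool (label_dist n z \<sigma> \<le> \<epsilon>)"
      proof (cases "label_dist n z \<sigma> \<le> \<epsilon>")
        case True
        have "(\<integral>\<^sup>+x. ennreal (1 - \<psi> x) \<partial>law z \<sigma>) \<le> (\<integral>\<^sup>+x. 1 \<partial>law z \<sigma>)"
          using \<psi>b by (intro nn_integral_mono) (simp only: sJ, simp add: ennreal_le_1)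
        also have "\<dots> = 1" using prob_space.emeasure_space_1[OF pJ] by simp
        finally show ?thesis using True by (simp add: add_increasing)
      next
        case False
        then show ?thesis using z unfolding R1_def by (auto intro!: SUP_upper2[of "(z, \<sigma>)"])
      qed
    qed simp
    also have "\<dots> = (\<Sum>z\<in>labels n. \<Sum>\<sigma>\<in>labels n. ennreal (label_prior n e z \<sigma>)) * R1
        + (\<Sum>z\<in>labels n. \<Sum>\<sigma>\<in>labels n. ennreal (label_prior n e z \<sigma>) * of_bool (label_dist n z \<sigma> \<le> \<epsilon>))"
      by (simp only: distrib_left sum.distrib sum_distrib_right)
    also have "(\<Sum>z\<in>labels n. \<Sum>\<sigma>\<in>labels n. ennreal (label_prior n e z \<sigma>) * of_bool (label_dist n z \<sigma> \<le> \<epsilon>)) = ennreal bad"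
    proof -
      have "ennreal (label_prior n e z \<sigma>) * of_bool b = ennreal (label_prior n e z \<sigma> * of_bool b)" for z \<sigma> b
        by (cases b) simp_all
      then show ?thesis unfolding bad_def by (simp add: sum_ennreal sum_nonneg label_prior_nonneg e)
    qed
    finally show ?thesis using sum1[OF e] by simp
  qed
  have m: "(\<lambda>x. ennreal (\<Prod>i<n. F0 (x i))) \<in> borel_measurable Q" "(\<lambda>x. ennreal (\<Prod>i<n. G e (x i))) \<in> borel_measurable Q"
    "(\<lambda>x. ennreal (\<psi> x)) \<in> borel_measurable Q" "(\<lambda>x. ennreal (1 - \<psi> x)) \<in> borel_measurable Q"
    by measurable
  have one: "(\<integral>\<^sup>+x. ennreal (\<Prod>i<n. F0 (x i)) \<partial>Q) = 1" "(\<integral>\<^sup>+x. ennreal (\<Prod>i<n. G e (x i)) \<partial>Q) = 1"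
  proof -
    have "(\<integral>\<^sup>+x. ennreal (\<Prod>i<n. F0 (x i)) \<partial>Q) = (\<integral>\<^sup>+x. ennreal (F0 x) \<partial>base) ^ n"
      by (rule nn_integral_prod_base) (use F_pos in \<open>auto intro: less_imp_le\<close>)
    then show "(\<integral>\<^sup>+x. ennreal (\<Prod>i<n. F0 (x i)) \<partial>Q) = 1" by (simp only: nn_integral_F power_one)
    have "(\<integral>\<^sup>+x. ennreal (\<Prod>i<n. G e (x i)) \<partial>Q) = (\<integral>\<^sup>+x. ennreal (G e x) \<partial>base) ^ n"
      by (rule nn_integral_prod_base) (use G_nonneg[OF e] in auto)
    then show "(\<integral>\<^sup>+x. ennreal (\<Prod>i<n. G e (x i)) \<partial>Q) = 1" by (simp only: nn_integral_G[OF e] power_one)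
  qed
  have "(\<integral>\<^sup>+x. ennreal (sqrt (F0 x * G e x)) \<partial>base) ^ n = (\<integral>\<^sup>+x. ennreal (\<Prod>i<n. sqrt (F0 (x i) * G e (x i))) \<partial>Q)"
    by (rule nn_integral_prod_base[symmetric]) (measurable, simp add: F_pos(1) G_nonneg[OF e] less_imp_le)
  also have "\<dots> \<le> (\<integral>\<^sup>+x. (ennreal (\<Prod>i<n. F0 (x i)) * ennreal (\<psi> x) + ennreal (\<Prod>i<n. G e (x i)) * ennreal (1 - \<psi> x))
        + ennreal (1/4) * (ennreal (\<Prod>i<n. F0 (x i)) + ennreal (\<Prod>i<n. G e (x i))) \<partial>Q)"
  proof (intro nn_integral_mono)
    fix x assume x: "x \<in> space Q"
    define a where "a = (\<Prod>i<n. F0 (x i))"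
    define b where "b = (\<Prod>i<n. G e (x i))"
    have ab: "0 \<le> a" "0 \<le> b"
      unfolding a_def b_def by (intro prod_nonneg ballI less_imp_le F_pos(1) G_nonneg e)+
    have "(\<Prod>i<n. sqrt (F0 (x i) * G e (x i))) = sqrt (a * b)"
      by (simp only: a_def b_def prod.distrib prod_sqrt)
    also have "\<dots> \<le> a * \<psi> x + b * (1 - \<psi> x) + (a + b) / 4"
      by (rule sqrt_mult_le_convex[OF ab \<psi>b[OF x]])
    finally have "ennreal (\<Prod>i<n. sqrt (F0 (x i) * G e (x i))) \<le> ennreal ((a * \<psi> x + b * (1 - \<psi> x)) + 1/4 * (a + b))"
      by (intro ennreal_leI) simp
    also have "\<dots> = (ennreal a * ennreal (\<psi> x) + ennreal b * ennreal (1 - \<psi> x)) + ennreal (1/4) * (ennreal a + ennreal b)"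
    proof -
      have "ennreal a * ennreal (\<psi> x) = ennreal (a * \<psi> x)" "ennreal b * ennreal (1 - \<psi> x) = ennreal (b * (1 - \<psi> x))"
        "ennreal a + ennreal b = ennreal (a + b)"
        using ab \<psi>b[OF x] by (simp_all add: ennreal_mult ennreal_plus)
      moreover have "ennreal (1/4) * ennreal (a + b) = ennreal (1/4 * (a + b))"
        by (rule ennreal_mult[symmetric]) (use ab in auto)
      ultimately show ?thesis using ab \<psi>b[OF x] by (simp only: ennreal_plus[symmetric] mult_nonneg_nonneg add_nonneg_nonneg diff_ge_0_iff_ge divide_nonneg_nonneg zero_le_one zero_le_numeral)
    qed
    finally show "ennreal (\<Prod>i<n. sqrt (F0 (x i) * G e (x i))) \<le> (ennreal (\<Prod>i<n. F0 (x i)) * ennreal (\<psi> x) + ennreal (\<Prod>i<n. G e (x i)) * ennreal (1 - \<psi> x))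
        + ennreal (1/4) * (ennreal (\<Prod>i<n. F0 (x i)) + ennreal (\<Prod>i<n. G e (x i)))" by (simp only: a_def b_def)
  qed
  also have "\<dots> = ((\<integral>\<^sup>+x. ennreal (\<Prod>i<n. F0 (x i)) * ennreal (\<psi> x) \<partial>Q) + (\<integral>\<^sup>+x. ennreal (\<Prod>i<n. G e (x i)) * ennreal (1 - \<psi> x) \<partial>Q))
        + ennreal (1/4) * (1 + 1)"
  proof -
    note t = borel_measurable_times_ennreal[OF m(1,3)] borel_measurable_times_ennreal[OF m(2,4)] borel_measurable_add[OF m(1,2)]
    have c: "(\<lambda>x. ennreal (1/4) * (ennreal (\<Prod>i<n. F0 (x i)) + ennreal (\<Prod>i<n. G e (x i)))) \<in> borel_measurable Q"
      by (rule borel_measurable_times_ennreal[OF borel_measurable_const t(3)])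
    show ?thesis
      unfolding nn_integral_add[OF borel_measurable_add[OF t(1,2)] c] nn_integral_add[OF t(1,2)]
        nn_integral_cmult[OF t(3)] nn_integral_add[OF m(1,2)] one ..
  qed
  also have "ennreal (1/4) * (1 + 1) = ennreal (1/2)"
  proof -
    have "ennreal (1/4) * ennreal 2 = ennreal (1/4 * 2)" by (rule ennreal_mult[symmetric]) auto
    then show ?thesis by simp
  qed
  also have "((\<integral>\<^sup>+x. ennreal (\<Prod>i<n. F0 (x i)) * ennreal (\<psi> x) \<partial>Q) + (\<integral>\<^sup>+x. ennreal (\<Prod>i<n. G e (x i)) * ennreal (1 - \<psi> x) \<partial>Q)) + ennreal (1/2)
     \<le> (R0 + (R1 + ennreal bad)) + ennreal (1/2)"
    by (intro add_right_mono add_mono null alt)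
  finally show ?thesis unfolding R bad_def by (simp only: add.assoc)
qed

end


text \<open>By Bernoulli's inequality the affinity of all n observations is at least 7/8.
  Subtracting 1/8 for labels too close to the null and the loss 1/2 leaves 1/4.\<close>

lemma (in testing_setup) minimax_risk_ge:
  assumes \<rho>: "1 \<le> \<rho>" "\<rho> \<le> 2" and \<kappa>: "0 \<le> \<kappa>" "\<kappa> \<le> 1" and e: "0 \<le> e" "e \<le> 1"
  defines "L \<equiv> mgf_exponent r s \<rho> \<kappa>"
  assumes D: "real n * (e powr \<rho> * (1 + 8 * real n powr L) / 2) \<le> 1/8"
    and bad: "exp (real n * \<epsilon>) * ((1 - e + e * exp (-1)) ^ n + ((1 - e) * exp (-1) + e) ^ n) \<le> 1/8"
  shows "ennreal (1/4) \<le> minimax_risk n p q \<theta> \<eta> \<epsilon>"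
  unfolding minimax_risk_def
proof (rule INF_greatest)
  fix \<psi> assume \<psi>: "\<psi> \<in> tests n p q"
  define d where "d = e powr \<rho> * (1 + 8 * real n powr L) / 2"
  define B where "B = (\<Sum>z\<in>labels n. \<Sum>\<sigma>\<in>labels n. label_prior n e z \<sigma> * of_bool (label_dist n z \<sigma> \<le> \<epsilon>))"
  have n0: "n > 0" using n by simp
  have d0: "d \<ge> 0" by (simp add: d_def)
  have "1 * d \<le> real n * d" using n0 d0 by (intro mult_right_mono) auto
  then have d1: "d \<le> 1/8" using D by (simp add: d_def)
  let ?\<alpha> = "\<integral>\<^sup>+x. ennreal (sqrt (F0 x * G e x)) \<partial>base"
  have \<alpha>: "1 \<le> ?\<alpha> + ennreal d" unfolding d_def L_def by (rule affinity_bound[OF \<rho> \<kappa> e])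
  have "ennreal (7/8) \<le> ?\<alpha> ^ n"
  proof (cases "?\<alpha>")
    case (real A)
    have "ennreal 1 \<le> ennreal (A + d)" using \<alpha> real d0 by (simp add: ennreal_plus)
    then have "1 \<le> A + d" using real d0 by (subst (asm) ennreal_le_iff) auto
    then have A: "A \<ge> 1 - d" by simp
    have "7/8 \<le> 1 + real n * (- d)" using D by (simp add: d_def)
    also have "\<dots> \<le> (1 + (- d)) ^ n" using d1 by (intro Bernoulli_inequality) auto
    also have "\<dots> \<le> A ^ n" using A d1 by (intro power_mono) auto
    finally have "ennreal (7/8) \<le> ennreal (A ^ n)" by (rule ennreal_leI)
    then show ?thesis unfolding real(2) using real(1) by (simp only: ennreal_power)
  next
    case top
    then show ?thesis using n0 by (simp only: top_power_ennreal) simp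
  qed
  also have "\<dots> \<le> test_risk n p q \<psi> \<theta> \<eta> \<epsilon> + ennreal B + ennreal (1/2)"
    unfolding B_def by (rule test_risk_ge_affinity[OF \<psi> e])
  also have "\<dots> \<le> test_risk n p q \<psi> \<theta> \<eta> \<epsilon> + ennreal (1/8) + ennreal (1/2)"
    using label_prior_close[OF n0 e, of \<epsilon>] bad
    by (intro add_mono ennreal_leI order_refl) (simp add: B_def)
  finally have main: "ennreal (7/8) \<le> test_risk n p q \<psi> \<theta> \<eta> \<epsilon> + ennreal (1/8) + ennreal (1/2)" .
  show "ennreal (1/4) \<le> test_risk n p q \<psi> \<theta> \<eta> \<epsilon>"
  proof (cases "test_risk n p q \<psi> \<theta> \<eta> \<epsilon>")
    case (real R)
    have "ennreal R + ennreal (1/8) + ennreal (1/2) = ennreal (R + 1/8 + 1/2)"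
      using ennreal_plus[of R "1/8"] ennreal_plus[of "R + 1/8" "1/2"] real(1) by simp
    then have "ennreal (7/8) \<le> ennreal (R + 1/8 + 1/2)" using main unfolding real(2) by simp
    then have "7/8 \<le> R + 1/8 + 1/2" using real(1) by (subst (asm) ennreal_le_iff) auto
    then show ?thesis unfolding real(2) by (intro ennreal_leI) simp
  qed simp
qed

text \<open>The bound on the affinity deficit of the sample is of order n e^\<rho> (1 + n^L) with e
  of order n^(- \<beta>). It vanishes because 1 + L \<le> \<rho> \<open>beta_star\<close> < \<rho>
  \<beta>, and L \<ge> 0 takes care of the summand without n^L.\<close>

lemma minimax_risk_liminf_pos:
  fixes \<beta> r s :: real
    and p q :: "nat \<Rightarrow> nat"
    and \<theta> \<eta> :: "nat \<Rightarrow> nat \<Rightarrow> real"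
    and \<epsilon> :: "nat \<Rightarrow> real"
  assumes \<beta>: "0 < \<beta>" "\<beta> < 1" and r: "r > 0" and s: "s \<ge> 0"
    and eps: "\<And>n. \<epsilon> n = real n powr (- \<beta>)"
    and hyp: "\<And>n. n \<ge> 2 \<Longrightarrow> testing_setup r s n (p n) (q n) (\<theta> n) (\<eta> n)"
    and gt: "\<beta> > beta_star r s"
  shows "liminf (\<lambda>n. minimax_risk n (p n) (q n) (\<theta> n) (\<eta> n) (\<epsilon> n)) > 0"
proof -
  have bs: "beta_star r s < 1" using gt \<beta> by simp
  obtain \<rho> \<kappa> where \<rho>: "1 \<le> \<rho>" "\<rho> \<le> 2" and \<kappa>: "0 \<le> \<kappa>" "\<kappa> \<le> 1"
    and L1: "1 + mgf_exponent r s \<rho> \<kappa> \<le> \<rho> * beta_star r s"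
    and L0: "mgf_exponent r s \<rho> \<kappa> \<ge> 0"
    by (rule beta_star_witness[OF r s]) (use bs in blast)
  define L where "L = mgf_exponent r s \<rho> \<kappa>"
  have "\<rho> * beta_star r s < \<rho> * \<beta>" using gt \<rho> by (intro mult_strict_left_mono) auto
  then have L: "1 + L - \<rho> * \<beta> < 0" "L \<ge> 0" using L1 L0 by (simp_all add: L_def)
  define x1 where "x1 = 1 - \<rho> * \<beta>"
  define x2 where "x2 = 1 - \<rho> * \<beta> + L"
  have x: "x1 < 0" "x2 < 0" using L by (simp_all add: x1_def x2_def)
  define \<gamma> where "\<gamma> = 1 - \<beta>"
  have \<gamma>: "0 < \<gamma>" "\<gamma> < 1" using \<beta> by (simp_all add: \<gamma>_def)
  have "(\<lambda>n::nat. 4 powr \<rho> / 2 * (real n powr x1 + 8 * real n powr x2)) \<longlonglongrightarrow> 4 powr \<rho> / 2 * (0 + 8 * 0)"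
  proof (intro tendsto_intros)
    show "(\<lambda>n::nat. real n powr x1) \<longlonglongrightarrow> 0" "(\<lambda>n::nat. real n powr x2) \<longlonglongrightarrow> 0" using x by real_asymp+
  qed
  then have "\<forall>\<^sub>F n::nat in sequentially. 4 powr \<rho> / 2 * (real n powr x1 + 8 * real n powr x2) < 1/8"
    by (rule order_tendstoD) simp
  moreover have "\<forall>\<^sub>F n::nat in sequentially. exp (- (real n powr \<gamma>)) < 1/16"
    using \<gamma> by real_asymp
  moreover have "\<forall>\<^sub>F n::nat in sequentially. exp (5 * real n powr \<gamma> - real n / 2) < 1/16"
    using \<gamma> by real_asymp
  moreover have "\<forall>\<^sub>F n::nat in sequentially. real n powr (- \<beta>) < 1/4"
    using \<beta> by real_asymp
  moreover have "\<forall>\<^sub>F n::nat in sequentially. n \<ge> 2" by (rule eventually_ge_at_top)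
  ultimately have "\<forall>\<^sub>F n in sequentially. ennreal (1/4) \<le> minimax_risk n (p n) (q n) (\<theta> n) (\<eta> n) (\<epsilon> n)"
  proof eventually_elim
    case (elim n)
    interpret T: testing_setup r s n "p n" "q n" "\<theta> n" "\<eta> n" by (rule hyp) (rule elim)
    \<comment> \<open>The factor 4 makes the typical distance exceed \<epsilon>: the disagreement of
      z with \<sigma> contributes at most exp (n \<epsilon> - 2 n \<epsilon>) to the mass of close
      labels. Closeness of z to - \<sigma> contributes at most exp (5 n \<epsilon> - n / 2).\<close>
    define e where "e = 4 * \<epsilon> n"
    have n: "real n > 0" using elim(5) by simp
    have e: "0 \<le> e" "e \<le> 1" using elim(4) by (simp_all add: e_def eps)
    have ne: "real n * \<epsilon> n = real n powr \<gamma>" using n by (simp add: eps \<gamma>_def powr_diff powr_minus field_simps)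
    have e1: "exp (-1) \<le> (1/2 :: real)"
      using exp_ge_add_one_self[of "1::real"] by (simp add: exp_minus field_simps)
    show ?case
    proof (rule T.minimax_risk_ge[OF \<rho> \<kappa> e])
      have "e powr \<rho> = 4 powr \<rho> * real n powr (- (\<rho> * \<beta>))"
        using n by (simp add: e_def eps powr_mult powr_powr mult.commute)
      then have "real n * (e powr \<rho> * (1 + 8 * real n powr L) / 2)
          = 4 powr \<rho> / 2 * (real n powr 1 * real n powr (- (\<rho> * \<beta>)) + 8 * (real n powr 1 * real n powr (- (\<rho> * \<beta>)) * real n powr L))"
        using n by (simp add: field_simps)
      also have "\<dots> = 4 powr \<rho> / 2 * (real n powr x1 + 8 * real n powr x2)"
        by (simp only: powr_add[symmetric]) (simp add: x1_def x2_def)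
      also have "\<dots> \<le> 1/8" using elim(1) by simp
      finally show "real n * (e powr \<rho> * (1 + 8 * real n powr mgf_exponent r s \<rho> \<kappa>) / 2) \<le> 1/8"
        by (simp only: L_def)
      have ee: "e * exp (-1) \<le> e / 2" using e e1 mult_left_mono[OF e1 e(1)] by simp
      have "(1 - e + e * exp (-1)) ^ n \<le> exp (- (2 * \<epsilon> n)) ^ n"
      proof (rule power_mono)
        have "1 - e + e * exp (-1) \<le> 1 + - (2 * \<epsilon> n)" using ee by (simp add: e_def)
        also have "\<dots> \<le> exp (- (2 * \<epsilon> n))" by (rule exp_ge_add_one_self)
        finally show "1 - e + e * exp (-1) \<le> exp (- (2 * \<epsilon> n))" .
      qed (use e in \<open>simp add: add_nonneg_nonneg\<close>)
      also have "\<dots> = exp (- (2 * (real n * \<epsilon> n)))" by (simp add: mult_ac flip: exp_of_nat_mult)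
      finally have 1: "(1 - e + e * exp (-1)) ^ n \<le> exp (- (2 * real n powr \<gamma>))" unfolding ne .
      have "((1 - e) * exp (-1) + e) ^ n \<le> exp (- (1/2) + 4 * \<epsilon> n) ^ n"
      proof (rule power_mono)
        have "(1 - e) * exp (-1) \<le> 1 * (1/2)" using e e1 by (intro mult_mono) auto
        then have "(1 - e) * exp (-1) + e \<le> 1 + (- (1/2) + 4 * \<epsilon> n)" by (simp add: e_def)
        also have "\<dots> \<le> exp (- (1/2) + 4 * \<epsilon> n)" by (rule exp_ge_add_one_self)
        finally show "(1 - e) * exp (-1) + e \<le> exp (- (1/2) + 4 * \<epsilon> n)" .
      qed (use e in \<open>simp add: add_nonneg_nonneg\<close>)
      also have "\<dots> = exp (4 * (real n * \<epsilon> n) - real n / 2)" by (simp add: algebra_simps flip: exp_of_nat_mult)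
      finally have 2: "((1 - e) * exp (-1) + e) ^ n \<le> exp (4 * real n powr \<gamma> - real n / 2)" unfolding ne .
      have "exp (real n * \<epsilon> n) * ((1 - e + e * exp (-1)) ^ n + ((1 - e) * exp (-1) + e) ^ n)
          \<le> exp (real n powr \<gamma>) * (exp (- (2 * real n powr \<gamma>)) + exp (4 * real n powr \<gamma> - real n / 2))"
        unfolding ne by (intro mult_left_mono add_mono 1 2) simp
      also have "\<dots> = exp (- (real n powr \<gamma>)) + exp (5 * real n powr \<gamma> - real n / 2)"
        unfolding distrib_left exp_add[symmetric] by simp
      also have "\<dots> \<le> 1/8" using elim(2,3) by simp
      finally show "exp (real n * \<epsilon> n) * ((1 - e + e * exp (-1)) ^ n + ((1 - e) * exp (-1) + e) ^ n) \<le> 1/8" .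
    qed
  qed
  then have "ennreal (1/4) \<le> liminf (\<lambda>n. minimax_risk n (p n) (q n) (\<theta> n) (\<eta> n) (\<epsilon> n))"
    by (rule Liminf_bounded)
  moreover have "(0::ennreal) < ennreal (1/4)" by simp
  ultimately show ?thesis by (rule less_le_trans[rotated])
qed

theorem theorem3p3:
  fixes \<beta> r s \<delta> :: real
    and p q :: "nat \<Rightarrow> nat"
    and \<theta> \<eta> :: "nat \<Rightarrow> nat \<Rightarrow> real"
    and \<epsilon> :: "nat \<Rightarrow> real"
  assumes "0 < \<beta>" "\<beta> < 1" and "r > 0" and "s \<ge> 0" and "\<delta> > 0"
    and "\<And>n. \<epsilon> n = real n powr (- \<beta>)"
    and "\<And>n. n \<ge> 2 \<Longrightarrow>
      2 * L2_set (\<theta> n) {..<p n} * L2_set (\<eta> n) {..<q n} /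
        sqrt ((L2_set (\<theta> n) {..<p n})\<^sup>2 + (L2_set (\<eta> n) {..<q n})\<^sup>2)
      = sqrt (2 * r * ln (real n))"
    and "\<And>n. n \<ge> 2 \<Longrightarrow>
      \<bar>(L2_set (\<theta> n) {..<p n})\<^sup>2 - (L2_set (\<eta> n) {..<q n})\<^sup>2\<bar> /
        sqrt ((L2_set (\<theta> n) {..<p n})\<^sup>2 + (L2_set (\<eta> n) {..<q n})\<^sup>2)
      = sqrt (2 * s * ln (real n))"
  shows "(\<beta> < beta_star r s \<longrightarrow>
           (\<lambda>n. test_risk n (p n) (q n) (psi_dot n (p n) (q n) r s \<delta> (\<theta> n) (\<eta> n)) (\<theta> n) (\<eta> n) (\<epsilon> n))
             \<longlonglongrightarrow> 0) \<and>
         (\<beta> > beta_star r s \<longrightarrow>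
           liminf (\<lambda>n. minimax_risk n (p n) (q n) (\<theta> n) (\<eta> n) (\<epsilon> n)) > 0)"
proof -
  have "testing_setup r s n (p n) (q n) (\<theta> n) (\<eta> n)" if "n \<ge> 2" for n
    using assms that by (intro testing_setup.intro)
  with assms show ?thesis
    by (intro conjI impI psi_dot_risk_tendsto[where \<beta> = \<beta>] minimax_risk_liminf_pos[where \<beta> = \<beta>])
qed

end
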